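(* Let $X$ be a perfectly normal space equipped with a continuous scaling $T$ and with the ideal $\mathcal{S}=\mathcal{S}_\tau$ generated by a continuous finite modulus $\tau$. Let $S_\tau^1=\{x\in X:\tau(x)=1\}$. Let $\xi$ be a Borel measurable random element in $X$, and let $\sigma$ be a non-zero finite Borel measure on $S_\tau^1$. Then the following statements are equivalent. (i) $\xi\in\mathrm{RV}(X,T,\mathcal{S},g,\mu)$ for some $g$ and some tau-additive measure $\mu$ such that, for some $\alpha>0$, $\mu(B)=\alpha\int_0^\infty\sigma(T_tB)\,t^{\alpha-1}\,dt$ for all Borel $B\in\mathcal{S}$. (ii) The random variable $\tau(\xi)$ is regularly varying with a normalising function $g\in\mathrm{RV}_\alpha$ for some $\alpha>0$, the measure $\sigma$ is tau-additive, and $$\mathbf{P}\big\{T_{\tau(\xi)^{-1}}\xi\in\cdot\;\big|\;\tau(\xi)>t\big\}\to\sigma(\cdot)/\sigma(S_\tau^1)\quad\text{as }t\to\infty$$ in the sense of weak convergence of probability measures on $S_\tau^1$. (iii) The measure $\sigma$ is tau-additive, and for some $\alpha>0$, $$\mathbf{P}\big\{(T_{\tau(\xi)^{-1}}\xi,\,t^{-1}\tau(\xi))\in A\times(u,\infty)\;\big|\;\tau(\xi)>t\big\}\to\frac{(\sigma\otimes\theta_\alpha)(A\times(u,\infty))}{\sigma(S_\tau^1)}\quad\text{as }t\to\infty$$ for all Borel $\sigma$-continuity sets $A\subset S_\tau^1$ and all $u\ge1$.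
   Context: A space is perfectly normal if any two disjoint closed sets $F_0,F_1$ are precisely separated by a continuous $f:X\to[0,1]$ with $f^{-1}(0)=F_0$, $f^{-1}(1)=F_1$; then Borel and Baire $\sigma$-algebras coincide. A continuous scaling is a family of maps $T_t:X\to X$, $t>0$, with $T_tT_s=T_{ts}$, $T_1=\mathrm{id}$ and $(x,t)\mapsto T_tx$ jointly continuous. A continuous finite modulus is a continuous $\tau:X\to[0,\infty)$ with $\tau(T_tx)=t\tau(x)$; it generates the ideal $\mathcal{S}_\tau=\{A\subset X:\inf_A\tau>0\}$, whose union is $\{\tau>0\}$. $T_tB=\{T_tx:x\in B\}$, and $\sigma(T_tB)$ means $\sigma(T_tB\cap S_\tau^1)$. $\xi\in\mathrm{RV}(X,T,\mathcal{S},g,\mu)$ means: $g:[0,\infty)\to[0,\infty)$ is measurable with $g(t)\to\infty$; $\mu$ is a Borel measure, finite on all Borel sets in $\mathcal{S}$, vanishing outside the union of the sets in $\mathcal{S}$, with $\mu(B)>0$ for some $B\in\mathcal{S}$; and $g(t)\mathbf{E}f(T_{t^{-1}}\xi)\to\int f\,d\mu$ as $t\to\infty$ for all bounded continuous $f$ on $\{\tau>0\}$ whose support (closure in $X$ of $\{f\neq0\}$) belongs to $\mathcal{S}$ (extended by zero). A random variable $\zeta\ge0$ is regularly varying with normalising function $g$ if $\zeta\in\mathrm{RV}([0,\infty),\cdot,\mathcal{R}_0,g,\mu')$ for some $\mu'$, with the linear scaling $T_tx=tx$ and $\mathcal{R}_0=\{A\subset[0,\infty):\inf A>0\}$. $\mathrm{RV}_\alpha$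 is the class of positive measurable functions $g$ with $g(xt)/g(t)\to x^\alpha$ as $t\to\infty$ for all $x>0$. $\theta_\alpha$ is the measure on $(0,\infty)$ with $\theta_\alpha(ds)=\alpha s^{-\alpha-1}ds$. A measure $\mu$ is tau-additive if $\mu(\bigcup_\gamma G_\gamma)=\lim_\gamma\mu(G_\gamma)$ for every increasing net $(G_\gamma)$ of functionally open sets (complements of zero sets of continuous real functions) whose union is functionally open. A Borel set $A\subset S_\tau^1$ is a $\sigma$-continuity set if its boundary in $S_\tau^1$ has $\sigma$-measure zero. *)

theory Defs
  imports "HOL-Probability.Probability"
begin

(* A topological space is a carrier set X in a type of class topological_space, with the
   subspace topology top_of_set X and the Borel sigma-algebra restrict_space borel X.
   The carriers that occur are a whole type, the half-line {0..}, and the unit sphere of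
   a modulus. *)

section \<open>Perfectly normal spaces and tau-additive measures\<close>

(* No T1 axiom is included. *)
definition perfectly_normal_on :: "'a::topological_space set \<Rightarrow> bool" where
  "perfectly_normal_on X \<longleftrightarrow>
    (\<forall>F0 F1. closedin (top_of_set X) F0 \<and> closedin (top_of_set X) F1 \<and> F0 \<inter> F1 = {} \<longrightarrow>
      (\<exists>f::'a \<Rightarrow> real. continuous_on X f \<and> f ` X \<subseteq> {0..1} \<and>
         {x \<in> X. f x = 0} = F0 \<and> {x \<in> X. f x = 1} = F1))"

definition functionally_open_in :: "'a::topological_space set \<Rightarrow> 'a set \<Rightarrow> bool" where
  "functionally_open_in X U \<longleftrightarrow>
    (\<exists>h::'a \<Rightarrow> real. continuous_on X h \<and> U = X - {x \<in> X. h x = 0})"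

(* An increasing net of sets enters only through its range, which is a nonempty family
   directed by inclusion. Such a family is itself a net, indexed by its own members, and the
   filter below, generated by the tails {H \<in> \<G>. G \<subseteq> H}, is the one of limits along that net. *)
definition tau_additive_on :: "'a::topological_space set \<Rightarrow> 'a measure \<Rightarrow> bool" where
  "tau_additive_on X \<mu> \<longleftrightarrow>
    (\<forall>\<G>. \<G> \<noteq> {} \<and> (\<forall>G\<in>\<G>. functionally_open_in X G) \<and>
         (\<forall>G\<in>\<G>. \<forall>H\<in>\<G>. \<exists>K\<in>\<G>. G \<subseteq> K \<and> H \<subseteq> K) \<and>
         functionally_open_in X (\<Union>\<G>) \<longrightarrow>
      (emeasure \<mu> \<longlongrightarrow> emeasure \<mu> (\<Union>\<G>)) (INF G\<in>\<G>. principal {H \<in> \<G>. G \<subseteq> H}))"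


section \<open>Scalings, moduli and ideals\<close>

(* Only the values T t x with t > 0 and x \<in> X matter. *)
definition continuous_scaling_on ::
    "'a::topological_space set \<Rightarrow> (real \<Rightarrow> 'a \<Rightarrow> 'a) \<Rightarrow> bool" where
  "continuous_scaling_on X T \<longleftrightarrow>
    (\<forall>t>0. \<forall>x\<in>X. T t x \<in> X) \<and>
    (\<forall>t>0. \<forall>s>0. \<forall>x\<in>X. T t (T s x) = T (t * s) x) \<and>
    (\<forall>x\<in>X. T 1 x = x) \<and>
    continuous_on (X \<times> {0<..}) (\<lambda>(x, t). T t x)"

definition continuous_finite_modulus_on ::
    "'a::topological_space set \<Rightarrow> (real \<Rightarrow> 'a \<Rightarrow> 'a) \<Rightarrow> ('a \<Rightarrow> real) \<Rightarrow> bool" where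
  "continuous_finite_modulus_on X T \<tau> \<longleftrightarrow>
    continuous_on X \<tau> \<and> (\<forall>x\<in>X. 0 \<le> \<tau> x) \<and> (\<forall>t>0. \<forall>x\<in>X. \<tau> (T t x) = t * \<tau> x)"

(* The infimum is taken in ereal, so that the empty set belongs to the ideal. *)
definition modulus_ideal :: "'a set \<Rightarrow> ('a \<Rightarrow> real) \<Rightarrow> 'a set set" where
  "modulus_ideal X \<tau> = {A. A \<subseteq> X \<and> 0 < (INF x\<in>A. ereal (\<tau> x))}"

definition modulus_sphere :: "'a set \<Rightarrow> ('a \<Rightarrow> real) \<Rightarrow> 'a set" where
  "modulus_sphere X \<tau> = {x \<in> X. \<tau> x = 1}"


section \<open>Regular variation\<close>

(* The random element \<xi> lives on the probability space M. A test function f is defined on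
   \<Union>S and extended by zero; its support is the closure of {f \<noteq> 0} in X. *)
definition in_RV ::
    "'w measure \<Rightarrow> ('w \<Rightarrow> 'a) \<Rightarrow> 'a::topological_space set \<Rightarrow> (real \<Rightarrow> 'a \<Rightarrow> 'a) \<Rightarrow> 'a set set
      \<Rightarrow> (real \<Rightarrow> real) \<Rightarrow> 'a measure \<Rightarrow> bool" where
  "in_RV M \<xi> X T S g \<mu> \<longleftrightarrow>
    g \<in> borel_measurable (restrict_space borel {0..}) \<and> (\<forall>t\<ge>0. 0 \<le> g t) \<and>
    filterlim g at_top at_top \<and>
    sets \<mu> = sets (restrict_space borel X) \<and>
    (\<forall>B \<in> sets \<mu>. B \<in> S \<longrightarrow> emeasure \<mu> B < \<infinity>) \<and>
    (\<forall>B \<in> sets \<mu>. B \<inter> \<Union>S = {} \<longrightarrow> emeasure \<mu> B = 0) \<and>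
    (\<exists>B \<in> sets \<mu>. B \<in> S \<and> 0 < emeasure \<mu> B) \<and>
    (\<forall>f::'a \<Rightarrow> real.
       continuous_on (\<Union>S) f \<and> bounded (f ` \<Union>S) \<and> (\<forall>x. x \<notin> \<Union>S \<longrightarrow> f x = 0) \<and>
       X \<inter> closure {x \<in> X. f x \<noteq> 0} \<in> S \<longrightarrow>
       ((\<lambda>t. g t * (\<integral>\<omega>. f (T (inverse t) (\<xi> \<omega>)) \<partial>M)) \<longlongrightarrow> (\<integral>x. f x \<partial>\<mu>)) at_top)"

definition regularly_varying_variable ::
    "'w measure \<Rightarrow> ('w \<Rightarrow> real) \<Rightarrow> (real \<Rightarrow> real) \<Rightarrow> bool" where
  "regularly_varying_variable M \<zeta> g \<longleftrightarrow>
    (\<exists>\<mu>'. in_RV M \<zeta> {0..} (\<lambda>t x. t * x) (modulus_ideal {0..} (\<lambda>x. x)) g \<mu>')"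

(* Positivity and measurability are required on (0,\<infinity>), so that t powr \<alpha> is included. *)
definition RV_class :: "real \<Rightarrow> (real \<Rightarrow> real) set" where
  "RV_class \<alpha> = {g. g \<in> borel_measurable (restrict_space borel {0<..}) \<and> (\<forall>t>0. 0 < g t) \<and>
     (\<forall>x>0. ((\<lambda>t. g (x * t) / g t) \<longlongrightarrow> x powr \<alpha>) at_top)}"

definition theta :: "real \<Rightarrow> real measure" where
  "theta \<alpha> = density (restrict_space lborel {0<..}) (\<lambda>s. ennreal (\<alpha> * s powr (- \<alpha> - 1)))"


section \<open>Conditional laws and weak convergence\<close>

(* Law of Y, with values in the measurable space N, given the event E. Restricting M to E
   first means that Y need take values in N only on E. *)
definition conditional_law ::
    "'w measure \<Rightarrow> 'a measure \<Rightarrow> ('w \<Rightarrow> 'a) \<Rightarrow> 'w set \<Rightarrow> 'a measure" where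
  "conditional_law M N Y E = distr (uniform_measure (restrict_space M E) E) N Y"

definition weakly_converges_on ::
    "'a::topological_space set \<Rightarrow> ('i \<Rightarrow> 'a measure) \<Rightarrow> 'a measure \<Rightarrow> 'i filter \<Rightarrow> bool" where
  "weakly_converges_on X N L F \<longleftrightarrow>
    (\<forall>f::'a \<Rightarrow> real. continuous_on X f \<and> bounded (f ` X) \<longrightarrow>
       ((\<lambda>i. \<integral>x. f x \<partial>N i) \<longlongrightarrow> (\<integral>x. f x \<partial>L)) F)"

end

theory Submission
  imports Defs
begin

text \<open>
  Every point with \<open>\<tau> x > 0\<close> is \<open>T (\<tau> x) (direction x)\<close> with \<open>direction x\<close> on the unit sphere of the
  modulus, and in these coordinates all three statements say the same thing: \<open>\<sigma>\<close> is tau-additive,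
  the tail \<open>P(\<tau>(\<xi>) > t)\<close> varies regularly with index \<open>- \<alpha>\<close>, and the conditional law of the direction
  given \<open>\<tau>(\<xi>) > t\<close> converges weakly to the normalised \<open>\<sigma>\<close>. This condition is \<open>polar_limit \<alpha>\<close>, and each
  statement is shown to be equivalent to its validity for some \<open>\<alpha>\<close>.

  The measure in (i) is \<open>homogeneous \<alpha>\<close>, the image of \<open>\<sigma>\<close> times the density \<open>\<alpha> t^(\<alpha> - 1)\<close> under
  \<open>(s, t) \<mapsto> T (1/t) s\<close>. That image is a Borel measure although the space need not be second countable:
  by perfect normality every open set is the complement of a zero set, and a real function that is
  continuous in \<open>t\<close> and measurable in \<open>s\<close> is jointly measurable. The tail \<open>{\<tau> > u}\<close> of this measure,
  projected to the sphere, is \<open>u^(-\<alpha>) \<sigma>\<close>.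

  From (i) to polar coordinates, the test functions \<open>k(direction x) ramp(\<tau> x)\<close> squeeze the
  discontinuous \<open>k(direction x) 1{\<tau> x > u}\<close>; the squeeze is tight because the limiting tail is a power
  of \<open>u\<close>, hence continuous (\<open>in_RV_excess_limit\<close>).

  In the other direction, weak convergence of directions and the tail asymptotics give the limit for
  the functions \<open>k(direction x) 1{\<tau> x > u}\<close>. A bounded nonnegative continuous function on \<open>{\<tau> \<ge> \<epsilon>}\<close> is
  approximated from below by finite combinations of these: cut \<open>{\<tau> > \<epsilon>}\<close> into thin shells and replace
  the function on each shell by its infimum over the radial segment, which depends continuously on the
  direction because the segment is compact. So the lower limit of the normalised expectations is at least the integral
  (\<open>vague_lower_bound\<close>); applying this to \<open>f + B\<close> and \<open>B - f\<close> gives convergence. The homogeneous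
  measure inherits tau-additivity from \<open>\<sigma>\<close> because the measures of the slices of an open set are lower
  semicontinuous in \<open>t\<close>, so that the Lindelof property of the line replaces a net by a sequence
  (\<open>tau_additive_homogeneous\<close>).

  In (ii) the index of \<open>g\<close> is the tail index: comparing \<open>g(t)\<close> with \<open>g(xt)\<close> shows that the limit measure on
  the half-line gives \<open>(u, \<infinity>)\<close> a multiple of \<open>u^(-\<alpha>)\<close> (\<open>in_RV_half_line_power_tail\<close>). Between (ii) and (iii)
  stands the portmanteau theorem, for which distances to closed sets are replaced by the functions that
  perfect normality provides.
\<close>

section \<open>Functionally open sets and directed unions\<close>

lemma functionally_open_in_openin:
  assumes "functionally_open_in X U"
  shows "openin (top_of_set X) U"
proof -
  obtain h :: "'a \<Rightarrow> real" where h: "continuous_on X h" "U = X - {x \<in> X. h x = 0}"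
    using assms by (auto simp: functionally_open_in_def)
  have "openin (top_of_set X) (X \<inter> h -` (- {0}))"
    using h(1) by (intro continuous_openin_preimage_gen) auto
  also have "X \<inter> h -` (- {0}) = U"
    using h(2) by auto
  finally show ?thesis .
qed

lemma openin_sets_restrict_borel:
  assumes "openin (top_of_set X) U"
  shows "U \<in> sets (restrict_space borel X)"
proof -
  obtain V where "open V" "U = X \<inter> V"
    using assms by (auto simp: openin_open)
  then show ?thesis
    by (auto simp: sets_restrict_space)
qed

lemma perfectly_normal_openin_functionally_open_in:
  fixes X :: "'a::topological_space set"
  assumes pn: "perfectly_normal_on (UNIV :: 'a set)" and X: "closed X"
    and U: "openin (top_of_set X) U"
  shows "functionally_open_in X U"
proof -
  obtain V where V: "open V" "U = X \<inter> V"
    using U by (auto simp: openin_open)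
  have "closedin (top_of_set UNIV) (X - U)" "closedin (top_of_set UNIV) ({} :: 'a set)"
    using X V by (auto simp: closed_Diff Diff_Int_distrib Diff_Int)
  then obtain f :: "'a \<Rightarrow> real" where f: "continuous_on UNIV f" "{x \<in> UNIV. f x = 0} = X - U"
    using pn[unfolded perfectly_normal_on_def, rule_format, of "X - U" "{}"] by auto
  have "U = X - {x \<in> X. f x = 0}"
    using f(2) V(2) by auto
  then show ?thesis
    using continuous_on_subset[OF f(1)] unfolding functionally_open_in_def by blast
qed

text \<open>
  The tails of a directed family generate a proper filter, and a monotone set function converges along
  it to its supremum; uniqueness of limits then gives the equivalence.
\<close>

lemma tendsto_directed_iff_SUP:
  fixes \<G> :: "'a set set"
  assumes ne: "\<G> \<noteq> {}" and dir: "\<And>G H. G \<in> \<G> \<Longrightarrow> H \<in> \<G> \<Longrightarrow> \<exists>K\<in>\<G>. G \<subseteq> K \<and> H \<subseteq> K"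
    and meas: "\<G> \<subseteq> sets \<mu>"
  shows "(emeasure \<mu> \<longlongrightarrow> L) (INF G\<in>\<G>. principal {H \<in> \<G>. G \<subseteq> H}) \<longleftrightarrow>
    (SUP G\<in>\<G>. emeasure \<mu> G) = L"
proof -
  let ?F = "INF G\<in>\<G>. principal {H \<in> \<G>. G \<subseteq> H}"
  have ev: "eventually P ?F \<longleftrightarrow> (\<exists>G\<in>\<G>. \<forall>H\<in>\<G>. G \<subseteq> H \<longrightarrow> P H)" for P
  proof (subst eventually_INF_base[OF ne])
    fix a b assume "a \<in> \<G>" "b \<in> \<G>"
    then obtain K where "K \<in> \<G>" "a \<subseteq> K" "b \<subseteq> K"
      using dir by blast
    then show "\<exists>x\<in>\<G>. principal {H \<in> \<G>. x \<subseteq> H} \<le> inf (principal {H \<in> \<G>. a \<subseteq> H}) (principal {H \<in> \<G>. b \<subseteq> H})"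
      by (intro bexI[of _ K]) auto
  qed (auto simp: eventually_principal)
  have nt: "?F \<noteq> bot"
    unfolding trivial_limit_def ev by auto
  have lim: "(emeasure \<mu> \<longlongrightarrow> (SUP G\<in>\<G>. emeasure \<mu> G)) ?F"
  proof (rule order_tendstoI)
    fix a assume "a < (SUP G\<in>\<G>. emeasure \<mu> G)"
    then obtain G where "G \<in> \<G>" "a < emeasure \<mu> G"
      by (auto simp: less_SUP_iff)
    then show "eventually (\<lambda>G. a < emeasure \<mu> G) ?F"
      unfolding ev using meas by (intro bexI[of _ G]) (auto intro: less_le_trans emeasure_mono)
  next
    fix a assume a: "(SUP G\<in>\<G>. emeasure \<mu> G) < a"
    show "eventually (\<lambda>G. emeasure \<mu> G < a) ?F"
      unfolding ev using ne a by (auto intro: le_less_trans[OF SUP_upper])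
  qed
  show ?thesis
    using tendsto_unique[OF nt lim] lim by blast
qed

lemma tau_additive_on_iff_SUP:
  assumes sets: "sets \<mu> = sets (restrict_space borel X)"
  shows "tau_additive_on X \<mu> \<longleftrightarrow>
    (\<forall>\<G>. \<G> \<noteq> {} \<and> (\<forall>G\<in>\<G>. functionally_open_in X G) \<and>
         (\<forall>G\<in>\<G>. \<forall>H\<in>\<G>. \<exists>K\<in>\<G>. G \<subseteq> K \<and> H \<subseteq> K) \<and> functionally_open_in X (\<Union>\<G>) \<longrightarrow>
      (SUP G\<in>\<G>. emeasure \<mu> G) = emeasure \<mu> (\<Union>\<G>))"
  unfolding tau_additive_on_def
proof (intro arg_cong[where f=All] ext imp_cong refl)
  fix \<G> :: "'a set set"
  assume *: "\<G> \<noteq> {} \<and> (\<forall>G\<in>\<G>. functionally_open_in X G) \<and>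
    (\<forall>G\<in>\<G>. \<forall>H\<in>\<G>. \<exists>K\<in>\<G>. G \<subseteq> K \<and> H \<subseteq> K) \<and> functionally_open_in X (\<Union>\<G>)"
  then have "\<G> \<subseteq> sets \<mu>"
    unfolding sets by (blast intro: openin_sets_restrict_borel functionally_open_in_openin)
  with * show "(emeasure \<mu> \<longlongrightarrow> emeasure \<mu> (\<Union>\<G>)) (INF G\<in>\<G>. principal {H \<in> \<G>. G \<subseteq> H}) \<longleftrightarrow>
      (SUP G\<in>\<G>. emeasure \<mu> G) = emeasure \<mu> (\<Union>\<G>)"
    by (intro tendsto_directed_iff_SUP) auto
qed

section \<open>The portmanteau theorem without a metric\<close>

lemma borel_measurable_continuous_on_sets:
  assumes "continuous_on X (f :: 'a::topological_space \<Rightarrow> real)" "sets N = sets (restrict_space borel X)"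
  shows "f \<in> borel_measurable N"
  using borel_measurable_continuous_on_restrict[OF assms(1)] measurable_cong_sets[OF assms(2) refl] by blast

lemma space_restrict_borel_sets:
  "sets N = sets (restrict_space borel X) \<Longrightarrow> space N = X"
  using sets_eq_imp_space_eq[of N "restrict_space borel X"] by (simp add: space_restrict_space)

text \<open>
  If \<open>U\<close> is the set where \<open>h\<close> does not vanish, the continuous functions \<open>min 1 (n \<bar>h\<bar>)\<close> increase to the
  indicator of \<open>U\<close>. One of them already integrates to more than \<open>l\<close>, and it bounds the measure of \<open>U\<close> from below.
\<close>

lemma weak_limit_functionally_open_lower:
  fixes X :: "'a::topological_space set"
  assumes weak: "weakly_converges_on X N L F" and U: "functionally_open_in X U"
    and N: "eventually (\<lambda>i. prob_space (N i) \<and> sets (N i) = sets (restrict_space borel X)) F"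
    and L: "prob_space L" "sets L = sets (restrict_space borel X)"
    and l: "l < measure L U"
  shows "eventually (\<lambda>i. l < measure (N i) U) F"
proof -
  interpret L: prob_space L by fact
  obtain h :: "'a \<Rightarrow> real" where h: "continuous_on X h" "U = X - {x \<in> X. h x = 0}"
    using U by (auto simp: functionally_open_in_def)
  have U_sets: "U \<in> sets (restrict_space borel X)"
    by (intro openin_sets_restrict_borel functionally_open_in_openin U)
  have UX: "U \<inter> X = U"
    using h(2) by auto
  define f where "f n x = min 1 (real n * \<bar>h x\<bar>)" for n x
  have cont: "continuous_on X (f n)" for n
    unfolding f_def by (intro continuous_intros h)
  have f01: "0 \<le> f n x" "f n x \<le> 1" for n x
    by (auto simp: f_def)
  have f_le: "f n x \<le> indicator U x" if "x \<in> X" for n x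
    using that h(2) by (auto simp: f_def indicator_def)
  have "(\<lambda>n. \<integral>x. f n x \<partial>L) \<longlonglongrightarrow> (\<integral>x. indicator U x \<partial>L)"
  proof (rule integral_dominated_convergence[where w="\<lambda>_. 1"])
    show "AE x in L. (\<lambda>n. f n x) \<longlonglongrightarrow> indicator U x"
    proof (rule AE_I2)
      fix x assume "x \<in> space L"
      then have x: "x \<in> X"
        using space_restrict_borel_sets[OF L(2)] by simp
      show "(\<lambda>n. f n x) \<longlonglongrightarrow> indicator U x"
      proof (cases "h x = 0")
        case True
        then show ?thesis using x h(2) by (simp add: f_def)
      next
        case False
        obtain m where m: "1 / \<bar>h x\<bar> < real m"
          using reals_Archimedean2 by blast
        have "f n x = 1" if "n \<ge> m" for n
        proof -
          have "1 / \<bar>h x\<bar> < real n" using m that by linarith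
          then show ?thesis using False by (auto simp: f_def field_simps min_def)
        qed
        then have "eventually (\<lambda>n. f n x = 1) sequentially"
          by (auto simp: eventually_sequentially)
        then show ?thesis using False x h(2) by (auto intro: tendsto_eventually)
      qed
    qed
  qed (use cont L(2) U_sets f01 in \<open>auto intro: borel_measurable_continuous_on_sets\<close>)
  then have "(\<lambda>n. \<integral>x. f n x \<partial>L) \<longlonglongrightarrow> measure L U"
    using U_sets L(2) UX by (simp add: space_restrict_borel_sets)
  then obtain n where n: "l < (\<integral>x. f n x \<partial>L)"
    using eventually_happens'[OF sequentially_bot order_tendstoD(1)[OF _ l]] by blast
  have "((\<lambda>i. \<integral>x. f n x \<partial>N i) \<longlongrightarrow> (\<integral>x. f n x \<partial>L)) F"
  proof -
    have "bounded (f n ` X)"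
      using f01 by (intro boundedI[where B=1]) auto
    then show ?thesis
      using weak cont unfolding weakly_converges_on_def by blast
  qed
  from order_tendstoD(1)[OF this n] N show ?thesis
  proof eventually_elim
    case (elim i)
    interpret Ni: prob_space "N i" using elim by blast
    have sets: "sets (N i) = sets (restrict_space borel X)" using elim by blast
    have "(\<integral>x. f n x \<partial>N i) \<le> (\<integral>x. indicator U x \<partial>N i)"
    proof (rule integral_mono)
      show "integrable (N i) (f n)"
        using f01 borel_measurable_continuous_on_sets[OF cont sets]
        by (intro Ni.integrable_const_bound[where B=1]) auto
      show "integrable (N i) (indicat_real U)"
        using U_sets sets by (intro Ni.integrable_const_bound[where B=1]) auto
    qed (use f_le space_restrict_borel_sets[OF sets] in auto)
    also have "\<dots> = measure (N i) U"
      using U_sets sets UX by (simp add: space_restrict_borel_sets)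
    finally show ?case using elim by simp
  qed
qed

text \<open>
  The lower bound for open sets is applied to the interior of \<open>A\<close> and to the complement of its closure.
  The two bounds meet because the frontier is a null set.
\<close>

lemma weak_convergence_imp_continuity_set_convergence:
  fixes X :: "'a::topological_space set"
  assumes weak: "weakly_converges_on X N L F"
    and fo: "\<And>U. openin (top_of_set X) U \<Longrightarrow> functionally_open_in X U"
    and N: "eventually (\<lambda>i. prob_space (N i) \<and> sets (N i) = sets (restrict_space borel X)) F"
    and L: "prob_space L" "sets L = sets (restrict_space borel X)"
    and A: "A \<in> sets L" "emeasure L (top_of_set X frontier_of A) = 0"
  shows "((\<lambda>i. measure (N i) A) \<longlongrightarrow> measure L A) F"
proof -
  interpret L: prob_space L by fact
  have AX: "A \<subseteq> X" using A(1) sets.sets_into_space space_restrict_borel_sets[OF L(2)] by blast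
  define I where "I = top_of_set X interior_of A"
  define C where "C = top_of_set X closure_of A"
  have sub: "I \<subseteq> A" "A \<subseteq> C" "C \<subseteq> X"
    unfolding I_def C_def using AX closure_of_subset_topspace[of "top_of_set X" A]
    by (auto simp: interior_of_subset closure_of_subset)
  have open_I: "openin (top_of_set X) I"
    unfolding I_def by simp
  have open_C: "openin (top_of_set X) (X - C)"
    unfolding C_def using closedin_closure_of[of "top_of_set X" A] by (simp add: closedin_def)
  have sets: "I \<in> sets (restrict_space borel X)" "X - C \<in> sets (restrict_space borel X)"
    using open_I open_C openin_sets_restrict_borel by auto
  have C_sets: "C \<in> sets (restrict_space borel X)"
  proof -
    have "space (restrict_space borel X) - (X - C) \<in> sets (restrict_space borel X)"
      using sets(2) by blast
    also have "space (restrict_space borel X) - (X - C) = C"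
      using sub(3) by (auto simp: space_restrict_space)
    finally show ?thesis .
  qed
  have "top_of_set X frontier_of A = C - I"
    by (simp add: frontier_of_def C_def I_def)
  then have "measure L (C - I) = 0"
    using A(2) by (simp add: measure_def)
  then have "measure L C = measure L I"
    using L.finite_measure_Diff[of C I] sets C_sets L(2) sub by auto
  moreover have "measure L I \<le> measure L A" "measure L A \<le> measure L C"
    using sub sets C_sets A L(2) by (auto intro!: L.finite_measure_mono)
  ultimately have eq: "measure L I = measure L A" "measure L C = measure L A"
    by linarith+
  have LC: "measure L (X - C) = 1 - measure L A"
    using L.prob_compl[of C] C_sets L(2) eq space_restrict_borel_sets[OF L(2)] by simp
  show ?thesis
  proof (rule order_tendstoI)
    fix l assume "l < measure L A"
    then have "eventually (\<lambda>i. l < measure (N i) I) F"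
      using eq by (intro weak_limit_functionally_open_lower[OF weak fo[OF open_I] N L]) simp
    with N show "eventually (\<lambda>i. l < measure (N i) A) F"
    proof eventually_elim
      case (elim i)
      interpret Ni: prob_space "N i" using elim by blast
      have "measure (N i) I \<le> measure (N i) A"
        using sub A L(2) elim by (intro Ni.finite_measure_mono) auto
      then show ?case using elim by simp
    qed
  next
    fix l assume "measure L A < l"
    then have "eventually (\<lambda>i. 1 - l < measure (N i) (X - C)) F"
      using LC by (intro weak_limit_functionally_open_lower[OF weak fo[OF open_C] N L]) simp
    with N show "eventually (\<lambda>i. measure (N i) A < l) F"
    proof eventually_elim
      case (elim i)
      interpret Ni: prob_space "N i" using elim by blast
      have [simp]: "space (N i) = X" using elim space_restrict_borel_sets by blast
      have "measure (N i) (X - C) = 1 - measure (N i) C"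
        using Ni.prob_compl[of C] C_sets elim by simp
      moreover have "measure (N i) A \<le> measure (N i) C"
        using sub C_sets elim by (intro Ni.finite_measure_mono) auto
      ultimately show ?case using elim by simp
    qed
  qed
qed

text \<open>
  Integrals of \<open>f\<close> depend only on its distribution on the real line. If the limiting distribution function
  is continuous at \<open>x\<close>, then \<open>{f \<le> x}\<close> is a continuity set, its frontier being contained in \<open>{f = x}\<close>. So
  the distribution functions of \<open>f\<close> converge weakly, and the portmanteau theorem on the line applies.
\<close>

lemma continuity_set_convergence_imp_weak_convergence:
  fixes X :: "'a::topological_space set" and N :: "nat \<Rightarrow> 'a measure"
  assumes N: "\<And>n. prob_space (N n)" "\<And>n. sets (N n) = sets (restrict_space borel X)"
    and L: "prob_space L" "sets L = sets (restrict_space borel X)"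
    and conv: "\<And>A. A \<in> sets L \<Longrightarrow> emeasure L (top_of_set X frontier_of A) = 0 \<Longrightarrow>
      (\<lambda>n. measure (N n) A) \<longlonglongrightarrow> measure L A"
  shows "weakly_converges_on X N L sequentially"
  unfolding weakly_converges_on_def
proof (intro allI impI)
  fix f :: "'a \<Rightarrow> real" assume f: "continuous_on X f \<and> bounded (f ` X)"
  then obtain B where B: "\<And>x. x \<in> X \<Longrightarrow> \<bar>f x\<bar> \<le> B"
    by (auto simp: bounded_iff)
  \<comment> \<open>The identity, truncated to the range of \<open>f\<close>, is a bounded test function on the line.\<close>
  define c where "c y = max (- B) (min B y)" for y :: real
  interpret L: prob_space L by fact
  interpret N: prob_space "N n" for n by fact
  have fL[measurable]: "f \<in> borel_measurable L" and fN[measurable]: "f \<in> borel_measurable (N n)" for n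
    using f N(2) L(2) by (auto intro: borel_measurable_continuous_on_sets)
  have spL: "space L = X" and spN: "space (N n) = X" for n
    using N(2) L(2) by (auto dest: space_restrict_borel_sets)
  have rdL: "real_distribution (distr L borel f)" and rdN: "real_distribution (distr (N n) borel f)" for n
    by (auto intro!: real_distribution.intro L.prob_space_distr N.prob_space_distr
        simp: real_distribution_axioms_def)
  interpret D: real_distribution "distr L borel f" by fact
  have c_cont: "isCont c y" for y
    unfolding c_def by (intro continuous_intros)
  have "weak_conv_m (\<lambda>n. distr (N n) borel f) (distr L borel f)"
    unfolding weak_conv_m_def weak_conv_def
  proof (intro allI impI)
    fix x assume "isCont (cdf (distr L borel f)) x"
    then have "measure (distr L borel f) {x} = 0"
      by (simp add: D.isCont_cdf)
    then have null: "emeasure L {y \<in> X. f y = x} = 0"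
      by (simp add: measure_distr L.emeasure_eq_measure vimage_def spL Int_def conj_commute)
    define A where "A = {y \<in> X. f y \<le> x}"
    have A: "A \<in> sets L"
    proof -
      have "{y \<in> space L. f y \<le> x} \<in> sets L" by measurable
      then show ?thesis by (simp add: A_def spL)
    qed
    have "top_of_set X frontier_of A \<subseteq> {y \<in> X. f y = x}"
    proof -
      have "closedin (top_of_set X) (X \<inter> f -` {..x})"
        using f by (intro continuous_closedin_preimage) auto
      then have "top_of_set X closure_of A \<subseteq> A"
        by (intro closure_of_minimal) (auto simp: A_def vimage_def Int_def)
      moreover have "openin (top_of_set X) (X \<inter> f -` {..<x})"
        using f by (intro continuous_openin_preimage_gen) auto
      then have "X \<inter> f -` {..<x} \<subseteq> top_of_set X interior_of A"
        by (intro interior_of_maximal) (auto simp: A_def)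
      ultimately show ?thesis
        unfolding frontier_of_def
      proof (intro subsetI)
        fix y assume sub: "top_of_set X closure_of A \<subseteq> A" "X \<inter> f -` {..<x} \<subseteq> top_of_set X interior_of A"
          and y: "y \<in> top_of_set X closure_of A - top_of_set X interior_of A"
        have "y \<in> A" "y \<notin> X \<inter> f -` {..<x}" using sub y by blast+
        then show "y \<in> {y \<in> X. f y = x}" by (auto simp: A_def)
      qed
    qed
    moreover have "{y \<in> X. f y = x} \<in> sets L"
    proof -
      have "{y \<in> space L. f y = x} \<in> sets L" by measurable
      then show ?thesis by (simp add: spL)
    qed
    ultimately have "emeasure L (top_of_set X frontier_of A) \<le> 0"
      using emeasure_mono[of "top_of_set X frontier_of A" "{y \<in> X. f y = x}" L] null by simp
    then have "(\<lambda>n. measure (N n) A) \<longlonglongrightarrow> measure L A"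
      by (intro conv A) simp
    then show "(\<lambda>n. cdf (distr (N n) borel f) x) \<longlonglongrightarrow> cdf (distr L borel f) x"
      by (simp add: cdf_def measure_distr A_def spL spN vimage_def Int_def conj_commute)
  qed
  then have "(\<lambda>n. integral\<^sup>L (distr (N n) borel f) c) \<longlonglongrightarrow> integral\<^sup>L (distr L borel f) c"
    by (intro weak_conv_imp_integral_bdd_continuous_conv[where B="\<bar>B\<bar>"] rdL rdN c_cont)
       (auto simp: c_def)
  moreover have "c \<in> borel_measurable borel"
    unfolding c_def by measurable
  ultimately have "(\<lambda>n. \<integral>x. c (f x) \<partial>N n) \<longlonglongrightarrow> (\<integral>x. c (f x) \<partial>L)"
    by (simp add: integral_distr)
  moreover have "c (f x) = f x" if "x \<in> X" for x
    using B[OF that] by (auto simp: c_def)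
  then have "(\<integral>x. c (f x) \<partial>N n) = (\<integral>x. f x \<partial>N n)" "(\<integral>x. c (f x) \<partial>L) = (\<integral>x. f x \<partial>L)" for n
    by (auto intro!: Bochner_Integration.integral_cong simp: spL spN)
  ultimately show "(\<lambda>n. \<integral>x. f x \<partial>N n) \<longlonglongrightarrow> (\<integral>x. f x \<partial>L)"
    by simp
qed

section \<open>Regular variation on the half-line\<close>

lemma modulus_ideal_iff:
  "A \<in> modulus_ideal X \<tau> \<longleftrightarrow> A \<subseteq> X \<and> (\<exists>\<epsilon>>0. \<forall>x\<in>A. \<epsilon> < \<tau> x)"
proof -
  have "0 < (INF x\<in>A. ereal (\<tau> x)) \<longleftrightarrow> (\<exists>\<epsilon>>0. \<forall>x\<in>A. \<epsilon> < \<tau> x)"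
  proof
    assume "0 < (INF x\<in>A. ereal (\<tau> x))"
    then obtain \<epsilon> where \<epsilon>: "0 < ereal \<epsilon>" "ereal \<epsilon> < (INF x\<in>A. ereal (\<tau> x))"
      using ereal_dense2 by blast
    have "\<epsilon> < \<tau> x" if "x \<in> A" for x
      using less_le_trans[OF \<epsilon>(2) INF_lower[OF that]] by simp
    then show "\<exists>\<epsilon>>0. \<forall>x\<in>A. \<epsilon> < \<tau> x"
      using \<epsilon>(1) by auto
  next
    assume "\<exists>\<epsilon>>0. \<forall>x\<in>A. \<epsilon> < \<tau> x"
    then obtain \<epsilon> where "\<epsilon> > 0" "\<forall>x\<in>A. \<epsilon> < \<tau> x" by blast
    then have "ereal \<epsilon> \<le> (INF x\<in>A. ereal (\<tau> x))"
      by (intro INF_greatest) auto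
    then show "0 < (INF x\<in>A. ereal (\<tau> x))"
      using \<open>\<epsilon> > 0\<close> by (metis ereal_less(2) less_le_trans)
  qed
  then show ?thesis
    by (simp add: modulus_ideal_def)
qed

lemma Union_modulus_ideal: "\<Union>(modulus_ideal X \<tau>) = {x \<in> X. 0 < \<tau> x}"
proof (intro equalityI subsetI)
  fix x assume "x \<in> {x \<in> X. 0 < \<tau> x}"
  then have "{x} \<in> modulus_ideal X \<tau>"
    by (auto simp: modulus_ideal_iff intro!: exI[of _ "\<tau> x / 2"])
  then show "x \<in> \<Union>(modulus_ideal X \<tau>)" by blast
qed (force simp: modulus_ideal_iff)

definition ramp :: "real \<Rightarrow> real \<Rightarrow> real \<Rightarrow> real" where
  "ramp a b y = max 0 (min 1 ((y - a) / (b - a)))"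

lemma ramp_bounds: "0 \<le> ramp a b y" "ramp a b y \<le> 1"
  by (auto simp: ramp_def)

lemma ramp_eq_0: "a < b \<Longrightarrow> y \<le> a \<Longrightarrow> ramp a b y = 0"
  using divide_nonpos_pos[of "y - a" "b - a"] by (simp add: ramp_def)

lemma ramp_eq_1: "a < b \<Longrightarrow> b \<le> y \<Longrightarrow> ramp a b y = 1"
  by (auto simp: ramp_def max_def min_def field_simps)

lemma continuous_on_ramp: "continuous_on A (ramp a b)"
  unfolding ramp_def
  by (cases "a = b") (auto intro!: continuous_intros)

lemma borel_measurable_ramp[measurable]: "ramp a b \<in> borel_measurable borel"
  by (intro borel_measurable_continuous_onI continuous_on_ramp)

lemma ramp_le_indicator: "a < b \<Longrightarrow> ramp a b y \<le> indicator {a<..} y"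
  using ramp_bounds[of a b y] ramp_eq_0[of a b y] by (auto simp: indicator_def)

lemma indicator_le_ramp: "a < b \<Longrightarrow> indicator {b<..} y \<le> ramp a b y"
  using ramp_bounds[of a b y] ramp_eq_1[of a b y] by (auto simp: indicator_def)

lemma ramp_scale: "0 < x \<Longrightarrow> ramp (x * a) (x * b) y = ramp a b (y / x)"
proof -
  assume x: "0 < x"
  have "(y - x * a) / (x * b - x * a) = (y / x - a) / (b - a)"
  proof -
    have "(y / x - a) / (b - a) = (x * (y / x - a)) / (x * (b - a))"
      using x by (subst mult_divide_mult_cancel_left) auto
    then show ?thesis using x by (simp add: algebra_simps)
  qed
  then show ?thesis by (simp add: ramp_def)
qed

lemma ramp_tendsto_indicator:
  assumes "0 < u"
  shows "(\<lambda>n. ramp u (u * (1 + 1 / Suc n)) y) \<longlonglongrightarrow> indicator {u<..} y"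
proof (cases "y \<le> u")
  case True
  then have "ramp u (u * (1 + 1 / Suc n)) y = 0" for n
    using assms by (intro ramp_eq_0) auto
  then show ?thesis using True by simp
next
  case False
  have "(\<lambda>n. u * (1 + 1 / Suc n)) \<longlonglongrightarrow> u * (1 + 0)"
    by (intro tendsto_intros LIMSEQ_Suc[OF lim_1_over_n])
  then have "eventually (\<lambda>n. u * (1 + 1 / Suc n) < y) sequentially"
    using False by (intro order_tendstoD) auto
  then have "eventually (\<lambda>n. ramp u (u * (1 + 1 / Suc n)) y = 1) sequentially"
    by eventually_elim (use assms in \<open>auto intro!: ramp_eq_1\<close>)
  then show ?thesis using False by (auto intro: tendsto_eventually)
qed

text \<open>
  \<open>ramp u b \<le> indicator {u<..} \<le> ramp a u\<close> for \<open>a < u < b\<close>, so the limits for ramps enclose those for the indicator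
  between values of \<open>H\<close> to the right and to the left of \<open>u\<close>.
\<close>

lemma tendsto_indicator_from_ramps:
  fixes W \<zeta> :: "'w \<Rightarrow> real" and g :: "real \<Rightarrow> real"
  assumes M: "prob_space M" and [measurable]: "W \<in> borel_measurable M" "\<zeta> \<in> borel_measurable M"
    and W: "\<And>\<omega>. \<omega> \<in> space M \<Longrightarrow> 0 \<le> W \<omega>" "\<And>\<omega>. \<omega> \<in> space M \<Longrightarrow> W \<omega> \<le> C"
    and g: "\<And>t. t \<ge> 0 \<Longrightarrow> 0 \<le> g t"
    and conv: "\<And>a b. 0 < a \<Longrightarrow> a < b \<Longrightarrow>
      ((\<lambda>t. g t * (\<integral>\<omega>. W \<omega> * ramp a b (inverse t * \<zeta> \<omega>) \<partial>M)) \<longlongrightarrow> I a b) at_top"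
    and I: "\<And>a b. 0 < a \<Longrightarrow> a < b \<Longrightarrow> H b \<le> I a b" "\<And>a b. 0 < a \<Longrightarrow> a < b \<Longrightarrow> I a b \<le> H a"
    and H: "isCont H u" and u: "0 < (u::real)"
  shows "((\<lambda>t. g t * (\<integral>\<omega>. W \<omega> * indicator {u<..} (inverse t * \<zeta> \<omega>) \<partial>M)) \<longlongrightarrow> (H u :: real)) at_top"
proof -
  interpret prob_space M by fact
  have intgr: "integrable M (\<lambda>\<omega>. W \<omega> * h (inverse t * \<zeta> \<omega>))"
    if [measurable]: "h \<in> borel_measurable borel" and "\<And>y. 0 \<le> h y" "\<And>y. h y \<le> 1" for h :: "real \<Rightarrow> real" and t
  proof (intro integrable_const_bound[where B=C] AE_I2)
    fix \<omega> assume \<omega>: "\<omega> \<in> space M"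
    have "W \<omega> * h (inverse t * \<zeta> \<omega>) \<le> W \<omega>"
      by (intro mult_left_le that W(1)[OF \<omega>])
    then show "norm (W \<omega> * h (inverse t * \<zeta> \<omega>)) \<le> C"
      using W[OF \<omega>] that(2) by (simp add: abs_mult)
  qed measurable
  have ge0: "eventually (\<lambda>t::real. 0 \<le> t) at_top" by (rule eventually_ge_at_top)
  show ?thesis
  proof (rule order_tendstoI)
    fix l assume l: "l < H u"
    have "(H \<longlongrightarrow> H u) (at_right u)"
      using H by (simp add: isCont_def filterlim_at_split)
    then have "eventually (\<lambda>b. l < H b \<and> u < b) (at_right u)"
      using order_tendstoD(1)[OF _ l] eventually_at_right_less[of u] by (intro eventually_conj) auto
    then obtain b where b: "l < H b" "u < b"
      using eventually_happens'[OF trivial_limit_at_right_real] by blast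
    have "l < I u b" using I(1)[OF u b(2)] b(1) by simp
    from order_tendstoD(1)[OF conv[OF u b(2)] this] ge0
    show "eventually (\<lambda>t. l < g t * (\<integral>\<omega>. W \<omega> * indicator {u<..} (inverse t * \<zeta> \<omega>) \<partial>M)) at_top"
    proof eventually_elim
      case (elim t)
      have "(\<integral>\<omega>. W \<omega> * ramp u b (inverse t * \<zeta> \<omega>) \<partial>M) \<le> (\<integral>\<omega>. W \<omega> * indicator {u<..} (inverse t * \<zeta> \<omega>) \<partial>M)"
        using W ramp_le_indicator[OF b(2)] ramp_bounds
        by (intro integral_mono intgr mult_left_mono) auto
      from mult_left_mono[OF this g[of t]] elim show ?case by linarith
    qed
  next
    fix l assume l: "H u < l"
    have "(H \<longlongrightarrow> H u) (at_left u)"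
      using H by (simp add: isCont_def filterlim_at_split)
    then have "eventually (\<lambda>a. H a < l \<and> a \<in> {0<..<u}) (at_left u)"
      using order_tendstoD(2)[OF _ l] eventually_at_left_real[OF u] by (intro eventually_conj) auto
    then obtain a where a: "H a < l" "0 < a" "a < u"
      using eventually_happens'[OF trivial_limit_at_left_real] by fastforce
    have "I a u < l" using I(2)[OF a(2,3)] a(1) by simp
    from order_tendstoD(2)[OF conv[OF a(2,3)] this] ge0
    show "eventually (\<lambda>t. g t * (\<integral>\<omega>. W \<omega> * indicator {u<..} (inverse t * \<zeta> \<omega>) \<partial>M) < l) at_top"
    proof eventually_elim
      case (elim t)
      have "(\<integral>\<omega>. W \<omega> * indicator {u<..} (inverse t * \<zeta> \<omega>) \<partial>M) \<le> (\<integral>\<omega>. W \<omega> * ramp a u (inverse t * \<zeta> \<omega>) \<partial>M)"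
        using W indicator_le_ramp[OF a(3)] ramp_bounds
        by (intro integral_mono intgr mult_left_mono) auto
      from mult_left_mono[OF this g[of t]] elim show ?case by linarith
    qed
  qed
qed

definition power_tail :: "'w measure \<Rightarrow> ('w \<Rightarrow> real) \<Rightarrow> real \<Rightarrow> bool" where
  "power_tail M \<zeta> \<alpha> \<longleftrightarrow> (\<forall>t. 0 < measure M {\<omega> \<in> space M. t < \<zeta> \<omega>}) \<and>
     (\<forall>u>0. ((\<lambda>t. measure M {\<omega> \<in> space M. u * t < \<zeta> \<omega>} / measure M {\<omega> \<in> space M. t < \<zeta> \<omega>})
        \<longlongrightarrow> u powr (- \<alpha>)) at_top)"

lemma tail_antimono:
  assumes "prob_space M" and "\<zeta> \<in> borel_measurable M" and "s \<le> (t::real)"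
  shows "measure M {\<omega> \<in> space M. t < \<zeta> \<omega>} \<le> measure M {\<omega> \<in> space M. s < \<zeta> \<omega>}"
proof -
  interpret prob_space M by fact
  note [measurable] = assms(2)
  show ?thesis using assms(3) by (intro finite_measure_mono) auto
qed

lemma power_tailI:
  assumes M: "prob_space M" and \<zeta>: "\<zeta> \<in> borel_measurable M" and c: "c \<noteq> 0"
    and lim: "\<And>u. 0 < u \<Longrightarrow> ((\<lambda>t. g t * measure M {\<omega> \<in> space M. u * t < \<zeta> \<omega>}) \<longlongrightarrow> c * u powr (- \<alpha>)) at_top"
  shows "power_tail M \<zeta> \<alpha>"
proof -
  let ?p = "\<lambda>t. measure M {\<omega> \<in> space M. t < \<zeta> \<omega>}"
  have lim1: "((\<lambda>t. g t * ?p t) \<longlongrightarrow> c) at_top"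
    using lim[of 1] by simp
  have ev: "eventually (\<lambda>t. g t * ?p t \<noteq> 0) at_top"
    using tendsto_imp_eventually_ne[OF lim1 c] .
  have pos: "0 < ?p t" for t
  proof -
    have "eventually (\<lambda>s. g s * ?p s \<noteq> 0 \<and> t \<le> s) at_top"
      using ev eventually_ge_at_top by (rule eventually_conj)
    then obtain s where "g s * ?p s \<noteq> 0" "t \<le> s"
      using eventually_happens'[OF trivial_limit_at_top_linorder] by blast
    then have "?p s \<noteq> 0" by auto
    then show ?thesis
      using tail_antimono[OF M \<zeta>, of t s] measure_nonneg[of M "{\<omega> \<in> space M. s < \<zeta> \<omega>}"] \<open>t \<le> s\<close> by linarith
  qed
  have "((\<lambda>t. ?p (u * t) / ?p t) \<longlongrightarrow> u powr (- \<alpha>)) at_top" if u: "0 < u" for u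
  proof -
    have "((\<lambda>t. (g t * ?p (u * t)) / (g t * ?p t)) \<longlongrightarrow> (c * u powr (- \<alpha>)) / c) at_top"
      by (intro tendsto_divide lim[OF u] lim1 c)
    moreover have "eventually (\<lambda>t. (g t * ?p (u * t)) / (g t * ?p t) = ?p (u * t) / ?p t) at_top"
      using ev by eventually_elim auto
    ultimately show ?thesis
      using c by (simp add: tendsto_cong)
  qed
  then show ?thesis
    using pos by (simp add: power_tail_def)
qed

text \<open>
  The canonical normalising function is the reciprocal of the tail, up to a positive factor.
\<close>

lemma inverse_tail_normalising:
  assumes M: "prob_space M" and \<zeta>[measurable]: "\<zeta> \<in> borel_measurable M" and c: "0 < c"
    and pt: "power_tail M \<zeta> \<alpha>"
  defines "g \<equiv> \<lambda>t. c / measure M {\<omega> \<in> space M. t < \<zeta> \<omega>}"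
  shows "g \<in> borel_measurable borel" "0 < g t" "filterlim g at_top at_top" "g \<in> RV_class \<alpha>"
proof -
  let ?p = "\<lambda>t. measure M {\<omega> \<in> space M. t < \<zeta> \<omega>}"
  interpret prob_space M by fact
  have pos: "0 < ?p t" for t
    using pt by (simp add: power_tail_def)
  have "mono g"
    unfolding g_def using c pos tail_antimono[OF M \<zeta>]
    by (intro monoI divide_left_mono mult_pos_pos) auto
  then show meas: "g \<in> borel_measurable borel"
    by (rule borel_measurable_mono)
  show g_pos: "0 < g t" for t
    using c pos by (simp add: g_def)
  have "((\<lambda>t. ?p t) \<longlongrightarrow> 0) at_top"
  proof (rule tendsto_at_topI_sequentially)
    fix X :: "nat \<Rightarrow> real" assume X: "filterlim X at_top sequentially"
    have "(\<lambda>n. \<integral>\<omega>. indicat_real {\<omega> \<in> space M. X n < \<zeta> \<omega>} \<omega> \<partial>M) \<longlonglongrightarrow> (\<integral>\<omega>. 0 \<partial>M)"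
    proof (rule integral_dominated_convergence[where w="\<lambda>_. 1"])
      show "AE \<omega> in M. (\<lambda>n. indicat_real {\<omega> \<in> space M. X n < \<zeta> \<omega>} \<omega>) \<longlonglongrightarrow> 0"
      proof (rule AE_I2)
        fix \<omega>
        have "eventually (\<lambda>n. \<zeta> \<omega> \<le> X n) sequentially"
          using X by (simp add: filterlim_at_top)
        then have "eventually (\<lambda>n. indicat_real {\<omega> \<in> space M. X n < \<zeta> \<omega>} \<omega> = 0) sequentially"
          by eventually_elim auto
        then show "(\<lambda>n. indicat_real {\<omega> \<in> space M. X n < \<zeta> \<omega>} \<omega>) \<longlonglongrightarrow> 0"
          by (rule tendsto_eventually)
      qed
    qed (auto simp: indicator_def)
    then show "(\<lambda>n. ?p (X n)) \<longlonglongrightarrow> 0"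
      by (simp add: Int_absorb2)
  qed
  then have "filterlim (\<lambda>t. inverse (?p t)) at_top at_top"
    using pos by (intro filterlim_inverse_at_top) auto
  then have "filterlim (\<lambda>t. c * inverse (?p t)) at_top at_top"
    using c by (intro filterlim_tendsto_pos_mult_at_top[OF tendsto_const])
  then show "filterlim g at_top at_top"
    by (simp add: g_def divide_inverse)
  have "((\<lambda>t. g (x * t) / g t) \<longlongrightarrow> x powr \<alpha>) at_top" if x: "0 < x" for x
  proof -
    have "((\<lambda>t. inverse (?p (x * t) / ?p t))
       \<longlongrightarrow> inverse (x powr (- \<alpha>))) at_top"
      using pt x by (intro tendsto_inverse) (auto simp: power_tail_def)
    moreover have "inverse (?p (x * t) / ?p t)
      = g (x * t) / g t" for t
      using c pos by (simp add: g_def field_simps)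
    ultimately show ?thesis
      by (simp add: powr_minus)
  qed
  then show "g \<in> RV_class \<alpha>"
    using g_pos meas unfolding RV_class_def by (auto intro: measurable_restrict_space1)
qed

text \<open>
  Replacing \<open>t\<close> by \<open>x t\<close> multiplies the normalisation by a factor that tends to \<open>x powr \<alpha>\<close>, and rescales the
  test function. Uniqueness of limits therefore makes the limit measure homogeneous: it gives \<open>(u, \<infinity>)\<close> the mass
  \<open>H u = H 1 * u powr (- \<alpha>)\<close>. The constant \<open>H 1\<close> is positive since some set bounded away from 0 has
  positive mass.
\<close>

lemma in_RV_half_line_power_tail:
  assumes M: "prob_space M" and \<zeta>[measurable]: "\<zeta> \<in> borel_measurable M"
    and g: "g \<in> RV_class \<alpha>"
    and rv: "in_RV M \<zeta> {0..} (\<lambda>t x. t * x) (modulus_ideal {0..} (\<lambda>x. x)) g \<mu>"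
  shows "power_tail M \<zeta> \<alpha>"
proof -
  interpret prob_space M by fact
  let ?R = "modulus_ideal {0..} (\<lambda>x::real. x)"
  have U: "\<Union>?R = {0<..}"
    unfolding Union_modulus_ideal by auto
  have sets_\<mu>: "sets \<mu> = sets (restrict_space borel {0..})"
    using rv by (simp add: in_RV_def)
  have space_\<mu>: "space \<mu> = {0..}"
    using space_restrict_borel_sets[OF sets_\<mu>] .
  have g_nonneg: "\<And>t. 0 \<le> t \<Longrightarrow> 0 \<le> g t"
    using rv by (simp add: in_RV_def)
  have tail_sets: "{u<..} \<in> sets \<mu>" and tail_finite: "emeasure \<mu> {u<..} < \<infinity>" if u: "0 < u" for u
  proof -
    show *: "{u<..} \<in> sets \<mu>"
      using u unfolding sets_\<mu> by (auto simp: sets_restrict_space_iff)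
    have "{u<..} \<in> ?R"
      using u by (auto simp: modulus_ideal_iff)
    then show "emeasure \<mu> {u<..} < \<infinity>"
      using rv * by (simp add: in_RV_def)
  qed
  define H where "H u = measure \<mu> {u<..}" for u
  define I where "I a b = (\<integral>x. ramp a b x \<partial>\<mu>)" for a b
  have ramp_meas[measurable]: "ramp a b \<in> borel_measurable \<mu>" for a b
    by (intro borel_measurable_continuous_on_sets[OF _ sets_\<mu>] continuous_on_ramp)
  have ind_int: "integrable \<mu> (indicat_real {u<..})" if "0 < u" for u
    using tail_sets[OF that] tail_finite[OF that] by (simp add: integrable_indicator_iff)
  have ind_eq: "(\<integral>x. indicat_real {u<..} x \<partial>\<mu>) = H u" if "0 < u" for u
    using that by (simp add: H_def space_\<mu> Int_absorb2 subset_iff)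
  have ramp_int: "integrable \<mu> (ramp a b)" if "0 < a" "a < b" for a b
    using ramp_le_indicator[OF that(2)] ramp_bounds[of a b]
    by (intro Bochner_Integration.integrable_bound[OF ind_int[OF that(1)]]) auto
  have I: "H b \<le> I a b" "I a b \<le> H a" if "0 < a" "a < b" for a b
  proof -
    have "0 < b" using that by simp
    show "H b \<le> I a b"
      unfolding I_def ind_eq[OF \<open>0 < b\<close>, symmetric]
      by (intro integral_mono ind_int ramp_int that \<open>0 < b\<close> indicator_le_ramp)
    show "I a b \<le> H a"
      unfolding I_def ind_eq[OF that(1), symmetric]
      by (intro integral_mono ind_int ramp_int that ramp_le_indicator)
  qed
  let ?e = "\<lambda>a b t. \<integral>\<omega>. ramp a b (inverse t * \<zeta> \<omega>) \<partial>M"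
  have conv: "((\<lambda>t. g t * ?e a b t) \<longlongrightarrow> I a b) at_top"
    if ab: "0 < a" "a < b" for a b
  proof -
    have "closure {x \<in> {0..}. ramp a b x \<noteq> 0} \<subseteq> {a..}"
    proof (intro closure_minimal subsetI)
      fix x assume "x \<in> {x \<in> {0..}. ramp a b x \<noteq> 0}"
      then show "x \<in> {a..}" using ramp_eq_0[OF ab(2), of x] by (cases "x \<le> a") auto
    qed simp
    then have "{0..} \<inter> closure {x \<in> {0..}. ramp a b x \<noteq> 0} \<in> ?R"
      using ab unfolding modulus_ideal_iff by (intro conjI exI[of _ "a / 2"]) force+
    moreover have "bounded (ramp a b ` {0<..})"
      using ramp_bounds[of a b] by (intro boundedI[where B=1]) auto
    moreover have "\<forall>x. x \<notin> {0<..} \<longrightarrow> ramp a b x = 0"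
      using ab by (auto intro!: ramp_eq_0)
    ultimately show ?thesis
      using rv continuous_on_ramp[of "{0<..}" a b] unfolding in_RV_def U I_def by blast
  qed
  have I_scale: "I (x * a) (x * b) * x powr \<alpha> = I a b" if ab: "0 < a" "a < b" and x: "0 < x" for a b x
  proof -
    have "((\<lambda>t. g t * ?e (x * a) (x * b) t * (g (x * t) / g t))
        \<longlongrightarrow> I (x * a) (x * b) * x powr \<alpha>) at_top"
      using g ab x by (intro tendsto_mult conv) (auto simp: RV_class_def)
    moreover have "eventually (\<lambda>t. g t * ?e (x * a) (x * b) t * (g (x * t) / g t)
        = g (x * t) * ?e a b (x * t)) at_top"
      using eventually_gt_at_top[of 0]
    proof eventually_elim
      case (elim t)
      then have "0 < g t" using g by (auto simp: RV_class_def)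
      moreover have "ramp (x * a) (x * b) (inverse t * y) = ramp a b (inverse (x * t) * y)" for y
        unfolding ramp_scale[OF x] by (simp add: divide_inverse ac_simps)
      ultimately show ?case
        by simp
    qed
    ultimately have 1: "((\<lambda>t. g (x * t) * ?e a b (x * t))
        \<longlongrightarrow> I (x * a) (x * b) * x powr \<alpha>) at_top"
      by (simp add: tendsto_cong)
    have "filterlim (\<lambda>t. x * t) at_top at_top"
      by (rule filterlim_tendsto_pos_mult_at_top[OF tendsto_const x filterlim_ident])
    from filterlim_compose[OF conv[OF ab] this]
    have 2: "((\<lambda>t. g (x * t) * ?e a b (x * t)) \<longlongrightarrow> I a b) at_top" .
    show ?thesis
      using tendsto_unique[OF _ 1 2] by simp
  qed
  have I_H: "(\<lambda>n. I u (u * (1 + 1 / Suc n))) \<longlonglongrightarrow> H u" if u: "0 < u" for u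
    unfolding I_def ind_eq[OF u, symmetric]
  proof (rule integral_dominated_convergence[OF _ _ ind_int[OF u]])
    show "AE x in \<mu>. norm (ramp u (u * (1 + 1 / real (Suc n))) x) \<le> indicat_real {u<..} x" for n
    proof -
      have "u < u * (1 + 1 / real (Suc n))" using u by simp
      then show ?thesis using ramp_bounds ramp_le_indicator by auto
    qed
    show "AE x in \<mu>. (\<lambda>n. ramp u (u * (1 + 1 / real (Suc n))) x) \<longlonglongrightarrow> indicat_real {u<..} x"
      using ramp_tendsto_indicator[OF u] by (intro AE_I2)
  qed (use tail_sets[OF u] in auto)
  have H_scale: "H u = H 1 * u powr (- \<alpha>)" if u: "0 < u" for u
  proof -
    have "(\<lambda>n. I (u * 1) (u * (1 * (1 + 1 / Suc n))) * u powr \<alpha>) \<longlonglongrightarrow> H u * u powr \<alpha>"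
      using I_H[OF u] by (intro tendsto_mult tendsto_const) simp
    moreover have "I (u * 1) (u * (1 * (1 + 1 / Suc n))) * u powr \<alpha> = I 1 (1 * (1 + 1 / Suc n))" for n
      using I_scale[of 1 "1 * (1 + 1 / Suc n)" u] u by simp
    ultimately have "H u * u powr \<alpha> = H 1"
      using I_H[of 1] by (simp add: LIMSEQ_unique)
    then show ?thesis
      using u by (simp add: powr_minus field_simps)
  qed
  have "H 1 \<noteq> 0"
  proof
    assume "H 1 = 0"
    obtain B where B: "B \<in> sets \<mu>" "B \<in> ?R" "0 < emeasure \<mu> B"
      using rv by (auto simp: in_RV_def)
    then obtain \<epsilon> where \<epsilon>: "0 < \<epsilon>" "B \<subseteq> {\<epsilon><..}"
      by (auto simp: modulus_ideal_iff)
    have "H \<epsilon> = 0"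
      using H_scale[OF \<epsilon>(1)] \<open>H 1 = 0\<close> by simp
    then have "emeasure \<mu> {\<epsilon><..} = 0"
      using tail_finite[OF \<epsilon>(1)] by (auto simp: H_def measure_def enn2real_eq_0_iff)
    then show False
      using emeasure_mono[OF \<epsilon>(2) tail_sets[OF \<epsilon>(1)]] B(3) by simp
  qed
  show ?thesis
  proof (rule power_tailI[OF M \<zeta> \<open>H 1 \<noteq> 0\<close>])
    fix u :: real assume u: "0 < u"
    have "((\<lambda>t. g t * (\<integral>\<omega>. 1 * indicat_real {u<..} (inverse t * \<zeta> \<omega>) \<partial>M)) \<longlongrightarrow> H 1 * u powr (- \<alpha>)) at_top"
    proof (rule tendsto_indicator_from_ramps[where I=I and C=1, OF M])
      show "isCont (\<lambda>u. H 1 * u powr (- \<alpha>)) u"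
        using u by (intro continuous_intros) auto
      fix a b :: real assume ab: "0 < a" "a < b"
      show "((\<lambda>t. g t * (\<integral>\<omega>. 1 * ramp a b (inverse t * \<zeta> \<omega>) \<partial>M)) \<longlongrightarrow> I a b) at_top"
        using conv[OF ab] by simp
      show "H 1 * b powr (- \<alpha>) \<le> I a b" "I a b \<le> H 1 * a powr (- \<alpha>)"
        using I[OF ab] H_scale[of a] H_scale[of b] ab by auto
    qed (use g_nonneg u in auto)
    moreover have "eventually (\<lambda>t. (\<integral>\<omega>. 1 * indicat_real {u<..} (inverse t * \<zeta> \<omega>) \<partial>M)
      = measure M {\<omega> \<in> space M. u * t < \<zeta> \<omega>}) at_top"
      using eventually_gt_at_top[of 0]
    proof eventually_elim
      case (elim t)
      then have "(\<integral>\<omega>. 1 * indicat_real {u<..} (inverse t * \<zeta> \<omega>) \<partial>M) = (\<integral>\<omega>. indicat_real {\<omega> \<in> space M. u * t < \<zeta> \<omega>} \<omega> \<partial>M)"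
        by (intro Bochner_Integration.integral_cong) (auto simp: indicator_def field_simps)
      then show ?case by (simp add: Int_absorb2)
    qed
    ultimately show "((\<lambda>t. g t * measure M {\<omega> \<in> space M. u * t < \<zeta> \<omega>}) \<longlongrightarrow> H 1 * u powr (- \<alpha>)) at_top"
      by (rule Lim_transform_eventually[OF _ eventually_mono]) simp
  qed
qed

section \<open>Radial measures\<close>

text \<open>
  For \<open>\<alpha> > 0\<close>, the image of \<open>theta \<alpha>\<close> under \<open>r \<mapsto> 1 / r\<close>. The inverse radius \<open>t\<close> is the integration variable in
  the formula for the limit measure, so that no substitution is needed there.
\<close>

definition radial_measure :: "real \<Rightarrow> real measure" where
  "radial_measure \<alpha> = density lborel (\<lambda>t. ennreal (\<alpha> * t powr (\<alpha> - 1)) * indicator {0<..} t)"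

lemma sets_radial_measure[simp, measurable_cong]: "sets (radial_measure \<alpha>) = sets borel"
  by (simp add: radial_measure_def)

lemma space_radial_measure[simp]: "space (radial_measure \<alpha>) = UNIV"
  by (simp add: radial_measure_def)

lemma sigma_finite_radial_measure: "sigma_finite_measure (radial_measure \<alpha>)"
  unfolding radial_measure_def
  by (subst sigma_finite_measure.sigma_finite_iff_density_finite[OF sigma_finite_lborel])
     (auto simp: indicator_def ennreal_mult_eq_top_iff)

lemma nn_integral_radial_measure:
  assumes [measurable]: "f \<in> borel_measurable borel"
  shows "(\<integral>\<^sup>+t. f t \<partial>radial_measure \<alpha>) =
    (\<integral>\<^sup>+t. ennreal (\<alpha> * t powr (\<alpha> - 1)) * indicator {0<..} t * f t \<partial>lborel)"
  unfolding radial_measure_def by (subst nn_integral_density) auto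

lemma emeasure_radial_measure_nonpos: "emeasure (radial_measure \<alpha>) {..0} = 0"
  by (simp add: radial_measure_def emeasure_density mult.assoc flip: indicator_inter_arith)

lemma emeasure_radial_measure:
  assumes \<alpha>: "0 < \<alpha>" and u: "0 < u"
  shows "emeasure (radial_measure \<alpha>) {t. 0 < t \<and> u < inverse t} = ennreal (u powr (- \<alpha>))"
proof -
  have eq: "{t. 0 < t \<and> u < inverse t} = {0<..<inverse u}"
    using u by (auto simp: field_simps)
  have "((\<lambda>t. \<alpha> * t powr (\<alpha> - 1)) has_integral \<alpha> * (inverse u powr (\<alpha> - 1 + 1) / (\<alpha> - 1 + 1))) {0..inverse u}"
    using \<alpha> u by (intro has_integral_mult_right has_integral_powr_from_0) auto
  then have "integral\<^sup>N lborel (\<lambda>t. indicator {0..inverse u} t * (\<alpha> * t powr (\<alpha> - 1))) = ennreal (u powr (- \<alpha>))"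
    using \<alpha> u by (subst nn_integral_has_integral_lebesgue) (auto simp: powr_minus inverse_powr)
  moreover have "emeasure (radial_measure \<alpha>) {0<..<inverse u} =
    integral\<^sup>N lborel (\<lambda>t. indicator {0..inverse u} t * (\<alpha> * t powr (\<alpha> - 1)))"
  proof -
    have "AE t in lborel. t \<noteq> 0 \<and> t \<noteq> inverse u"
      by (intro AE_conjI AE_lborel_singleton)
    then have "AE t in lborel. ennreal (\<alpha> * t powr (\<alpha> - 1)) * indicator {0<..} t * indicator {0<..<inverse u} t =
      ennreal (indicator {0..inverse u} t * (\<alpha> * t powr (\<alpha> - 1)))"
      by eventually_elim (auto simp: indicator_def)
    then show ?thesis
      unfolding radial_measure_def by (subst emeasure_density) (auto intro!: nn_integral_cong_AE)
  qed
  ultimately show ?thesis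
    by (simp add: eq)
qed

lemma sigma_finite_theta: "sigma_finite_measure (theta \<alpha>)"
  unfolding theta_def
  by (subst sigma_finite_measure.sigma_finite_iff_density_finite)
     (auto intro!: sigma_finite_measure_restrict_space sigma_finite_lborel measurable_restrict_space1)

lemma emeasure_theta:
  assumes \<alpha>: "0 < \<alpha>" and u: "0 < u"
  shows "{u<..} \<in> sets (theta \<alpha>)" "emeasure (theta \<alpha>) {u<..} = ennreal (u powr (- \<alpha>))"
proof -
  show sets: "{u<..} \<in> sets (theta \<alpha>)"
    using u by (auto simp: theta_def sets_restrict_space_iff)
  have "((\<lambda>s. \<alpha> * s powr (- \<alpha> - 1)) has_integral \<alpha> * (- (u powr (- \<alpha> - 1 + 1)) / (- \<alpha> - 1 + 1))) {u..}"
    using \<alpha> u by (intro has_integral_mult_right has_integral_powr_to_inf) auto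
  then have "integral\<^sup>N lborel (\<lambda>s. indicator {u..} s * (\<alpha> * s powr (- \<alpha> - 1))) = ennreal (u powr (- \<alpha>))"
    using \<alpha> u by (subst nn_integral_has_integral_lebesgue) auto
  moreover have "emeasure (theta \<alpha>) {u<..} =
    integral\<^sup>N lborel (\<lambda>s. indicator {u..} s * (\<alpha> * s powr (- \<alpha> - 1)))"
  proof -
    have "AE s in lborel. s \<noteq> u"
      by (intro AE_lborel_singleton)
    then have "AE s in lborel. ennreal (\<alpha> * s powr (- \<alpha> - 1)) * indicator {u<..} s * indicator {0<..} s =
      ennreal (indicator {u..} s * (\<alpha> * s powr (- \<alpha> - 1)))"
      by eventually_elim (use u in \<open>auto simp: indicator_def\<close>)
    then show ?thesis
      using sets unfolding theta_def
      by (subst emeasure_density)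
         (auto simp: nn_integral_restrict_space intro!: nn_integral_cong_AE measurable_restrict_space1)
  qed
  ultimately show "emeasure (theta \<alpha>) {u<..} = ennreal (u powr (- \<alpha>))"
    by simp
qed

section \<open>Polar coordinates\<close>

text \<open>
  A function that is measurable in one variable and continuous in a real variable is the limit of functions that
  depend on the real variable only through a countable grid. The grid points lie above \<open>t\<close>, so they stay positive.
\<close>

lemma borel_measurable_Caratheodory:
  fixes h :: "'b \<Rightarrow> real \<Rightarrow> real"
  assumes meas: "\<And>t. 0 < t \<Longrightarrow> (\<lambda>s. h s t) \<in> borel_measurable N"
    and cont: "\<And>s. s \<in> space N \<Longrightarrow> continuous_on {0<..} (h s)"
  shows "(\<lambda>(s, t). h s (if 0 < t then t else 1)) \<in> borel_measurable (N \<Otimes>\<^sub>M borel)"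
proof -
  define p where "p t = (if 0 < t then t else 1)" for t :: real
  have p_pos: "0 < p t" for t by (simp add: p_def)
  have p_meas[measurable]: "p \<in> borel_measurable borel" unfolding p_def by measurable
  define r where "r n t = (real_of_int \<lfloor>p t * Suc n\<rfloor> + 1) / Suc n" for n t
  have r_bounds: "p t < r n t" "r n t \<le> p t + 1 / Suc n" for n t
  proof -
    define z where "z = real_of_int \<lfloor>p t * Suc n\<rfloor>"
    have z: "p t * Suc n < z + 1" "z + 1 \<le> p t * Suc n + 1"
      unfolding z_def by linarith+
    have "p t = p t * Suc n / Suc n"
      by simp
    also have "\<dots> < (z + 1) / Suc n"
      by (intro divide_strict_right_mono z) simp
    finally show "p t < r n t"
      by (simp only: r_def z_def)
    have "(z + 1) / Suc n \<le> (p t * Suc n + 1) / Suc n"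
      by (intro divide_right_mono z) simp
    also have "\<dots> = p t + 1 / Suc n"
      by (subst add_divide_distrib) simp
    finally show "r n t \<le> p t + 1 / Suc n"
      by (simp only: r_def z_def)
  qed
  have "(\<lambda>x. h (fst x) (p (snd x))) \<in> borel_measurable (N \<Otimes>\<^sub>M borel)"
  proof (rule borel_measurable_LIMSEQ_metric[where f="\<lambda>n x. h (fst x) (r n (snd x))"])
    fix n
    define f where "f i x = h (fst x) (p ((real_of_int i + 1) / Suc n))" for i :: int and x :: "'b \<times> real"
    have "(\<lambda>x. f \<lfloor>p (snd x) * Suc n\<rfloor> x) \<in> borel_measurable (N \<Otimes>\<^sub>M borel)"
    proof (rule measurable_compose_countable)
      show "f i \<in> borel_measurable (N \<Otimes>\<^sub>M borel)" for i
        unfolding f_def by (rule measurable_compose[OF measurable_fst meas[OF p_pos]])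
      show "(\<lambda>x. \<lfloor>p (snd x) * real (Suc n)\<rfloor>) \<in> N \<Otimes>\<^sub>M borel \<rightarrow>\<^sub>M count_space UNIV"
        by measurable
    qed
    also have "(\<lambda>x. f \<lfloor>p (snd x) * Suc n\<rfloor> x) = (\<lambda>x. h (fst x) (r n (snd x)))"
    proof
      fix x :: "'b \<times> real"
      have "0 < r n (snd x)" using r_bounds(1)[of "snd x" n] p_pos[of "snd x"] by linarith
      then show "f \<lfloor>p (snd x) * Suc n\<rfloor> x = h (fst x) (r n (snd x))"
        by (simp add: f_def r_def p_def)
    qed
    finally show "(\<lambda>x. h (fst x) (r n (snd x))) \<in> borel_measurable (N \<Otimes>\<^sub>M borel)" .
  next
    fix x assume x: "x \<in> space (N \<Otimes>\<^sub>M (borel :: real measure))"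
    have "(\<lambda>n. r n (snd x)) \<longlonglongrightarrow> p (snd x)"
    proof (rule tendsto_sandwich[of "\<lambda>_. p (snd x)" _ _ "\<lambda>n. p (snd x) + 1 / Suc n"])
      have "(\<lambda>n. p (snd x) + 1 / Suc n) \<longlonglongrightarrow> p (snd x) + 0"
        by (intro tendsto_intros LIMSEQ_Suc[OF lim_1_over_n])
      then show "(\<lambda>n. p (snd x) + 1 / Suc n) \<longlonglongrightarrow> p (snd x)" by simp
      show "eventually (\<lambda>n. p (snd x) \<le> r n (snd x)) sequentially"
        using less_imp_le[OF r_bounds(1)] by (intro always_eventually allI)
      show "eventually (\<lambda>n. r n (snd x) \<le> p (snd x) + 1 / Suc n) sequentially"
        using r_bounds(2) by (intro always_eventually allI)
    qed simp
    moreover have "isCont (h (fst x)) (p (snd x))"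
      using cont[of "fst x"] x p_pos by (auto simp: space_pair_measure continuous_on_eq_continuous_at)
    ultimately show "(\<lambda>n. h (fst x) (r n (snd x))) \<longlonglongrightarrow> h (fst x) (p (snd x))"
      by (rule isCont_tendsto_compose[rotated])
  qed
  then show ?thesis
    by (simp add: p_def case_prod_unfold)
qed

locale scaled_space =
  fixes T :: "real \<Rightarrow> 'a::topological_space \<Rightarrow> 'a" and \<tau> :: "'a \<Rightarrow> real"
  assumes normal: "perfectly_normal_on (UNIV :: 'a set)"
    and scaling: "continuous_scaling_on UNIV T"
    and modulus: "continuous_finite_modulus_on UNIV T \<tau>"
begin

abbreviation sphere :: "'a set" where
  "sphere \<equiv> modulus_sphere UNIV \<tau>"

abbreviation ideal :: "'a set set" where
  "ideal \<equiv> modulus_ideal UNIV \<tau>"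

lemma Union_ideal: "\<Union>ideal = {x. 0 < \<tau> x}"
  by (simp add: Union_modulus_ideal)

definition direction :: "'a \<Rightarrow> 'a" where
  "direction x = T (inverse (\<tau> x)) x"

lemma T_T: "0 < t \<Longrightarrow> 0 < s \<Longrightarrow> T t (T s x) = T (t * s) x"
  and T_1: "T 1 x = x"
  and tau_T: "0 < t \<Longrightarrow> \<tau> (T t x) = t * \<tau> x"
  and tau_nonneg: "0 \<le> \<tau> x"
  using scaling modulus by (auto simp: continuous_scaling_on_def continuous_finite_modulus_on_def)

lemma continuous_on_tau: "continuous_on A \<tau>"
  using modulus by (auto simp: continuous_finite_modulus_on_def intro: continuous_on_subset[where s=UNIV])

lemma borel_measurable_tau[measurable]: "\<tau> \<in> borel_measurable borel"
  by (intro borel_measurable_continuous_onI continuous_on_tau)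

lemma continuous_on_T:
  assumes "continuous_on A f" "continuous_on A r" "\<And>x. x \<in> A \<Longrightarrow> 0 < r x"
  shows "continuous_on A (\<lambda>x. T (r x) (f x))"
proof -
  have "continuous_on (UNIV \<times> {0<..}) (\<lambda>(x, t). T t x)"
    using scaling by (simp add: continuous_scaling_on_def)
  from continuous_on_compose2[OF this continuous_on_Pair[OF assms(1,2)]] show ?thesis
    using assms(3) by (auto simp: image_subset_iff)
qed

lemma mem_sphere: "x \<in> sphere \<longleftrightarrow> \<tau> x = 1"
  by (simp add: modulus_sphere_def)

lemma closed_sphere: "closed sphere"
  using continuous_closed_preimage_constant[OF continuous_on_tau closed_UNIV, of 1] by (simp add: modulus_sphere_def)

lemma open_tau_greater: "open {x. u < \<tau> x}"
  using continuous_on_tau[of UNIV] by (intro open_Collect_less) auto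

lemma functionally_open_UNIV: "functionally_open_in UNIV (U :: 'a set) \<longleftrightarrow> open U"
proof -
  have "openin (top_of_set UNIV) U \<longleftrightarrow> open U"
    by simp
  then show ?thesis
    using functionally_open_in_openin[of UNIV U] perfectly_normal_openin_functionally_open_in[OF normal closed_UNIV, of U]
    by blast
qed

lemma functionally_open_sphere: "openin (top_of_set sphere) U \<Longrightarrow> functionally_open_in sphere U"
  by (rule perfectly_normal_openin_functionally_open_in[OF normal closed_sphere])

lemma direction_in_sphere: "0 < \<tau> x \<Longrightarrow> direction x \<in> sphere"
  by (simp add: direction_def mem_sphere tau_T)

lemma direction_T: "0 < t \<Longrightarrow> 0 < \<tau> x \<Longrightarrow> direction (T t x) = direction x"
proof -
  assume "0 < t" "0 < \<tau> x"
  moreover from this have "inverse (t * \<tau> x) * t = inverse (\<tau> x)"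
    by (simp add: field_simps)
  ultimately show ?thesis
    by (simp only: direction_def tau_T T_T inverse_positive_iff_positive mult_pos_pos)
qed

lemma direction_sphere: "s \<in> sphere \<Longrightarrow> direction s = s"
  by (simp add: direction_def mem_sphere T_1)

lemma T_direction: "0 < \<tau> x \<Longrightarrow> T (\<tau> x) (direction x) = x"
  by (simp add: direction_def T_T T_1)

lemma continuous_on_direction: "continuous_on {x. 0 < \<tau> x} direction"
  unfolding direction_def
  by (intro continuous_on_T continuous_on_id continuous_on_inverse continuous_on_tau) auto

lemma measurable_direction:
  assumes "sets \<sigma> = sets (restrict_space borel sphere)"
  shows "direction \<in> restrict_space borel {x. 0 < \<tau> x} \<rightarrow>\<^sub>M \<sigma>"
proof -
  have "direction \<in> restrict_space borel {x. 0 < \<tau> x} \<rightarrow>\<^sub>M restrict_space borel sphere"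
  proof (rule measurable_restrict_space2)
    show "direction \<in> space (restrict_space borel {x. 0 < \<tau> x}) \<rightarrow> sphere"
      by (intro funcsetI direction_in_sphere) (simp add: space_restrict_space)
    show "direction \<in> restrict_space borel {x. 0 < \<tau> x} \<rightarrow>\<^sub>M borel"
      by (rule borel_measurable_continuous_on_restrict[OF continuous_on_direction])
  qed
  also have "(restrict_space borel {x. 0 < \<tau> x} \<rightarrow>\<^sub>M restrict_space borel sphere) =
      (restrict_space borel {x. 0 < \<tau> x} \<rightarrow>\<^sub>M \<sigma>)"
    by (rule measurable_cong_sets[OF refl assms[symmetric]])
  finally show ?thesis .
qed

lemma borel_measurable_direction_tail:
  assumes \<sigma>: "sets \<sigma> = sets (restrict_space borel sphere)" and k: "k \<in> borel_measurable \<sigma>" and u: "0 \<le> u"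
  shows "(\<lambda>x. k (direction x) * indicator {u<..} (\<tau> x) :: real) \<in> borel_measurable borel"
proof -
  have U: "{x. 0 < \<tau> x} \<inter> space borel \<in> sets borel"
    using open_tau_greater[of 0] by simp
  have "(\<lambda>x. k (direction x)) \<in> borel_measurable (restrict_space borel {x. 0 < \<tau> x})"
    by (rule measurable_compose[OF measurable_direction[OF \<sigma>] k])
  then have 1: "(\<lambda>x. indicator {x. 0 < \<tau> x} x *\<^sub>R k (direction x)) \<in> borel_measurable borel"
    by (subst (asm) borel_measurable_restrict_space_iff[OF U]) simp
  have "(\<lambda>x. (indicator {x. 0 < \<tau> x} x *\<^sub>R k (direction x)) * indicator {u<..} (\<tau> x)) \<in> borel_measurable borel"
    by (intro borel_measurable_times 1) measurable
  also have "(\<lambda>x. (indicator {x. 0 < \<tau> x} x *\<^sub>R k (direction x)) * indicator {u<..} (\<tau> x)) =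
      (\<lambda>x. k (direction x) * indicator {u<..} (\<tau> x))"
    using u by (auto simp: indicator_def fun_eq_iff)
  finally show ?thesis .
qed

text \<open>
  The second coordinate is the inverse radius. At \<open>t \<le> 0\<close> the value 1 is substituted, so that every slice
  \<open>s \<mapsto> polar_map (s, t)\<close> is continuous; these \<open>t\<close> are null for the radial measure.
\<close>

definition polar_map :: "'a \<times> real \<Rightarrow> 'a" where
  "polar_map = (\<lambda>(s, t). T (inverse (if 0 < t then t else 1)) s)"

abbreviation slice :: "'a set \<Rightarrow> real \<Rightarrow> 'a set" where
  "slice B t \<equiv> {s \<in> sphere. polar_map (s, t) \<in> B}"

text \<open>
  An open set is \<open>{h \<noteq> 0}\<close> for a continuous real function \<open>h\<close>, which reduces measurability with respect to
  the product sigma-algebra to the real-valued case.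
\<close>

lemma measurable_polar_map:
  assumes \<sigma>: "sets \<sigma> = sets (restrict_space borel sphere)"
  shows "polar_map \<in> \<sigma> \<Otimes>\<^sub>M borel \<rightarrow>\<^sub>M borel"
proof (rule borel_measurableI)
  fix U :: "'a set" assume "open U"
  then have "functionally_open_in UNIV U"
    by (simp only: functionally_open_UNIV)
  then obtain h :: "'a \<Rightarrow> real" where h: "continuous_on UNIV h" "U = UNIV - {x \<in> UNIV. h x = 0}"
    unfolding functionally_open_in_def by blast
  have hT: "continuous_on A (\<lambda>x. h (T (r x) (f x)))"
    if "continuous_on A f" "continuous_on A r" "\<And>x. x \<in> A \<Longrightarrow> 0 < r x"
    for A :: "'b::topological_space set" and f r
    using continuous_on_compose2[OF h(1) continuous_on_T[OF that]] by simp
  have "(\<lambda>(s, t). h (T (inverse (if 0 < t then t else 1)) s)) \<in> borel_measurable (\<sigma> \<Otimes>\<^sub>M borel)"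
  proof (rule borel_measurable_Caratheodory)
    show "(\<lambda>s. h (T (inverse t) s)) \<in> borel_measurable \<sigma>" if "0 < t" for t
      using that by (intro borel_measurable_continuous_on_sets[OF _ \<sigma>] hT continuous_on_id continuous_on_const) auto
    show "continuous_on {0<..} (\<lambda>t. h (T (inverse t) s))" for s
      by (intro hT continuous_on_const continuous_on_inverse continuous_on_id) auto
  qed
  then have m: "(\<lambda>x. h (polar_map x)) \<in> borel_measurable (\<sigma> \<Otimes>\<^sub>M borel)"
    by (simp add: polar_map_def case_prod_unfold)
  have "(\<lambda>x. h (polar_map x)) -` (- {0}) \<inter> space (\<sigma> \<Otimes>\<^sub>M borel) \<in> sets (\<sigma> \<Otimes>\<^sub>M borel)"
    by (rule measurable_sets[OF m]) auto
  also have "(\<lambda>x. h (polar_map x)) -` (- {0}) = polar_map -` U"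
    using h(2) by auto
  finally show "polar_map -` U \<inter> space (\<sigma> \<Otimes>\<^sub>M borel) \<in> sets (\<sigma> \<Otimes>\<^sub>M borel)" .
qed

lemma T_image_Int_sphere: "0 < t \<Longrightarrow> T t ` B \<inter> sphere = slice B t"
proof (intro equalityI subsetI)
  fix s assume t: "0 < t" and "s \<in> slice B t"
  then have "s \<in> sphere" "T (inverse t) s \<in> B" by (auto simp: polar_map_def)
  moreover have "T t (T (inverse t) s) = s"
    using t by (simp add: T_T T_1)
  ultimately show "s \<in> T t ` B \<inter> sphere"
    using image_eqI[of s "T t" "T (inverse t) s" B] by simp
next
  fix s assume t: "0 < t" and "s \<in> T t ` B \<inter> sphere"
  then obtain b where b: "s = T t b" "b \<in> B" "s \<in> sphere" by blast
  have "polar_map (s, t) = T (inverse t * t) b"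
    unfolding b(1) polar_map_def using t by (simp add: T_T del: left_inverse)
  then show "s \<in> slice B t"
    using t b by (simp add: T_1)
qed

end

section \<open>Homogeneous measures\<close>

locale spherical_measure = scaled_space T \<tau> for T :: "real \<Rightarrow> 'a::topological_space \<Rightarrow> 'a" and \<tau> +
  fixes \<sigma> :: "'a measure"
  assumes sets_\<sigma>: "sets \<sigma> = sets (restrict_space borel (modulus_sphere UNIV \<tau>))"
    and finite_\<sigma>: "finite_measure \<sigma>"
begin

sublocale \<sigma>: finite_measure \<sigma>
  by (rule finite_\<sigma>)

lemma space_\<sigma>: "space \<sigma> = sphere"
  using space_restrict_borel_sets[OF sets_\<sigma>] .

definition homogeneous :: "real \<Rightarrow> 'a measure" where
  "homogeneous \<alpha> = distr (\<sigma> \<Otimes>\<^sub>M radial_measure \<alpha>) borel polar_map"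

lemma sets_homogeneous[simp, measurable_cong]: "sets (homogeneous \<alpha>) = sets borel"
  and space_homogeneous[simp]: "space (homogeneous \<alpha>) = UNIV"
  by (simp_all add: homogeneous_def)

lemma measurable_polar_map_radial: "polar_map \<in> \<sigma> \<Otimes>\<^sub>M radial_measure \<alpha> \<rightarrow>\<^sub>M borel"
  using measurable_polar_map[OF sets_\<sigma>]
  by (subst measurable_cong_sets[where M'="\<sigma> \<Otimes>\<^sub>M borel" and N'=borel]) (auto intro!: sets_pair_measure_cong)

lemma
  assumes B: "B \<in> sets borel"
  shows emeasure_homogeneous:
      "emeasure (homogeneous \<alpha>) B = (\<integral>\<^sup>+t. emeasure \<sigma> (slice B t) \<partial>radial_measure \<alpha>)"
    and borel_measurable_emeasure_slice: "(\<lambda>t. emeasure \<sigma> (slice B t)) \<in> borel_measurable borel"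
    and slice_sets: "slice B t \<in> sets \<sigma>"
proof -
  interpret pair_sigma_finite \<sigma> "radial_measure \<alpha>"
    by (intro pair_sigma_finite.intro sigma_finite_radial_measure \<sigma>.sigma_finite_measure_axioms)
  let ?P = "polar_map -` B \<inter> space (\<sigma> \<Otimes>\<^sub>M radial_measure \<alpha>)"
  have P: "?P \<in> sets (\<sigma> \<Otimes>\<^sub>M radial_measure \<alpha>)"
    by (rule measurable_sets[OF measurable_polar_map_radial B])
  have slice: "(\<lambda>s. (s, t)) -` ?P = slice B t" for t
    by (auto simp: space_pair_measure space_\<sigma>)
  show "emeasure (homogeneous \<alpha>) B = (\<integral>\<^sup>+t. emeasure \<sigma> (slice B t) \<partial>radial_measure \<alpha>)"
    unfolding homogeneous_def
    by (subst emeasure_distr[OF measurable_polar_map_radial B]) (simp only: emeasure_pair_measure_alt2[OF P] slice)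
  show "(\<lambda>t. emeasure \<sigma> (slice B t)) \<in> borel_measurable borel"
    using measurable_emeasure_Pair2[OF P] unfolding slice by simp
  show "slice B t \<in> sets \<sigma>"
    using sets_Pair2[OF P, of t] unfolding slice .
qed

lemma emeasure_homogeneous_scaled:
  assumes \<alpha>: "0 < \<alpha>" and B: "B \<in> sets borel"
  shows "emeasure (homogeneous \<alpha>) B =
    ennreal \<alpha> * (\<integral>\<^sup>+ t \<in> {0<..}. emeasure \<sigma> (T t ` B \<inter> sphere) * ennreal (t powr (\<alpha> - 1)) \<partial>lborel)"
proof -
  define e where "e t = emeasure \<sigma> (slice B t)" for t
  have e[measurable]: "e \<in> borel_measurable borel"
    unfolding e_def by (rule borel_measurable_emeasure_slice[OF B])
  have "emeasure (homogeneous \<alpha>) B =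
      (\<integral>\<^sup>+t. ennreal (\<alpha> * t powr (\<alpha> - 1)) * indicator {0<..} t * e t \<partial>lborel)"
    unfolding emeasure_homogeneous[OF B] e_def[symmetric] by (rule nn_integral_radial_measure[OF e])
  also have "\<dots> = (\<integral>\<^sup>+t. ennreal \<alpha> * (e t * ennreal (t powr (\<alpha> - 1)) * indicator {0<..} t) \<partial>lborel)"
    using \<alpha> by (intro nn_integral_cong) (simp add: ennreal_mult ac_simps)
  also have "\<dots> = ennreal \<alpha> * (\<integral>\<^sup>+t. e t * ennreal (t powr (\<alpha> - 1)) * indicator {0<..} t \<partial>lborel)"
    by (rule nn_integral_cmult) measurable
  also have "(\<integral>\<^sup>+t. e t * ennreal (t powr (\<alpha> - 1)) * indicator {0<..} t \<partial>lborel) =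
      (\<integral>\<^sup>+ t \<in> {0<..}. emeasure \<sigma> (T t ` B \<inter> sphere) * ennreal (t powr (\<alpha> - 1)) \<partial>lborel)"
    by (intro nn_integral_cong) (auto simp: e_def indicator_def T_image_Int_sphere)
  finally show ?thesis .
qed

lemma direction_tail_sets:
  assumes "A \<in> sets \<sigma>" "0 \<le> u"
  shows "{x. u < \<tau> x \<and> direction x \<in> A} \<in> sets borel"
proof -
  have [measurable]: "(\<lambda>x. indicat_real A (direction x) * indicator {u<..} (\<tau> x)) \<in> borel_measurable borel"
    using assms by (intro borel_measurable_direction_tail[OF sets_\<sigma>]) auto
  have "{x \<in> space borel. indicat_real A (direction x) * indicator {u<..} (\<tau> x) \<noteq> 0} \<in> sets borel"
    by measurable
  also have "{x \<in> space borel. indicat_real A (direction x) * indicator {u<..} (\<tau> x) \<noteq> 0} = {x. u < \<tau> x \<and> direction x \<in> A}"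
    by (auto simp: indicator_def)
  finally show ?thesis .
qed

text \<open>
  At inverse radius \<open>t\<close>, the slice of \<open>{x. u < \<tau> x \<and> direction x \<in> A}\<close> is \<open>A\<close> if \<open>u < 1 / t\<close> and empty otherwise.
\<close>

lemma emeasure_homogeneous_polar:
  assumes \<alpha>: "0 < \<alpha>" and A: "A \<in> sets \<sigma>" and u: "0 < u"
  shows "emeasure (homogeneous \<alpha>) {x. u < \<tau> x \<and> direction x \<in> A} = emeasure \<sigma> A * ennreal (u powr (- \<alpha>))"
proof -
  have AS: "A \<subseteq> sphere" using sets.sets_into_space[OF A] by (simp add: space_\<sigma>)
  let ?R = "{t. 0 < t \<and> u < inverse t}"
  have slice: "slice {x. u < \<tau> x \<and> direction x \<in> A} t = (if t \<in> ?R then A else {})"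
    if t: "0 < t" for t
  proof -
    have "\<tau> (polar_map (s, t)) = inverse t" "direction (polar_map (s, t)) = s" if "s \<in> sphere" for s
      using that t by (auto simp: polar_map_def tau_T direction_T direction_sphere mem_sphere)
    then show ?thesis using AS t by auto
  qed
  have R: "?R \<in> sets borel" by measurable
  have "AE t in radial_measure \<alpha>. 0 < t"
    using emeasure_radial_measure_nonpos[of \<alpha>] by (intro AE_I[where N="{..0}"]) auto
  then have "(\<integral>\<^sup>+t. emeasure \<sigma> (slice {x. u < \<tau> x \<and> direction x \<in> A} t) \<partial>radial_measure \<alpha>)
      = (\<integral>\<^sup>+t. emeasure \<sigma> A * indicator ?R t \<partial>radial_measure \<alpha>)"
    by (intro nn_integral_cong_AE, eventually_elim) (simp add: slice del: mem_Collect_eq)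
  also have "\<dots> = emeasure \<sigma> A * ennreal (u powr (- \<alpha>))"
    using R by (subst nn_integral_cmult_indicator) (simp_all add: emeasure_radial_measure[OF \<alpha> u])
  finally show ?thesis
    using u by (subst emeasure_homogeneous) (auto intro: direction_tail_sets A)
qed

lemma emeasure_homogeneous_tail:
  assumes "0 < \<alpha>" "0 < u"
  shows "emeasure (homogeneous \<alpha>) {x. u < \<tau> x} = ennreal (measure \<sigma> sphere * u powr (- \<alpha>))"
proof -
  have "{x. u < \<tau> x} = {x. u < \<tau> x \<and> direction x \<in> sphere}"
    using assms direction_in_sphere by auto
  then show ?thesis
    using emeasure_homogeneous_polar[OF assms(1) _ assms(2), of sphere] sets.top[of \<sigma>]
    by (simp add: space_\<sigma> \<sigma>.emeasure_eq_measure ennreal_mult)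
qed

lemma emeasure_homogeneous_tau_0:
  assumes B: "B \<in> sets borel" "B \<inter> {x. 0 < \<tau> x} = {}"
  shows "emeasure (homogeneous \<alpha>) B = 0"
proof -
  have "slice B t = {}" for t
  proof -
    have "0 < \<tau> (polar_map (s, t))" if "s \<in> sphere" for s
      using that by (auto simp: polar_map_def tau_T mem_sphere)
    then show ?thesis using B(2) by blast
  qed
  then show ?thesis
    by (simp only: emeasure_homogeneous[OF B(1)] emeasure_empty nn_integral_0_iff) simp
qed

text \<open>
  By the polar formula above, the direction maps the restriction of the homogeneous measure to \<open>{\<tau> > u}\<close> to \<open>u powr (- \<alpha>)\<close> times \<open>\<sigma>\<close>.
\<close>

lemma integral_homogeneous_direction:
  assumes \<alpha>: "0 < \<alpha>" and k[measurable]: "k \<in> borel_measurable \<sigma>" and u: "0 < u"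
  shows "(\<integral>x. k (direction x) * indicator {u<..} (\<tau> x) \<partial>homogeneous \<alpha>) = u powr (- \<alpha>) * (\<integral>s. k s \<partial>\<sigma> :: real)"
proof -
  let ?E = "{x. u < \<tau> x}"
  have E: "?E \<inter> space (homogeneous \<alpha>) \<in> sets (homogeneous \<alpha>)"
    using open_tau_greater[of u] by simp
  have dir: "direction \<in> restrict_space (homogeneous \<alpha>) ?E \<rightarrow>\<^sub>M \<sigma>"
  proof -
    have "direction \<in> restrict_space (restrict_space borel {x. 0 < \<tau> x}) ?E \<rightarrow>\<^sub>M \<sigma>"
      by (intro measurable_restrict_space1 measurable_direction sets_\<sigma>)
    moreover have "sets (restrict_space (restrict_space borel {x. 0 < \<tau> x}) ?E) = sets (restrict_space (homogeneous \<alpha>) ?E)"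
      using u by (subst sets_restrict_restrict_space) (auto intro!: sets_restrict_space_cong arg_cong2[where f=restrict_space] simp: sets_restrict_space Int_def intro!: arg_cong2[where f=image])
    ultimately show ?thesis
      by (simp cong: measurable_cong_sets)
  qed
  have eq: "distr (restrict_space (homogeneous \<alpha>) ?E) \<sigma> direction = density \<sigma> (\<lambda>_. ennreal (u powr (- \<alpha>)))"
  proof (rule measure_eqI)
    fix A assume "A \<in> sets (distr (restrict_space (homogeneous \<alpha>) ?E) \<sigma> direction)"
    then have A: "A \<in> sets \<sigma>" by simp
    have "emeasure (distr (restrict_space (homogeneous \<alpha>) ?E) \<sigma> direction) A
        = emeasure (homogeneous \<alpha>) (direction -` A \<inter> (?E \<inter> space (homogeneous \<alpha>)))"
      using E by (subst emeasure_distr[OF dir A], subst emeasure_restrict_space) (auto simp: space_restrict_space Int_commute)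
    also have "direction -` A \<inter> (?E \<inter> space (homogeneous \<alpha>)) = {x. u < \<tau> x \<and> direction x \<in> A}"
      by auto
    finally show "emeasure (distr (restrict_space (homogeneous \<alpha>) ?E) \<sigma> direction) A =
      emeasure (density \<sigma> (\<lambda>_. ennreal (u powr (- \<alpha>)))) A"
      using A by (simp add: emeasure_homogeneous_polar[OF \<alpha> A u] emeasure_density_const mult.commute)
  qed simp
  have "(\<integral>x. k (direction x) * indicator {u<..} (\<tau> x) \<partial>homogeneous \<alpha>)
    = (\<integral>x. k (direction x) \<partial>restrict_space (homogeneous \<alpha>) ?E)"
    by (subst integral_restrict_space[OF E]) (auto intro!: Bochner_Integration.integral_cong simp: indicator_def)
  also have "\<dots> = (\<integral>s. k s \<partial>distr (restrict_space (homogeneous \<alpha>) ?E) \<sigma> direction)"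
    by (rule integral_distr[OF dir k, symmetric])
  also have "\<dots> = u powr (- \<alpha>) * (\<integral>s. k s \<partial>\<sigma>)"
    unfolding eq by (subst integral_density) auto
  finally show ?thesis .
qed

end

section \<open>Approximation by steps on thin shells\<close>

text \<open>
  Over a compact set, a jointly continuous function varies uniformly near each \<open>s\<close>, and infima over the set
  differ by no more than the function does.
\<close>

lemma continuous_on_INF_compact:
  fixes \<phi> :: "'a::topological_space \<Rightarrow> 'b::topological_space \<Rightarrow> real"
  assumes cont: "continuous_on (A \<times> C) (\<lambda>(s, r). \<phi> s r)" and C: "compact C" "C \<noteq> {}"
    and bd: "\<And>s r. s \<in> A \<Longrightarrow> r \<in> C \<Longrightarrow> B \<le> \<phi> s r"
  shows "continuous_on A (\<lambda>s. INF r\<in>C. \<phi> s r)"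
  unfolding continuous_on_def
proof (intro ballI tendstoI)
  fix s0 and e :: real assume s0: "s0 \<in> A" and e: "0 < e"
  obtain X0 where X0: "s0 \<in> X0" "open X0"
    and near: "\<forall>s\<in>X0 \<inter> A. \<forall>r\<in>C. dist (case (s, r) of (s, r) \<Rightarrow> \<phi> s r) (case (s0, r) of (s, r) \<Rightarrow> \<phi> s r) \<le> e / 2"
    using continuous_on_prod_compactE[OF cont C(1) s0, of "e / 2"] e by auto
  have bdd: "bdd_below (\<phi> s ` C)" if "s \<in> A" for s
    using bd[OF that] by (intro bdd_belowI2)
  have "dist (INF r\<in>C. \<phi> s r) (INF r\<in>C. \<phi> s0 r) < e" if s: "s \<in> X0" "s \<in> A" for s
  proof -
    have d: "\<bar>\<phi> s r - \<phi> s0 r\<bar> \<le> e / 2" if "r \<in> C" for r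
      using near s that by (auto simp: dist_real_def)
    have "(INF r\<in>C. \<phi> s0 r) - e / 2 \<le> (INF r\<in>C. \<phi> s r)"
    proof (rule cINF_greatest[OF C(2)])
      fix r assume r: "r \<in> C"
      have "(INF r\<in>C. \<phi> s0 r) \<le> \<phi> s0 r" by (rule cINF_lower[OF bdd[OF s0] r])
      then show "(INF r\<in>C. \<phi> s0 r) - e / 2 \<le> \<phi> s r" using d[OF r] by linarith
    qed
    moreover have "(INF r\<in>C. \<phi> s r) - e / 2 \<le> (INF r\<in>C. \<phi> s0 r)"
    proof (rule cINF_greatest[OF C(2)])
      fix r assume r: "r \<in> C"
      have "(INF r\<in>C. \<phi> s r) \<le> \<phi> s r" by (rule cINF_lower[OF bdd[OF s(2)] r])
      then show "(INF r\<in>C. \<phi> s r) - e / 2 \<le> \<phi> s0 r" using d[OF r] by linarith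
    qed
    ultimately show ?thesis using e by (simp add: dist_real_def abs_less_iff)
  qed
  then show "eventually (\<lambda>s. dist (INF r\<in>C. \<phi> s r) (INF r\<in>C. \<phi> s0 r) < e) (at s0 within A)"
    unfolding eventually_at_topological using X0 by blast
qed

lemma grid_cell_iff:
  assumes "0 < z"
  shows "real j < z \<and> z \<le> real (Suc j) \<longleftrightarrow> j = nat (\<lceil>z\<rceil> - 1)"
proof
  assume "real j < z \<and> z \<le> real (Suc j)"
  then have "\<lceil>z\<rceil> = int (Suc j)" by (intro ceiling_unique) auto
  then show "j = nat (\<lceil>z\<rceil> - 1)" by simp
next
  assume j: "j = nat (\<lceil>z\<rceil> - 1)"
  have "0 < \<lceil>z\<rceil>" using assms by simp
  then have "int j = \<lceil>z\<rceil> - 1" using j by simp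
  then have "real j = real_of_int \<lceil>z\<rceil> - 1"
    by (metis of_int_1 of_int_diff of_int_of_nat_eq)
  then show "real j < z \<and> z \<le> real (Suc j)"
    using ceiling_correct[of z] by auto
qed

context spherical_measure
begin

text \<open>
  The functions for which convergence in polar coordinates gives limits directly; for an indicator function \<open>k\<close> of
  a set of directions, this is the indicator of a truncated cone.
\<close>

definition cone :: "real \<Rightarrow> ('a \<Rightarrow> real) \<Rightarrow> 'a \<Rightarrow> real" where
  "cone u k x = k (direction x) * indicator {u<..} (\<tau> x)"

lemma borel_measurable_cone: "k \<in> borel_measurable \<sigma> \<Longrightarrow> 0 \<le> u \<Longrightarrow> cone u k \<in> borel_measurable borel"
  unfolding cone_def by (rule borel_measurable_direction_tail[OF sets_\<sigma>])

lemma integral_cone: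
  "0 < \<alpha> \<Longrightarrow> k \<in> borel_measurable \<sigma> \<Longrightarrow> 0 < u \<Longrightarrow>
    (\<integral>x. cone u k x \<partial>homogeneous \<alpha>) = u powr (- \<alpha>) * (\<integral>s. k s \<partial>\<sigma>)"
  unfolding cone_def by (rule integral_homogeneous_direction)

lemma cone_scale:
  assumes "0 < t" "0 < u"
  shows "cone u k (T (inverse t) x) = cone (u * t) k x"
proof (cases "0 < \<tau> x")
  case True
  then show ?thesis
    using assms by (simp add: cone_def direction_T tau_T indicator_def field_simps)
next
  case False
  then have "\<tau> x = 0" using tau_nonneg[of x] by simp
  then show ?thesis
    using assms by (simp add: cone_def tau_T indicator_def not_less)
qed

lemma cone_bound:
  assumes "\<And>s. s \<in> sphere \<Longrightarrow> \<bar>k s\<bar> \<le> C" "0 \<le> u"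
  shows "\<bar>cone u k x\<bar> \<le> C * indicator {x. u < \<tau> x} x"
  using assms(1)[OF direction_in_sphere, of x] assms(2) by (auto simp: cone_def indicator_def)

lemma integrable_tail:
  assumes "0 < \<alpha>" "0 < u"
  shows "integrable (homogeneous \<alpha>) (\<lambda>x. C * indicator {x. u < \<tau> x} x :: real)"
  using open_tau_greater[of u] emeasure_homogeneous_tail[OF assms]
  by (intro integrable_mult_right) (simp add: integrable_indicator_iff)

lemma integrable_cone:
  assumes "0 < \<alpha>" "0 < u" and k: "k \<in> borel_measurable \<sigma>" "\<And>s. s \<in> sphere \<Longrightarrow> \<bar>k s\<bar> \<le> C"
  shows "integrable (homogeneous \<alpha>) (cone u k)"
proof (rule Bochner_Integration.integrable_bound[OF integrable_tail[OF assms(1,2), of C]])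
  show "cone u k \<in> borel_measurable (homogeneous \<alpha>)"
    using borel_measurable_cone[OF k(1), of u] assms(2) by (simp cong: measurable_cong_sets)
  have "norm (cone u k x) \<le> norm (C * indicat_real {x. u < \<tau> x} x)" for x
    using cone_bound[of k C u x, OF k(2)] assms(2) by auto
  then show "AE x in homogeneous \<alpha>. norm (cone u k x) \<le> norm (C * indicat_real {x. u < \<tau> x} x)"
    by (intro AE_I2)
qed

text \<open>
  The shells are \<open>{x. \<epsilon> + j / (n + 1) < \<tau> x \<and> \<tau> x \<le> \<epsilon> + (j + 1) / (n + 1)}\<close>. Using \<open>(n + 1)\<^sup>2\<close> of them
  makes them exhaust \<open>{\<epsilon> < \<tau>}\<close> as they become thinner.
\<close>

definition shell_inf :: "real \<Rightarrow> ('a \<Rightarrow> real) \<Rightarrow> nat \<Rightarrow> nat \<Rightarrow> 'a \<Rightarrow> real" where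
  "shell_inf \<epsilon> f n j s = (INF r\<in>{\<epsilon> + real j / Suc n .. \<epsilon> + real (Suc j) / Suc n}. f (T r s))"

definition shell_step :: "real \<Rightarrow> ('a \<Rightarrow> real) \<Rightarrow> nat \<Rightarrow> 'a \<Rightarrow> real" where
  "shell_step \<epsilon> f n x = (\<Sum>j<Suc n * Suc n.
     cone (\<epsilon> + real j / Suc n) (shell_inf \<epsilon> f n j) x - cone (\<epsilon> + real (Suc j) / Suc n) (shell_inf \<epsilon> f n j) x)"

context
  fixes f :: "'a \<Rightarrow> real" and \<epsilon> C :: real
  assumes \<epsilon>: "0 < \<epsilon>" and f_cont: "continuous_on {x. \<epsilon> \<le> \<tau> x} f"
    and f0: "\<And>x. \<epsilon> \<le> \<tau> x \<Longrightarrow> 0 \<le> f x" and fC: "\<And>x. \<epsilon> \<le> \<tau> x \<Longrightarrow> f x \<le> C"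
begin

lemma tau_T_sphere: "s \<in> sphere \<Longrightarrow> \<epsilon> \<le> r \<Longrightarrow> \<epsilon> \<le> \<tau> (T r s)"
  using \<epsilon> by (simp add: tau_T mem_sphere)

lemma grid_ge: "\<epsilon> \<le> \<epsilon> + real j / Suc n"
  by simp

lemma continuous_on_shell_inf: "continuous_on sphere (shell_inf \<epsilon> f n j)"
proof -
  let ?I = "{\<epsilon> + real j / Suc n .. \<epsilon> + real (Suc j) / Suc n}"
  have ge: "\<epsilon> \<le> r" if "r \<in> ?I" for r
    using order_trans[OF grid_ge, of j n r] that by simp
  have "continuous_on (sphere \<times> ?I) (\<lambda>x. T (snd x) (fst x))"
    using ge \<epsilon> by (intro continuous_on_T continuous_on_fst continuous_on_snd continuous_on_id) force
  moreover have "(\<lambda>x. T (snd x) (fst x)) ` (sphere \<times> ?I) \<subseteq> {x. \<epsilon> \<le> \<tau> x}"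
    using ge tau_T_sphere by fastforce
  ultimately have "continuous_on (sphere \<times> ?I) (\<lambda>x. f (T (snd x) (fst x)))"
    by (rule continuous_on_compose2[OF f_cont])
  then have "continuous_on (sphere \<times> ?I) (\<lambda>(s, r). f (T r s))"
    by (simp add: case_prod_unfold)
  moreover have "?I \<noteq> {}"
    by (simp add: divide_right_mono)
  ultimately show ?thesis
    unfolding shell_inf_def
    by (intro continuous_on_INF_compact[where B=0] f0 tau_T_sphere ge) auto
qed

lemma shell_inf_bounds:
  assumes s: "s \<in> sphere" and r: "\<epsilon> + real j / Suc n \<le> r" "r \<le> \<epsilon> + real (Suc j) / Suc n"
  shows "0 \<le> shell_inf \<epsilon> f n j s" "shell_inf \<epsilon> f n j s \<le> f (T r s)"
proof -
  let ?I = "{\<epsilon> + real j / Suc n .. \<epsilon> + real (Suc j) / Suc n}"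
  have r: "r \<in> ?I" using r by simp
  have pos: "0 \<le> f (T q s)" if "q \<in> ?I" for q
    using that s order_trans[OF grid_ge, of j n q] by (intro f0 tau_T_sphere) auto
  show "0 \<le> shell_inf \<epsilon> f n j s"
    unfolding shell_inf_def using r pos by (intro cINF_greatest) auto
  show "shell_inf \<epsilon> f n j s \<le> f (T r s)"
    unfolding shell_inf_def using pos r by (intro cINF_lower bdd_belowI2[where m=0])
qed

lemma shell_inf_abs_le: "s \<in> sphere \<Longrightarrow> \<bar>shell_inf \<epsilon> f n j s\<bar> \<le> C"
proof -
  assume s: "s \<in> sphere"
  have "\<epsilon> + real j / Suc n \<le> \<epsilon> + real (Suc j) / Suc n"
    by (simp add: divide_right_mono)
  from shell_inf_bounds[OF s order_refl this] fC[OF tau_T_sphere[OF s grid_ge]] show ?thesis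
    by (smt (verit))
qed

lemma borel_measurable_shell_inf: "shell_inf \<epsilon> f n j \<in> borel_measurable \<sigma>"
  by (rule borel_measurable_continuous_on_sets[OF continuous_on_shell_inf sets_\<sigma>])

lemma shell_step_outside: "\<tau> x \<le> \<epsilon> \<Longrightarrow> shell_step \<epsilon> f n x = 0"
proof -
  assume x: "\<tau> x \<le> \<epsilon>"
  have "cone (\<epsilon> + real j / Suc n) k x = 0" for j k
    using order_trans[OF x grid_ge, of j n] by (simp add: cone_def not_less del: of_nat_Suc)
  then show ?thesis
    unfolding shell_step_def by (simp only: diff_self sum.neutral_const)
qed

text \<open>
  A point with \<open>\<epsilon> < \<tau> x\<close> lies in exactly one of the infinitely many shells, the one with number \<open>i\<close>, and only
  the cones bounding that shell contribute to the sum.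
\<close>

lemma shell_step_inside:
  fixes n :: nat
  assumes x: "\<epsilon> < \<tau> x"
  defines "i \<equiv> nat (\<lceil>(\<tau> x - \<epsilon>) * Suc n\<rceil> - 1)"
  shows "\<epsilon> + real i / Suc n < \<tau> x" "\<tau> x \<le> \<epsilon> + real (Suc i) / Suc n"
    and "shell_step \<epsilon> f n x = (if i < Suc n * Suc n then shell_inf \<epsilon> f n i (direction x) else 0)"
proof -
  have lt: "\<epsilon> + real j / Suc n < \<tau> x \<longleftrightarrow> real j < (\<tau> x - \<epsilon>) * Suc n" for j
    using pos_divide_less_eq[of "real (Suc n)" "real j" "\<tau> x - \<epsilon>"] by (auto simp: algebra_simps)
  have z: "0 < (\<tau> x - \<epsilon>) * Suc n" using x by simp
  have cell: "\<epsilon> + real j / Suc n < \<tau> x \<and> \<tau> x \<le> \<epsilon> + real (Suc j) / Suc n \<longleftrightarrow> j = i" for j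
    unfolding i_def grid_cell_iff[OF z, symmetric] lt by (auto simp: lt[of "Suc j"] simp flip: not_less simp del: of_nat_Suc)
  then show "\<epsilon> + real i / Suc n < \<tau> x" "\<tau> x \<le> \<epsilon> + real (Suc i) / Suc n"
    by blast+
  have mono: "\<epsilon> + real j / Suc n \<le> \<epsilon> + real (Suc j) / Suc n" for j
    by (simp add: divide_right_mono)
  have "cone (\<epsilon> + real j / Suc n) k x - cone (\<epsilon> + real (Suc j) / Suc n) k x =
      (if i = j then k (direction x) else 0)" for j k
    using cell[of j] mono[of j] unfolding cone_def by (auto simp: indicator_def simp del: of_nat_Suc)
  then have "shell_step \<epsilon> f n x = (\<Sum>j<Suc n * Suc n. if i = j then shell_inf \<epsilon> f n j (direction x) else 0)"
    unfolding shell_step_def by (intro sum.cong) auto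
  also have "\<dots> = (if i \<in> {..<Suc n * Suc n} then shell_inf \<epsilon> f n i (direction x) else 0)"
    by (rule sum.delta') simp
  finally show "shell_step \<epsilon> f n x = (if i < Suc n * Suc n then shell_inf \<epsilon> f n i (direction x) else 0)"
    by simp
qed

lemma shell_step_bounds:
  "0 \<le> shell_step \<epsilon> f n x" "shell_step \<epsilon> f n x \<le> f x * indicator {x. \<epsilon> < \<tau> x} x"
proof -
  have "0 \<le> shell_step \<epsilon> f n x \<and> shell_step \<epsilon> f n x \<le> f x * indicator {x. \<epsilon> < \<tau> x} x"
  proof (cases "\<epsilon> < \<tau> x")
    case True
    then have "0 < \<tau> x" using \<epsilon> by simp
    note inside = shell_step_inside[OF True, of n]
    show ?thesis
      using shell_inf_bounds[OF direction_in_sphere[OF \<open>0 < \<tau> x\<close>] less_imp_le[OF inside(1)] inside(2)]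
        inside(3) T_direction[OF \<open>0 < \<tau> x\<close>] f0[of x] True by simp
  qed (simp add: shell_step_outside)
  then show "0 \<le> shell_step \<epsilon> f n x" "shell_step \<epsilon> f n x \<le> f x * indicator {x. \<epsilon> < \<tau> x} x"
    by auto
qed

text \<open>
  Once the shells are thinner than the radius of continuity of \<open>r \<mapsto> f (T r (direction x))\<close> at \<open>\<tau> x\<close>, the infimum
  over the shell that contains \<open>x\<close> is close to \<open>f x\<close>.
\<close>

lemma shell_step_tendsto: "(\<lambda>n. shell_step \<epsilon> f n x) \<longlonglongrightarrow> f x * indicator {x. \<epsilon> < \<tau> x} x"
proof (cases "\<epsilon> < \<tau> x")
  case True
  then have pos: "0 < \<tau> x" using \<epsilon> by simp
  note s = direction_in_sphere[OF pos]
  have cont: "continuous_on {\<epsilon>..} (\<lambda>r. f (T r (direction x)))"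
  proof (rule continuous_on_compose2[OF f_cont])
    show "continuous_on {\<epsilon>..} (\<lambda>r. T r (direction x))"
      using \<epsilon> by (intro continuous_on_T continuous_on_const continuous_on_id) auto
  qed (use tau_T_sphere[OF s] in auto)
  show ?thesis
  proof (rule tendstoI)
    fix e :: real assume "0 < e"
    then have "0 < e / 2" by simp
    then obtain \<delta> where \<delta>: "0 < \<delta>"
      and near: "\<And>r. \<epsilon> \<le> r \<Longrightarrow> \<bar>r - \<tau> x\<bar> < \<delta> \<Longrightarrow> \<bar>f (T r (direction x)) - f x\<bar> < e / 2"
      using cont[unfolded continuous_on_iff, rule_format, of "\<tau> x" "e / 2"] True T_direction[OF pos]
      by (auto simp: dist_real_def)
    have "eventually (\<lambda>n. 1 / Suc n < \<delta>) sequentially"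
      using order_tendstoD(2)[OF LIMSEQ_Suc[OF lim_1_over_n] \<delta>] .
    moreover have "eventually (\<lambda>n. \<tau> x - \<epsilon> \<le> real n) sequentially"
      using filterlim_real_sequentially unfolding filterlim_at_top by blast
    ultimately show "eventually (\<lambda>n. dist (shell_step \<epsilon> f n x) (f x * indicator {x. \<epsilon> < \<tau> x} x) < e) sequentially"
    proof eventually_elim
      case (elim n)
      define i where "i = nat (\<lceil>(\<tau> x - \<epsilon>) * Suc n\<rceil> - 1)"
      note inside = shell_step_inside[OF True, of n, folded i_def]
      have "real i / Suc n < Suc n"
        using inside(1) elim(2) by simp
      then have "real i < real (Suc n) * real (Suc n)"
        by (simp add: pos_divide_less_eq del: of_nat_Suc)
      then have "i < Suc n * Suc n"
        by (simp only: of_nat_mult[symmetric] of_nat_less_iff)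
      then have eq: "shell_step \<epsilon> f n x = shell_inf \<epsilon> f n i (direction x)"
        using inside(3) by simp
      have "f x - e / 2 \<le> shell_inf \<epsilon> f n i (direction x)"
        unfolding shell_inf_def
      proof (rule cINF_greatest)
        fix r assume r: "r \<in> {\<epsilon> + real i / Suc n .. \<epsilon> + real (Suc i) / Suc n}"
        have "real (Suc i) / Suc n = real i / Suc n + 1 / Suc n"
          by (simp add: add_divide_distrib)
        then have "\<bar>r - \<tau> x\<bar> < \<delta>"
          using r inside(1,2) elim(1) by (auto simp: abs_less_iff simp del: of_nat_Suc)
        moreover have "\<epsilon> \<le> r" using order_trans[OF grid_ge, of i n r] r by simp
        ultimately show "f x - e / 2 \<le> f (T r (direction x))"
          using near[of r] by linarith
      qed (simp add: divide_right_mono)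
      moreover have "shell_step \<epsilon> f n x \<le> f x"
        using shell_step_bounds(2)[of n x] True by simp
      ultimately show ?case
        using True eq \<open>0 < e\<close> by (simp add: dist_real_def)
    qed
  qed
qed (simp add: shell_step_outside)

lemma borel_measurable_outside: "(\<lambda>x. f x * indicator {x. \<epsilon> < \<tau> x} x) \<in> borel_measurable borel"
proof -
  have "(\<lambda>x. indicator {x. \<epsilon> < \<tau> x} x *\<^sub>R f x) \<in> borel_measurable borel"
  proof (rule borel_measurable_continuous_on_indicator)
    show "continuous_on {x. \<epsilon> < \<tau> x} f"
      by (rule continuous_on_subset[OF f_cont]) auto
  qed (use open_tau_greater[of \<epsilon>] in simp)
  then show ?thesis by (simp add: mult.commute)
qed

lemma borel_measurable_shell_step: "shell_step \<epsilon> f n \<in> borel_measurable borel"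
  unfolding shell_step_def using \<epsilon>
  by (intro borel_measurable_sum borel_measurable_diff borel_measurable_cone borel_measurable_shell_inf) auto

lemma integral_shell_step_tendsto:
  assumes "0 < \<alpha>"
  shows "(\<lambda>n. \<integral>x. shell_step \<epsilon> f n x \<partial>homogeneous \<alpha>) \<longlonglongrightarrow>
    (\<integral>x. f x * indicator {x. \<epsilon> < \<tau> x} x \<partial>homogeneous \<alpha>)"
proof (rule integral_dominated_convergence[OF _ _ integrable_tail[OF assms \<epsilon>, of C]])
  show "AE x in homogeneous \<alpha>. norm (shell_step \<epsilon> f n x) \<le> C * indicator {x. \<epsilon> < \<tau> x} x" for n
  proof (rule AE_I2)
    fix x
    have "f x * indicator {x. \<epsilon> < \<tau> x} x \<le> C * indicator {x. \<epsilon> < \<tau> x} x"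
      using fC[of x] by (auto simp: indicator_def)
    then show "norm (shell_step \<epsilon> f n x) \<le> C * indicator {x. \<epsilon> < \<tau> x} x"
      using shell_step_bounds[of n x] by simp
  qed
qed (use borel_measurable_shell_step borel_measurable_outside shell_step_tendsto in
      \<open>auto cong: measurable_cong_sets\<close>)

text \<open>
  The step functions are finite combinations of cone functions, so the expectations converge for each of them.
  They lie below \<open>f\<close> on \<open>{\<epsilon> < \<tau>}\<close>, and by dominated convergence one of them has an integral that exceeds \<open>l\<close>.
\<close>

lemma vague_lower_bound:
  fixes \<xi> :: "'w \<Rightarrow> 'a" and g :: "real \<Rightarrow> real"
  assumes M: "prob_space M" and \<xi>[measurable]: "\<xi> \<in> borel_measurable M"
    and \<alpha>: "0 < \<alpha>" and g: "\<And>t. 0 < t \<Longrightarrow> 0 \<le> g t"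
    and T_meas: "\<And>t. 0 < t \<Longrightarrow> T (inverse t) \<in> borel_measurable borel"
    and conv: "\<And>u k. 0 < u \<Longrightarrow> continuous_on sphere k \<Longrightarrow> bounded (k ` sphere) \<Longrightarrow>
      ((\<lambda>t. g t * (\<integral>\<omega>. cone u k (T (inverse t) (\<xi> \<omega>)) \<partial>M)) \<longlongrightarrow> (\<integral>x. cone u k x \<partial>homogeneous \<alpha>)) at_top"
    and l: "l < (\<integral>x. f x * indicator {x. \<epsilon> < \<tau> x} x \<partial>homogeneous \<alpha>)"
  shows "eventually (\<lambda>t. l < g t * (\<integral>\<omega>. f (T (inverse t) (\<xi> \<omega>)) * indicator {x. \<epsilon> < \<tau> x} (T (inverse t) (\<xi> \<omega>)) \<partial>M)) at_top"
proof -
  interpret prob_space M by fact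
  obtain n where n: "l < (\<integral>x. shell_step \<epsilon> f n x \<partial>homogeneous \<alpha>)"
    using eventually_happens'[OF sequentially_bot order_tendstoD(1)[OF integral_shell_step_tendsto[OF \<alpha>] l]] by blast
  define k where "k = shell_inf \<epsilon> f n"
  define r where "r j = \<epsilon> + real j / Suc n" for j
  have r: "0 < r j" for j unfolding r_def using \<epsilon> by (simp add: add_pos_nonneg)
  have k: "continuous_on sphere (k j)" "bounded (k j ` sphere)" "k j \<in> borel_measurable \<sigma>"
    "\<And>s. s \<in> sphere \<Longrightarrow> \<bar>k j s\<bar> \<le> C" for j
    unfolding k_def using continuous_on_shell_inf borel_measurable_shell_inf shell_inf_abs_le
    by (auto intro!: boundedI[where B=C])
  have step: "shell_step \<epsilon> f n x = (\<Sum>j<Suc n * Suc n. cone (r j) (k j) x - cone (r (Suc j)) (k j) x)" for x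
    by (simp add: shell_step_def k_def r_def)
  have \<xi>T[measurable]: "(\<lambda>\<omega>. T (inverse t) (\<xi> \<omega>)) \<in> borel_measurable M" if "0 < t" for t
    by (rule measurable_compose[OF \<xi> T_meas[OF that]])
  have int_M: "integrable M (\<lambda>\<omega>. h (T (inverse t) (\<xi> \<omega>)))"
    if "h \<in> borel_measurable borel" "\<And>x. \<bar>h x\<bar> \<le> C * indicator {x. \<delta> < \<tau> x} x" "0 < t" for h :: "'a \<Rightarrow> real" and \<delta> t
  proof (rule integrable_const_bound[where B="\<bar>C\<bar>"])
    show "AE \<omega> in M. norm (h (T (inverse t) (\<xi> \<omega>))) \<le> \<bar>C\<bar>"
    proof (rule AE_I2)
      fix \<omega>
      show "norm (h (T (inverse t) (\<xi> \<omega>))) \<le> \<bar>C\<bar>"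
        using that(2)[of "T (inverse t) (\<xi> \<omega>)"]
        by (cases "\<delta> < \<tau> (T (inverse t) (\<xi> \<omega>))") auto
    qed
  qed (rule measurable_compose[OF \<xi>T[OF that(3)] that(1)])
  have int_cone_M: "integrable M (\<lambda>\<omega>. cone (r i) (k j) (T (inverse t) (\<xi> \<omega>)))" if "0 < t" for i j t
    by (rule int_M[OF borel_measurable_cone[OF k(3)] cone_bound[OF k(4)] that]) (auto intro: less_imp_le r)
  let ?e = "\<lambda>i j t. \<integral>\<omega>. cone (r i) (k j) (T (inverse t) (\<xi> \<omega>)) \<partial>M"
  let ?h = "\<lambda>i j. \<integral>x. cone (r i) (k j) x \<partial>homogeneous \<alpha>"
  have "((\<lambda>t. \<Sum>j<Suc n * Suc n. g t * ?e j j t - g t * ?e (Suc j) j t) \<longlongrightarrow>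
      (\<Sum>j<Suc n * Suc n. ?h j j - ?h (Suc j) j)) at_top"
    by (intro tendsto_sum tendsto_diff conv r k)
  also have "(\<Sum>j<Suc n * Suc n. ?h j j - ?h (Suc j) j) = (\<integral>x. shell_step \<epsilon> f n x \<partial>homogeneous \<alpha>)"
    unfolding step
    by (subst Bochner_Integration.integral_sum)
       (auto intro!: sum.cong Bochner_Integration.integrable_diff integrable_cone[OF \<alpha> r k(3,4)]
         Bochner_Integration.integral_diff[symmetric] simp del: sum.lessThan_Suc)
  finally have lim: "((\<lambda>t. \<Sum>j<Suc n * Suc n. g t * ?e j j t - g t * ?e (Suc j) j t) \<longlongrightarrow>
      (\<integral>x. shell_step \<epsilon> f n x \<partial>homogeneous \<alpha>)) at_top" .
  from order_tendstoD(1)[OF lim n] eventually_gt_at_top[of 0] show ?thesis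
  proof eventually_elim
    case (elim t)
    have "(\<Sum>j<Suc n * Suc n. g t * ?e j j t - g t * ?e (Suc j) j t) =
        g t * (\<Sum>j<Suc n * Suc n. ?e j j t - ?e (Suc j) j t)"
      by (simp only: sum_distrib_left right_diff_distrib)
    also have "(\<Sum>j<Suc n * Suc n. ?e j j t - ?e (Suc j) j t) = (\<integral>\<omega>. shell_step \<epsilon> f n (T (inverse t) (\<xi> \<omega>)) \<partial>M)"
      unfolding step
      by (subst Bochner_Integration.integral_sum)
         (auto intro!: sum.cong Bochner_Integration.integrable_diff int_cone_M elim
           Bochner_Integration.integral_diff[symmetric] simp del: sum.lessThan_Suc)
    also have "g t * \<dots> \<le> g t * (\<integral>\<omega>. f (T (inverse t) (\<xi> \<omega>)) * indicator {x. \<epsilon> < \<tau> x} (T (inverse t) (\<xi> \<omega>)) \<partial>M)"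
    proof (intro mult_left_mono integral_mono g elim shell_step_bounds)
      have b: "\<bar>f x * indicator {x. \<epsilon> < \<tau> x} x\<bar> \<le> C * indicator {x. \<epsilon> < \<tau> x} x" for x
        using f0[of x] fC[of x] by (auto simp: indicator_def)
      show "integrable M (\<lambda>\<omega>. f (T (inverse t) (\<xi> \<omega>)) * indicator {x. \<epsilon> < \<tau> x} (T (inverse t) (\<xi> \<omega>)))"
        by (rule int_M[OF borel_measurable_outside b elim(2)])
      have "\<bar>shell_step \<epsilon> f n x\<bar> \<le> C * indicator {x. \<epsilon> < \<tau> x} x" for x
        using shell_step_bounds[of n x] b[of x] by linarith
      then show "integrable M (\<lambda>\<omega>. shell_step \<epsilon> f n (T (inverse t) (\<xi> \<omega>)))"
        by (rule int_M[OF borel_measurable_shell_step _ elim(2)])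
    qed
    finally show ?case using elim(1) by linarith
  qed
qed

end

end

section \<open>Tau-additivity\<close>

lemma sets_restrict_borel_UNIV: "sets (restrict_space borel UNIV) = sets borel"
  by (simp add: sets_restrict_space)

context spherical_measure
begin

lemma continuous_on_polar_map_sphere: "continuous_on A (\<lambda>s. polar_map (s, t))"
  unfolding polar_map_def prod.case
  by (intro continuous_on_T continuous_on_id continuous_on_const) auto

lemma functionally_open_slice:
  assumes "open G"
  shows "functionally_open_in sphere (slice G t)"
proof (rule functionally_open_sphere)
  have "openin (top_of_set sphere) (sphere \<inter> (\<lambda>s. polar_map (s, t)) -` G)"
    by (rule continuous_openin_preimage_gen[OF continuous_on_polar_map_sphere assms])
  then show "openin (top_of_set sphere) (slice G t)"
    by (simp add: vimage_def Int_def)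
qed

text \<open>
  For a fixed \<open>t\<close>, the slices of a directed family of open sets form a directed family of functionally open
  subsets of the sphere.
\<close>

lemma emeasure_slice_union:
  assumes tau: "tau_additive_on sphere \<sigma>" and ne: "\<G> \<noteq> {}" and op: "\<And>G. G \<in> \<G> \<Longrightarrow> open G"
    and dir: "\<And>G H. G \<in> \<G> \<Longrightarrow> H \<in> \<G> \<Longrightarrow> \<exists>K\<in>\<G>. G \<subseteq> K \<and> H \<subseteq> K"
  shows "emeasure \<sigma> (slice (\<Union>\<G>) t) =
    (SUP G\<in>\<G>. emeasure \<sigma> (slice G t))"
proof -
  define sl where "sl G = slice G t" for G
  have un: "\<Union>(sl ` \<G>) = sl (\<Union>\<G>)"
    by (auto simp: sl_def)
  have "(SUP H\<in>sl ` \<G>. emeasure \<sigma> H) = emeasure \<sigma> (\<Union>(sl ` \<G>))"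
  proof (rule tau[unfolded tau_additive_on_iff_SUP[OF sets_\<sigma>], rule_format], intro conjI ballI)
    show "sl ` \<G> \<noteq> {}" using ne by simp
    show "functionally_open_in sphere H" if "H \<in> sl ` \<G>" for H
      using that op unfolding sl_def by (auto intro: functionally_open_slice)
    show "\<exists>K\<in>sl ` \<G>. G \<subseteq> K \<and> H \<subseteq> K" if GH: "G \<in> sl ` \<G>" "H \<in> sl ` \<G>" for G H
    proof -
      obtain G' H' where GH': "G' \<in> \<G>" "H' \<in> \<G>" "G = sl G'" "H = sl H'" using GH by blast
      then obtain K where "K \<in> \<G>" "G' \<subseteq> K" "H' \<subseteq> K" using dir by blast
      then show ?thesis
        using GH' by (intro bexI[of _ "sl K"]) (auto simp: sl_def)
    qed
    show "functionally_open_in sphere (\<Union>(sl ` \<G>))"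
      unfolding un unfolding sl_def using op by (intro functionally_open_slice open_Union) blast
  qed
  then show ?thesis
    unfolding un unfolding image_image sl_def by (rule sym)
qed

text \<open>
  The measure of the slice of an open set is lower semicontinuous in \<open>t\<close>: if \<open>r n \<longlonglongrightarrow> t\<close>, a point of the slice
  at \<open>t\<close> belongs to the slices at all late \<open>r n\<close>, hence to some \<open>E N\<close>, and the \<open>E N\<close> increase.
\<close>

lemma open_slice_superlevel:
  assumes G: "open G"
  shows "open {t. 0 < t \<and> q < emeasure \<sigma> (slice G t)}" (is "open ?V")
  unfolding open_contains_ball
proof (rule ccontr)
  have G_borel: "G \<in> sets borel" using G by simp
  assume "\<not> (\<forall>t\<in>?V. \<exists>e>0. ball t e \<subseteq> ?V)"
  then obtain t where t: "t \<in> ?V" and bad: "\<And>e. 0 < e \<Longrightarrow> \<not> ball t e \<subseteq> ?V" by blast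
  have t0: "0 < t" using t by simp
  have "\<exists>r. r \<in> ball t (1 / Suc n) \<and> r \<notin> ?V" for n
    using bad[of "1 / Suc n"] by auto
  then have "\<exists>r. \<forall>n. r n \<in> ball t (1 / Suc n) \<and> r n \<notin> ?V"
    by (intro choice allI)
  then obtain r where r: "\<And>n. r n \<in> ball t (1 / Suc n)" "\<And>n. r n \<notin> ?V" by blast
  have r_lim: "r \<longlonglongrightarrow> t"
  proof (rule tendstoI)
    fix e :: real assume "0 < e"
    then have "eventually (\<lambda>n. 1 / Suc n < e) sequentially"
      by (rule order_tendstoD(2)[OF LIMSEQ_Suc[OF lim_1_over_n]])
    then show "eventually (\<lambda>n. dist (r n) t < e) sequentially"
    proof eventually_elim
      case (elim n)
      then show ?case using r(1)[of n] by (simp add: dist_commute del: of_nat_Suc)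
    qed
  qed
  then obtain N0 where N0: "\<And>n. N0 \<le> n \<Longrightarrow> 0 < r n"
    using order_tendstoD(1)[OF r_lim t0] unfolding eventually_sequentially by blast
  let ?sl = "\<lambda>t. slice G t"
  define E where "E N = (\<Inter>n. ?sl (r (N + n)))" for N
  have E_sets: "E N \<in> sets \<sigma>" for N
    unfolding E_def using slice_sets[OF G_borel] by (intro sets.countable_INT) auto
  have E_le: "emeasure \<sigma> (E N) \<le> q" for N
  proof -
    have "E N \<subseteq> ?sl (r (N + (max N N0 - N)))" unfolding E_def by blast
    then have "E N \<subseteq> ?sl (r (max N N0))" by simp
    then have "emeasure \<sigma> (E N) \<le> emeasure \<sigma> (?sl (r (max N N0)))"
      by (intro emeasure_mono slice_sets[OF G_borel])
    also have "\<dots> \<le> q"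
      using r(2)[of "max N N0"] N0[of "max N N0"] by (simp add: not_less)
    finally show ?thesis .
  qed
  have "?sl t \<subseteq> (\<Union>N. E N)"
  proof
    fix s assume s: "s \<in> ?sl t"
    have "continuous_on {0<..} (\<lambda>t. T (inverse t) s)"
      by (intro continuous_on_T continuous_on_const continuous_on_inverse continuous_on_id) auto
    then have "isCont (\<lambda>t. T (inverse t) s) t"
      using t0 by (simp add: continuous_on_eq_continuous_at)
    then have "(\<lambda>n. T (inverse (r n)) s) \<longlonglongrightarrow> T (inverse t) s"
      by (rule isCont_tendsto_compose[OF _ r_lim])
    moreover have "T (inverse t) s \<in> G" using s t0 by (simp add: polar_map_def)
    ultimately have "eventually (\<lambda>n. T (inverse (r n)) s \<in> G) sequentially"
      by (rule topological_tendstoD[OF _ G])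
    then obtain N where N: "\<And>n. N \<le> n \<Longrightarrow> T (inverse (r n)) s \<in> G"
      unfolding eventually_sequentially by blast
    have "s \<in> ?sl (r (max N N0 + n))" for n
      using s N[of "max N N0 + n"] N0[of "max N N0 + n"] by (simp add: polar_map_def)
    then have "s \<in> E (max N N0)"
      unfolding E_def by blast
    then show "s \<in> (\<Union>N. E N)" by blast
  qed
  then have "emeasure \<sigma> (?sl t) \<le> emeasure \<sigma> (\<Union>N. E N)"
    using E_sets by (intro emeasure_mono) auto
  also have "\<dots> = (SUP N. emeasure \<sigma> (E N))"
  proof (rule SUP_emeasure_incseq[symmetric])
    show "incseq E"
    proof (intro incseq_SucI subsetI)
      fix N s assume s: "s \<in> E N"
      have "s \<in> ?sl (r (N + Suc n))" for n
        using s unfolding E_def by blast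
      then have "s \<in> ?sl (r (Suc N + n))" for n
        by simp
      then show "s \<in> E (Suc N)" unfolding E_def by blast
    qed
  qed (use E_sets in blast)
  also have "\<dots> \<le> q"
    using E_le by (rule SUP_least)
  finally show False using t by (simp add: not_le[symmetric])
qed

text \<open>
  For nets, the supremum over slices cannot simply be exchanged with the integral over \<open>t\<close>. By lower
  semicontinuity the superlevel sets \<open>V q G\<close> are open subsets of the line, so for each rational level countably
  many members of the family cover as much as all of them. A chain in the family that dominates these countably many
  members attains the supremum of the slices at every \<open>t\<close> simultaneously, and continuity from below finishes
  the argument.
\<close>

lemma tau_additive_homogeneous:
  assumes tau: "tau_additive_on sphere \<sigma>"
  shows "tau_additive_on UNIV (homogeneous \<alpha>)"
proof -
  have sets: "sets (homogeneous \<alpha>) = sets (restrict_space borel UNIV)"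
    by (simp add: sets_restrict_borel_UNIV)
  show ?thesis
    unfolding tau_additive_on_iff_SUP[OF sets] functionally_open_UNIV
  proof (intro allI impI, elim conjE)
    fix \<G> :: "'a set set"
    assume ne: "\<G> \<noteq> {}" and op': "\<forall>G\<in>\<G>. open G" and dir': "\<forall>G\<in>\<G>. \<forall>H\<in>\<G>. \<exists>K\<in>\<G>. G \<subseteq> K \<and> H \<subseteq> K"
    have op: "\<And>G. G \<in> \<G> \<Longrightarrow> open G" using op' by blast
    have dir: "\<And>G H. G \<in> \<G> \<Longrightarrow> H \<in> \<G> \<Longrightarrow> \<exists>K\<in>\<G>. G \<subseteq> K \<and> H \<subseteq> K" using dir' by blast
    define \<phi> where "\<phi> G t = emeasure \<sigma> (slice G t)" for G t
    have \<phi>_mono: "\<phi> G t \<le> \<phi> H t" if "G \<subseteq> H" "open H" for G H t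
      unfolding \<phi>_def using that by (intro emeasure_mono slice_sets) auto
    define V where "V q G = {t. 0 < t \<and> ennreal (real_of_rat q) < \<phi> G t}" for q G
    have "\<exists>\<C>\<subseteq>\<G>. countable \<C> \<and> \<Union>(V q ` \<C>) = \<Union>(V q ` \<G>)" for q
    proof -
      obtain F where F: "F \<subseteq> V q ` \<G>" "countable F" "\<Union>F = \<Union>(V q ` \<G>)"
        using Lindelof[of "V q ` \<G>"] open_slice_superlevel op unfolding V_def \<phi>_def by blast
      then show ?thesis
        using countable_subset_image[of F "V q" \<G>] by auto
    qed
    then have "\<exists>\<C>. \<forall>q. \<C> q \<subseteq> \<G> \<and> countable (\<C> q) \<and> \<Union>(V q ` \<C> q) = \<Union>(V q ` \<G>)"
      by (intro choice allI)
    then obtain \<C> where "\<forall>q. \<C> q \<subseteq> \<G> \<and> countable (\<C> q) \<and> \<Union>(V q ` \<C> q) = \<Union>(V q ` \<G>)"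
      by (rule exE)
    then have \<C>: "\<And>q. \<C> q \<subseteq> \<G>" "\<And>q. countable (\<C> q)" "\<And>q. \<Union>(V q ` \<C> q) = \<Union>(V q ` \<G>)"
      by simp_all
    obtain G0 where G0: "G0 \<in> \<G>" using ne by blast
    define \<D> where "\<D> = insert G0 (\<Union>q. \<C> q)"
    have \<D>: "countable \<D>" "\<D> \<subseteq> \<G>" "\<D> \<noteq> {}"
      unfolding \<D>_def using \<C>(1,2) G0 by auto
    define e where "e = from_nat_into \<D>"
    have e: "range e = \<D>" "\<And>n. e n \<in> \<G>"
      unfolding e_def using \<D> range_from_nat_into[OF \<D>(3,1)] from_nat_into[OF \<D>(3)] by auto
    define up where "up G H = (SOME K. K \<in> \<G> \<and> G \<subseteq> K \<and> H \<subseteq> K)" for G H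
    have up: "up G H \<in> \<G> \<and> G \<subseteq> up G H \<and> H \<subseteq> up G H" if "G \<in> \<G>" "H \<in> \<G>" for G H
      unfolding up_def using dir[OF that] by (intro someI_ex[of "\<lambda>K. K \<in> \<G> \<and> G \<subseteq> K \<and> H \<subseteq> K"]) blast
    define K where "K = rec_nat (e 0) (\<lambda>n G. up G (e (Suc n)))"
    have K_Suc: "K (Suc n) = up (K n) (e (Suc n))" for n by (simp add: K_def)
    have K: "K n \<in> \<G>" for n
      by (induction n) (use up e(2) in \<open>auto simp: K_Suc K_def\<close>)
    have eK: "e n \<subseteq> K n" for n
    proof (cases n)
      case (Suc m)
      then show ?thesis using up[OF K e(2)] by (auto simp: K_Suc)
    qed (simp add: K_def)
    have "incseq K"
      using up[OF K e(2)] by (intro incseq_SucI) (auto simp: K_Suc)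
    define L where "L = (\<Union>n. K n)"
    have L_open: "open L" unfolding L_def using K op by blast
    have U_open: "open (\<Union>\<G>)" using op by blast
    have \<phi>_le: "\<phi> (\<Union>\<G>) t \<le> \<phi> L t" if t: "0 < t" for t
    proof (rule ccontr)
      assume "\<not> ?thesis"
      then obtain q where q: "\<phi> L t < ennreal (real_of_rat q)" "ennreal (real_of_rat q) < \<phi> (\<Union>\<G>) t"
        using ennreal_rat_dense[of "\<phi> L t" "\<phi> (\<Union>\<G>) t"] by (auto simp: not_le)
      then have "ennreal (real_of_rat q) < (SUP G\<in>\<G>. \<phi> G t)"
        unfolding \<phi>_def using emeasure_slice_union[OF tau ne op dir, of t] by simp
      then obtain G where "G \<in> \<G>" "ennreal (real_of_rat q) < \<phi> G t"
        unfolding less_SUP_iff by blast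
      then have "t \<in> \<Union>(V q ` \<G>)" using t by (auto simp: V_def)
      then obtain H where H: "H \<in> \<C> q" "t \<in> V q H" unfolding \<C>(3)[symmetric] by blast
      then have "H \<in> range e" unfolding e(1) \<D>_def by blast
      then have "H \<subseteq> L" unfolding L_def using eK by blast
      then have "ennreal (real_of_rat q) < \<phi> L t"
        using H(2) \<phi>_mono[OF _ L_open, of H t] unfolding V_def by auto
      then show False using q(1) by simp
    qed
    have AE_pos: "AE t in radial_measure \<alpha>. 0 < t"
      using emeasure_radial_measure_nonpos[of \<alpha>] by (intro AE_I[where N="{..0}"]) auto
    have "emeasure (homogeneous \<alpha>) (\<Union>\<G>) = (\<integral>\<^sup>+t. \<phi> (\<Union>\<G>) t \<partial>radial_measure \<alpha>)"
      unfolding \<phi>_def using U_open by (intro emeasure_homogeneous) auto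
    also have "\<dots> \<le> (\<integral>\<^sup>+t. \<phi> L t \<partial>radial_measure \<alpha>)"
    proof (rule nn_integral_mono_AE)
      show "AE t in radial_measure \<alpha>. \<phi> (\<Union>\<G>) t \<le> \<phi> L t"
        using AE_pos by eventually_elim (rule \<phi>_le)
    qed
    also have "\<dots> = emeasure (homogeneous \<alpha>) L"
      unfolding \<phi>_def using L_open by (intro emeasure_homogeneous[symmetric]) auto
    also have "\<dots> = (SUP n. emeasure (homogeneous \<alpha>) (K n))"
      unfolding L_def using \<open>incseq K\<close> K op by (intro SUP_emeasure_incseq[symmetric]) auto
    also have "\<dots> \<le> (SUP G\<in>\<G>. emeasure (homogeneous \<alpha>) G)"
      using K by (intro SUP_mono) auto
    finally show "(SUP G\<in>\<G>. emeasure (homogeneous \<alpha>) G) = emeasure (homogeneous \<alpha>) (\<Union>\<G>)"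
      using U_open by (intro antisym SUP_least emeasure_mono) auto
  qed
qed

text \<open>
  A relatively open set \<open>G\<close> of directions corresponds to the open set \<open>p G\<close> above it, outside the
  unit sphere, whose homogeneous measure is that of \<open>G\<close> under \<open>\<sigma>\<close>.
\<close>

lemma tau_additive_sphere:
  assumes tau: "tau_additive_on UNIV (homogeneous \<alpha>)" and \<alpha>: "0 < \<alpha>"
  shows "tau_additive_on sphere \<sigma>"
  unfolding tau_additive_on_iff_SUP[OF sets_\<sigma>]
proof (intro allI impI, elim conjE)
  have sets: "sets (homogeneous \<alpha>) = sets (restrict_space borel UNIV)"
    by (simp add: sets_restrict_borel_UNIV)
  fix \<G> :: "'a set set"
  assume ne: "\<G> \<noteq> {}" and op: "\<forall>G\<in>\<G>. functionally_open_in sphere G"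
    and dir: "\<forall>G\<in>\<G>. \<forall>H\<in>\<G>. \<exists>K\<in>\<G>. G \<subseteq> K \<and> H \<subseteq> K" and opU: "functionally_open_in sphere (\<Union>\<G>)"
  define p where "p G = {x. 1 < \<tau> x \<and> direction x \<in> G}" for G
  have p_open: "open (p G)" if "functionally_open_in sphere G" for G
  proof -
    obtain V where V: "open V" "G = sphere \<inter> V"
      using functionally_open_in_openin[OF \<open>functionally_open_in sphere G\<close>] by (auto simp: openin_open)
    have "continuous_on {x. 1 < \<tau> x} direction"
      by (rule continuous_on_subset[OF continuous_on_direction]) auto
    then have "open ({x. 1 < \<tau> x} \<inter> direction -` V)"
      by (rule continuous_open_preimage[OF _ open_tau_greater V(1)])
    also have "{x. 1 < \<tau> x} \<inter> direction -` V = p G"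
      using V(2) direction_in_sphere by (auto simp: p_def)
    finally show ?thesis .
  qed
  have p_measure: "emeasure (homogeneous \<alpha>) (p G) = emeasure \<sigma> G" if "functionally_open_in sphere G" for G
  proof -
    have "G \<in> sets \<sigma>"
      unfolding sets_\<sigma> by (intro openin_sets_restrict_borel functionally_open_in_openin that)
    then show ?thesis
      unfolding p_def using emeasure_homogeneous_polar[OF \<alpha>, of G 1] by simp
  qed
  have un: "\<Union>(p ` \<G>) = p (\<Union>\<G>)" by (auto simp: p_def)
  have "(SUP H\<in>p ` \<G>. emeasure (homogeneous \<alpha>) H) = emeasure (homogeneous \<alpha>) (\<Union>(p ` \<G>))"
  proof (rule tau[unfolded tau_additive_on_iff_SUP[OF sets] functionally_open_UNIV, rule_format], intro conjI ballI)
    show "p ` \<G> \<noteq> {}" using ne by simp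
    show "open H" if "H \<in> p ` \<G>" for H using that op p_open by blast
    show "open (\<Union>(p ` \<G>))" unfolding un by (rule p_open[OF opU])
    show "\<exists>K\<in>p ` \<G>. G \<subseteq> K \<and> H \<subseteq> K" if GH: "G \<in> p ` \<G>" "H \<in> p ` \<G>" for G H
    proof -
      obtain G' H' where GH': "G' \<in> \<G>" "H' \<in> \<G>" "G = p G'" "H = p H'" using GH by blast
      then obtain K where "K \<in> \<G>" "G' \<subseteq> K" "H' \<subseteq> K" using dir by blast
      then show ?thesis
        using GH' by (intro bexI[of _ "p K"]) (auto simp: p_def)
    qed
  qed
  then show "(SUP G\<in>\<G>. emeasure \<sigma> G) = emeasure \<sigma> (\<Union>\<G>)"
    unfolding un image_image using p_measure op opU by simp
qed

text \<open>
  Sets in the ideal determine the measure, since \<open>{\<tau> > 0}\<close> is the union of the sets \<open>{\<tau> > 1 / (n + 1)}\<close>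
  and both measures vanish on the rest.
\<close>

lemma measure_eq_homogeneous:
  assumes sets: "sets \<mu> = sets borel"
    and eq: "\<And>B. B \<in> sets borel \<Longrightarrow> B \<in> ideal \<Longrightarrow> emeasure \<mu> B = emeasure (homogeneous \<alpha>) B"
    and null: "\<And>B. B \<in> sets borel \<Longrightarrow> B \<inter> {x. 0 < \<tau> x} = {} \<Longrightarrow> emeasure \<mu> B = 0"
  shows "\<mu> = homogeneous \<alpha>"
proof (rule measure_eqI)
  show "sets \<mu> = sets (homogeneous \<alpha>)" using sets by simp
  fix A assume "A \<in> sets \<mu>"
  then have A: "A \<in> sets borel" using sets by simp
  define P where "P = {x. 0 < \<tau> x}"
  define B where "B n = A \<inter> {x. 1 / Suc n < \<tau> x}" for n
  have P: "P \<in> sets borel" unfolding P_def using open_tau_greater[of 0] by simp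
  have B: "B n \<in> sets borel" for n
    unfolding B_def using A open_tau_greater by (intro sets.Int) auto
  have B_ideal: "B n \<in> ideal" for n
    unfolding modulus_ideal_iff B_def by (intro conjI exI[of _ "1 / Suc n"]) auto
  have "incseq B"
  proof (rule incseq_SucI)
    fix n
    have "1 / real (Suc (Suc n)) \<le> 1 / real (Suc n)" by (simp add: field_simps)
    then show "B n \<subseteq> B (Suc n)" by (auto simp: B_def simp del: of_nat_Suc)
  qed
  have "(\<Union>n. B n) = A \<inter> P"
  proof (intro equalityI subsetI)
    fix x assume x: "x \<in> A \<inter> P"
    then obtain n where "inverse (real (Suc n)) < \<tau> x"
      using reals_Archimedean by (auto simp: P_def)
    then show "x \<in> (\<Union>n. B n)"
      using x by (auto simp: B_def inverse_eq_divide)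
  next
    fix x assume "x \<in> (\<Union>n. B n)"
    then obtain n where "x \<in> A" "1 / Suc n < \<tau> x" by (auto simp: B_def)
    moreover have "0 < 1 / real (Suc n)" by simp
    ultimately have "x \<in> A" "0 < \<tau> x" by linarith+
    then show "x \<in> A \<inter> P" by (simp add: P_def)
  qed
  then have part: "emeasure m A = (SUP n. emeasure m (B n))"
    if m: "sets m = sets borel" and "\<And>B. B \<in> sets borel \<Longrightarrow> B \<inter> P = {} \<Longrightarrow> emeasure m B = 0" for m
  proof -
    have "emeasure m A = emeasure m (A \<inter> P) + emeasure m (A - P)"
      using A P m by (subst plus_emeasure) (auto simp: Int_Diff_Un)
    also have "emeasure m (A - P) = 0" using A P by (intro that) auto
    also have "emeasure m (A \<inter> P) = (SUP n. emeasure m (B n))"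
      unfolding \<open>(\<Union>n. B n) = A \<inter> P\<close>[symmetric]
      using B m \<open>incseq B\<close> by (intro SUP_emeasure_incseq[symmetric]) auto
    finally show ?thesis by simp
  qed
  show "emeasure \<mu> A = emeasure (homogeneous \<alpha>) A"
    using part[OF sets] part[of "homogeneous \<alpha>"] null emeasure_homogeneous_tau_0
    by (simp add: P_def eq[OF B B_ideal])
qed

end

context scaled_space
begin

text \<open>
  A test function on the half-line becomes a test function on the space by composition with the modulus, which
  is compatible with the scalings. The limit is the image of \<open>\<mu>\<close> under \<open>\<tau>\<close>.
\<close>

lemma in_RV_modulus:
  assumes rv: "in_RV M \<xi> UNIV T ideal g \<mu>"
  shows "regularly_varying_variable M (\<lambda>\<omega>. \<tau> (\<xi> \<omega>)) g"
proof -
  let ?R = "modulus_ideal {0..} (\<lambda>x::real. x)"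
  have sets: "sets \<mu> = sets borel" using rv by (simp add: in_RV_def sets_restrict_borel_UNIV)
  have space: "space \<mu> = UNIV" using sets_eq_imp_space_eq[OF sets] by simp
  have \<tau>_meas: "\<tau> \<in> \<mu> \<rightarrow>\<^sub>M restrict_space borel {0..}"
  proof (rule measurable_restrict_space2)
    show "\<tau> \<in> borel_measurable \<mu>"
      using borel_measurable_tau measurable_cong_sets[OF sets refl] by blast
  qed (use tau_nonneg in auto)
  define \<mu>' where "\<mu>' = distr \<mu> (restrict_space borel {0..}) \<tau>"
  have sets': "sets \<mu>' = sets (restrict_space borel {0..})" by (simp add: \<mu>'_def)
  have em: "emeasure \<mu>' B = emeasure \<mu> (\<tau> -` B)" "\<tau> -` B \<in> sets \<mu>" if "B \<in> sets \<mu>'" for B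
  proof -
    have B: "B \<in> sets (restrict_space borel {0..})" using that sets' by simp
    show "emeasure \<mu>' B = emeasure \<mu> (\<tau> -` B)"
      unfolding \<mu>'_def using emeasure_distr[OF \<tau>_meas B] by (simp add: space)
    show "\<tau> -` B \<in> sets \<mu>" using measurable_sets[OF \<tau>_meas B] by (simp add: space)
  qed
  have UR: "\<Union>?R = {0<..}"
    by (auto simp: Union_modulus_ideal)
  have "in_RV M (\<lambda>\<omega>. \<tau> (\<xi> \<omega>)) {0..} (\<lambda>t x. t * x) ?R g \<mu>'"
    unfolding in_RV_def
  proof (intro conjI)
    show "g \<in> borel_measurable (restrict_space borel {0..})" "\<forall>t\<ge>0. 0 \<le> g t" "filterlim g at_top at_top"
      using rv by (simp_all add: in_RV_def)
    show "sets \<mu>' = sets (restrict_space borel {0..})" by (rule sets')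
    show "\<forall>B\<in>sets \<mu>'. B \<in> ?R \<longrightarrow> emeasure \<mu>' B < \<infinity>"
    proof (intro ballI impI)
      fix B assume B: "B \<in> sets \<mu>'" "B \<in> ?R"
      then have "\<tau> -` B \<in> ideal" by (auto simp: modulus_ideal_iff)
      then show "emeasure \<mu>' B < \<infinity>"
        using rv em[OF B(1)] by (simp add: in_RV_def)
    qed
    show "\<forall>B\<in>sets \<mu>'. B \<inter> \<Union>?R = {} \<longrightarrow> emeasure \<mu>' B = 0"
    proof (intro ballI impI)
      fix B assume B: "B \<in> sets \<mu>'" "B \<inter> \<Union>?R = {}"
      then have "\<tau> -` B \<inter> \<Union>ideal = {}" unfolding UR Union_ideal by auto
      then show "emeasure \<mu>' B = 0"
        using rv em[OF B(1)] by (simp add: in_RV_def)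
    qed
    show "\<exists>B\<in>sets \<mu>'. B \<in> ?R \<and> 0 < emeasure \<mu>' B"
    proof -
      obtain B where B: "B \<in> sets \<mu>" "B \<in> ideal" "0 < emeasure \<mu> B"
        using rv by (auto simp: in_RV_def)
      then obtain \<epsilon> where \<epsilon>: "0 < \<epsilon>" "B \<subseteq> \<tau> -` {\<epsilon><..}" by (auto simp: modulus_ideal_iff)
      have s: "{\<epsilon><..} \<in> sets \<mu>'"
        using \<epsilon>(1) unfolding sets' by (auto simp: sets_restrict_space_iff)
      have "emeasure \<mu> B \<le> emeasure \<mu>' {\<epsilon><..}"
        unfolding em[OF s] by (rule emeasure_mono[OF \<epsilon>(2) em(2)[OF s]])
      moreover have "{\<epsilon><..} \<in> ?R" using \<epsilon>(1) by (auto simp: modulus_ideal_iff)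
      ultimately show ?thesis using B(3) s by (meson less_le_trans)
    qed
    show "\<forall>f::real \<Rightarrow> real. continuous_on (\<Union>?R) f \<and> bounded (f ` \<Union>?R) \<and> (\<forall>x. x \<notin> \<Union>?R \<longrightarrow> f x = 0) \<and>
        {0..} \<inter> closure {x \<in> {0..}. f x \<noteq> 0} \<in> ?R \<longrightarrow>
        ((\<lambda>t. g t * (\<integral>\<omega>. f (inverse t * \<tau> (\<xi> \<omega>)) \<partial>M)) \<longlongrightarrow> (\<integral>x. f x \<partial>\<mu>')) at_top"
    proof (intro allI impI, elim conjE)
      fix f :: "real \<Rightarrow> real"
      assume f: "continuous_on (\<Union>?R) f" "bounded (f ` \<Union>?R)" "\<forall>x. x \<notin> \<Union>?R \<longrightarrow> f x = 0"
        "{0..} \<inter> closure {x \<in> {0..}. f x \<noteq> 0} \<in> ?R"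
      have "continuous_on (\<Union>ideal) (\<lambda>x. f (\<tau> x))"
        unfolding Union_ideal by (rule continuous_on_compose2[OF f(1)[unfolded UR] continuous_on_tau]) auto
      moreover have "bounded ((\<lambda>x. f (\<tau> x)) ` \<Union>ideal)"
        by (rule bounded_subset[OF f(2)]) (auto simp: UR Union_ideal)
      moreover have "\<forall>x. x \<notin> \<Union>ideal \<longrightarrow> f (\<tau> x) = 0"
        using f(3) by (simp add: UR Union_ideal)
      moreover have "UNIV \<inter> closure {x \<in> UNIV. f (\<tau> x) \<noteq> 0} \<in> ideal"
      proof -
        obtain \<epsilon> where \<epsilon>: "0 < \<epsilon>" "{0..} \<inter> closure {x \<in> {0..}. f x \<noteq> 0} \<subseteq> {\<epsilon><..}"
          using f(4) by (auto simp: modulus_ideal_iff subset_iff)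
        have "f (\<tau> x) = 0" if "\<tau> x \<le> \<epsilon>" for x
        proof (rule ccontr)
          assume "f (\<tau> x) \<noteq> 0"
          then have "\<tau> x \<in> {0..} \<inter> closure {x \<in> {0..}. f x \<noteq> 0}"
            using tau_nonneg[of x] closure_subset[of "{x \<in> {0..}. f x \<noteq> 0}"] by auto
          then show False using \<epsilon>(2) that by auto
        qed
        then have "{x \<in> UNIV. f (\<tau> x) \<noteq> 0} \<subseteq> {x. \<epsilon> \<le> \<tau> x}"
          using linear by blast
        moreover have "closed {x. \<epsilon> \<le> \<tau> x}"
          by (intro closed_Collect_le continuous_on_const continuous_on_tau)
        ultimately have "closure {x \<in> UNIV. f (\<tau> x) \<noteq> 0} \<subseteq> {x. \<epsilon> \<le> \<tau> x}"
          by (rule closure_minimal)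
        then show ?thesis
          unfolding modulus_ideal_iff using \<epsilon>(1) by (intro conjI exI[of _ "\<epsilon> / 2"]) auto
      qed
      ultimately have "((\<lambda>t. g t * (\<integral>\<omega>. f (\<tau> (T (inverse t) (\<xi> \<omega>))) \<partial>M)) \<longlongrightarrow> (\<integral>x. f (\<tau> x) \<partial>\<mu>)) at_top"
        using rv unfolding in_RV_def by blast
      moreover have "(\<integral>x. f (\<tau> x) \<partial>\<mu>) = (\<integral>x. f x \<partial>\<mu>')"
        unfolding \<mu>'_def
      proof (rule integral_distr[OF \<tau>_meas, symmetric])
        have "(\<lambda>x. indicator {0<..} x *\<^sub>R f x) \<in> borel_measurable borel"
          using f(1)[unfolded UR] by (intro borel_measurable_continuous_on_indicator) auto
        also have "(\<lambda>x. indicator {0<..} x *\<^sub>R f x) = f"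
          using f(3) by (auto simp: UR indicator_def fun_eq_iff)
        finally show "f \<in> borel_measurable (restrict_space borel {0..})"
          by (rule measurable_restrict_space1)
      qed
      moreover have "eventually (\<lambda>t. g t * (\<integral>\<omega>. f (\<tau> (T (inverse t) (\<xi> \<omega>))) \<partial>M) =
          g t * (\<integral>\<omega>. f (inverse t * \<tau> (\<xi> \<omega>)) \<partial>M)) at_top"
        using eventually_gt_at_top[of 0] by eventually_elim (simp add: tau_T)
      ultimately show "((\<lambda>t. g t * (\<integral>\<omega>. f (inverse t * \<tau> (\<xi> \<omega>)) \<partial>M)) \<longlongrightarrow> (\<integral>x. f x \<partial>\<mu>')) at_top"
        by (simp add: tendsto_cong)
    qed
  qed
  then show ?thesis
    unfolding regularly_varying_variable_def by blast
qed

end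

section \<open>The law of a random element in polar coordinates\<close>

lemma filterlim_mult_const_at_top: "0 < u \<Longrightarrow> filterlim (\<lambda>t::real. u * t) at_top at_top"
  by (rule filterlim_tendsto_pos_mult_at_top[OF tendsto_const _ filterlim_ident])

locale scaled_random_element = spherical_measure T \<tau> \<sigma>
  for T :: "real \<Rightarrow> 'a::topological_space \<Rightarrow> 'a" and \<tau> and \<sigma> +
  fixes M :: "'w measure" and \<xi> :: "'w \<Rightarrow> 'a"
  assumes prob_M: "prob_space M"
    and \<xi>[measurable]: "\<xi> \<in> borel_measurable M"
    and nonzero: "emeasure \<sigma> (modulus_sphere UNIV \<tau>) \<noteq> 0"
begin

sublocale M: prob_space M
  by (rule prob_M)

abbreviation mass :: real where
  "mass \<equiv> measure \<sigma> sphere"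

lemma mass_pos: "0 < mass"
  using nonzero by (simp add: \<sigma>.emeasure_eq_measure zero_less_measure_iff)

definition tail :: "real \<Rightarrow> real" where
  "tail t = measure M {\<omega> \<in> space M. t < \<tau> (\<xi> \<omega>)}"

text \<open>
  The tail weighted by a function of the direction: for an indicator function \<open>k\<close> of \<open>A\<close> this is the probability that
  \<open>\<tau> (\<xi>)\<close> exceeds \<open>t\<close> with direction in \<open>A\<close>.
\<close>

definition excess :: "('a \<Rightarrow> real) \<Rightarrow> real \<Rightarrow> real" where
  "excess k t = (\<integral>\<omega>. cone t k (\<xi> \<omega>) \<partial>M)"

definition law :: "real \<Rightarrow> 'a measure" where
  "law t = conditional_law M (restrict_space borel sphere) (\<lambda>\<omega>. direction (\<xi> \<omega>)) {\<omega> \<in> space M. t < \<tau> (\<xi> \<omega>)}"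

definition spherical_law :: "'a measure" where
  "spherical_law = scale_measure (1 / emeasure \<sigma> sphere) \<sigma>"

lemma sphere_sets: "sphere \<in> sets \<sigma>"
  using sets.top[of \<sigma>] by (simp add: space_\<sigma>)

lemma borel_measurable_one: "(\<lambda>_. 1 :: real) \<in> borel_measurable \<sigma>"
  by simp

lemma integrable_cone_M:
  assumes "k \<in> borel_measurable \<sigma>" "\<And>s. s \<in> sphere \<Longrightarrow> \<bar>k s\<bar> \<le> C" "0 \<le> u"
  shows "integrable M (\<lambda>\<omega>. cone u k (\<xi> \<omega>))"
proof (rule M.integrable_const_bound[where B="\<bar>C\<bar>"])
  show "AE \<omega> in M. norm (cone u k (\<xi> \<omega>)) \<le> \<bar>C\<bar>"
  proof (rule AE_I2)
    fix \<omega>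
    show "norm (cone u k (\<xi> \<omega>)) \<le> \<bar>C\<bar>"
      using cone_bound[of k C u "\<xi> \<omega>", OF assms(2,3)] by (cases "u < \<tau> (\<xi> \<omega>)") auto
  qed
qed (rule measurable_compose[OF \<xi> borel_measurable_cone[OF assms(1,3)]])

lemma tail_event[measurable]: "{\<omega> \<in> space M. t < \<tau> (\<xi> \<omega>)} \<in> sets M"
  by measurable

lemma excess_one: "0 \<le> t \<Longrightarrow> excess (\<lambda>_. 1) t = tail t"
proof -
  have "excess (\<lambda>_. 1) t = (\<integral>\<omega>. indicat_real {\<omega> \<in> space M. t < \<tau> (\<xi> \<omega>)} \<omega> \<partial>M)"
    unfolding excess_def by (intro Bochner_Integration.integral_cong) (auto simp: cone_def indicator_def)
  then show ?thesis by (simp add: tail_def Int_absorb2)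
qed

lemma excess_add_const:
  assumes "k \<in> borel_measurable \<sigma>" "\<And>s. s \<in> sphere \<Longrightarrow> \<bar>k s\<bar> \<le> C" "0 \<le> t"
  shows "excess (\<lambda>s. k s + b) t = excess k t + b * tail t"
proof -
  have "excess (\<lambda>s. k s + b) t = (\<integral>\<omega>. cone t k (\<xi> \<omega>) + b * cone t (\<lambda>_. 1) (\<xi> \<omega>) \<partial>M)"
    unfolding excess_def by (intro Bochner_Integration.integral_cong) (auto simp: cone_def algebra_simps)
  also have "\<dots> = excess k t + b * excess (\<lambda>_. 1) t"
    unfolding excess_def using integrable_cone_M[OF assms] integrable_cone_M[OF borel_measurable_one, of 1 t] assms(3)
    by (subst Bochner_Integration.integral_add) auto
  finally show ?thesis using excess_one[OF assms(3)] by simp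
qed

lemma excess_indicator:
  assumes A: "A \<in> sets \<sigma>" and t: "0 \<le> t"
  shows "excess (indicator A) t = measure M {\<omega> \<in> space M. t < \<tau> (\<xi> \<omega>) \<and> direction (\<xi> \<omega>) \<in> A}"
proof -
  have "excess (indicator A) t = (\<integral>\<omega>. indicat_real {\<omega> \<in> space M. t < \<tau> (\<xi> \<omega>) \<and> direction (\<xi> \<omega>) \<in> A} \<omega> \<partial>M)"
    unfolding excess_def by (intro Bochner_Integration.integral_cong) (auto simp: cone_def indicator_def)
  moreover have "{\<omega> \<in> space M. t < \<tau> (\<xi> \<omega>) \<and> direction (\<xi> \<omega>) \<in> A} \<subseteq> space M" by blast
  ultimately show ?thesis by (simp add: Int_absorb2)
qed

lemma measurable_direction_\<xi>:
  assumes "0 \<le> t"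
  shows "(\<lambda>\<omega>. direction (\<xi> \<omega>)) \<in> restrict_space M {\<omega> \<in> space M. t < \<tau> (\<xi> \<omega>)} \<rightarrow>\<^sub>M restrict_space borel sphere"
proof -
  have "\<xi> \<in> restrict_space M {\<omega> \<in> space M. t < \<tau> (\<xi> \<omega>)} \<rightarrow>\<^sub>M restrict_space borel {x. 0 < \<tau> x}"
    using assms by (intro measurable_restrict_space3 \<xi>) auto
  from measurable_compose[OF this measurable_direction[OF refl]] show ?thesis .
qed

lemma sets_law: "sets (law t) = sets (restrict_space borel sphere)"
  by (simp add: law_def conditional_law_def)

lemma
  assumes t: "0 \<le> t" and pos: "0 < tail t"
  shows prob_space_law: "prob_space (law t)"
    and integral_law: "k \<in> borel_measurable \<sigma> \<Longrightarrow> (\<integral>s. k s \<partial>law t) = excess k t / tail t"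
proof -
  define E where "E = {\<omega> \<in> space M. t < \<tau> (\<xi> \<omega>)}"
  define R where "R = restrict_space M E"
  have E[measurable]: "E \<in> sets M" unfolding E_def by (rule tail_event)
  have E': "E \<inter> space M \<in> sets M" by measurable
  have spR: "space R = E"
    using sets.sets_into_space[OF E] by (auto simp: R_def space_restrict_space)
  have ER: "E \<in> sets R" using sets.top[of R] by (simp add: spR)
  have emE: "emeasure R E = ennreal (tail t)"
    unfolding R_def by (subst emeasure_restrict_space[OF E']) (simp_all add: E_def tail_def M.emeasure_eq_measure)
  have Y: "(\<lambda>\<omega>. direction (\<xi> \<omega>)) \<in> R \<rightarrow>\<^sub>M restrict_space borel sphere"
    unfolding R_def E_def by (rule measurable_direction_\<xi>[OF t])
  have law: "law t = distr (uniform_measure R E) (restrict_space borel sphere) (\<lambda>\<omega>. direction (\<xi> \<omega>))"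
    by (simp add: law_def conditional_law_def R_def E_def)
  have YU: "(\<lambda>\<omega>. direction (\<xi> \<omega>)) \<in> uniform_measure R E \<rightarrow>\<^sub>M restrict_space borel sphere"
    using Y by (simp cong: measurable_cong_sets)
  have "prob_space (uniform_measure R E)"
    using pos emE by (intro prob_space_uniform_measure) auto
  then show "prob_space (law t)"
    unfolding law by (rule prob_space.prob_space_distr[OF _ YU])
  assume k: "k \<in> borel_measurable \<sigma>"
  then have k': "k \<in> borel_measurable (restrict_space borel sphere)"
    by (simp only: measurable_cong_sets[OF sets_\<sigma> refl])
  have kY: "(\<lambda>\<omega>. k (direction (\<xi> \<omega>))) \<in> borel_measurable R"
    by (rule measurable_compose[OF Y k'])
  have dens: "uniform_measure R E = density R (\<lambda>_. ennreal (1 / tail t))"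
    unfolding uniform_measure_def
  proof (rule density_cong)
    show "AE x in R. indicator E x / emeasure R E = ennreal (1 / tail t)"
      using pos emE divide_ennreal[of 1 "tail t"] by (intro AE_I2) (simp add: spR)
  qed (use ER in auto)
  have "(\<integral>s. k s \<partial>law t) = (\<integral>\<omega>. k (direction (\<xi> \<omega>)) \<partial>uniform_measure R E)"
    unfolding law by (rule integral_distr[OF YU k'])
  also have "\<dots> = (\<integral>\<omega>. (1 / tail t) *\<^sub>R k (direction (\<xi> \<omega>)) \<partial>R)"
    unfolding dens using kY pos by (intro integral_density) auto
  also have "\<dots> = (1 / tail t) * (\<integral>\<omega>. k (direction (\<xi> \<omega>)) \<partial>R)"
    by simp
  also have "(\<integral>\<omega>. k (direction (\<xi> \<omega>)) \<partial>R) = (\<integral>\<omega>. indicator E \<omega> *\<^sub>R k (direction (\<xi> \<omega>)) \<partial>M)"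
    unfolding R_def by (rule integral_restrict_space[OF E'])
  also have "\<dots> = excess k t"
    unfolding excess_def by (intro Bochner_Integration.integral_cong) (auto simp: cone_def E_def indicator_def)
  finally show "(\<integral>s. k s \<partial>law t) = excess k t / tail t" by simp
qed

lemma measure_law:
  assumes "0 \<le> t" "0 < tail t" and A: "A \<in> sets \<sigma>"
  shows "measure (law t) A = excess (indicator A) t / tail t"
proof -
  have "A \<in> sets (law t)" using A by (simp add: sets_law sets_\<sigma>)
  then have "measure (law t) A = (\<integral>s. indicator A s \<partial>law t)"
    using sets.sets_into_space[of A "law t"] by (simp add: Int_absorb2)
  then show ?thesis
    using integral_law[OF assms(1,2), of "indicator A"] A by simp
qed

lemma emeasure_sphere: "emeasure \<sigma> sphere = ennreal mass"
  by (rule \<sigma>.emeasure_eq_measure)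

lemma inverse_mass: "1 / emeasure \<sigma> sphere = ennreal (1 / mass)"
  using divide_ennreal[of 1 mass] mass_pos by (simp add: emeasure_sphere)

lemma sets_spherical_law: "sets spherical_law = sets (restrict_space borel sphere)"
  by (simp add: spherical_law_def sets_\<sigma>)

lemma emeasure_spherical_law: "emeasure spherical_law A = ennreal (1 / mass) * emeasure \<sigma> A"
  unfolding spherical_law_def inverse_mass by simp

lemma measure_spherical_law: "measure spherical_law A = measure \<sigma> A / mass"
  using mass_pos by (simp add: measure_def emeasure_spherical_law enn2real_mult)

lemma prob_space_spherical_law: "prob_space spherical_law"
proof
  have "space spherical_law = sphere" using space_restrict_borel_sets[OF sets_spherical_law] .
  then show "emeasure spherical_law (space spherical_law) = 1"
    using mass_pos by (simp add: emeasure_spherical_law emeasure_sphere flip: ennreal_mult)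
qed

lemma integral_spherical_law:
  assumes "k \<in> borel_measurable \<sigma>"
  shows "(\<integral>s. k s \<partial>spherical_law) = (\<integral>s. k s \<partial>\<sigma> :: real) / mass"
proof -
  have "spherical_law = density \<sigma> (\<lambda>_. ennreal (1 / mass))"
    by (rule measure_eqI) (simp_all add: spherical_law_def emeasure_density_const inverse_mass)
  then show ?thesis
    using assms mass_pos by (simp add: integral_density)
qed

lemma weakly_converges_on_law_iff:
  assumes pos: "\<And>t. 0 < tail t"
  shows "weakly_converges_on sphere law spherical_law at_top \<longleftrightarrow>
    (\<forall>k. continuous_on sphere k \<and> bounded (k ` sphere) \<longrightarrow>
      ((\<lambda>t. excess k t / tail t) \<longlongrightarrow> (\<integral>s. k s \<partial>\<sigma>) / mass) at_top)"
  unfolding weakly_converges_on_def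
proof (intro arg_cong[where f=All] ext imp_cong refl)
  fix k :: "'a \<Rightarrow> real" assume k: "continuous_on sphere k \<and> bounded (k ` sphere)"
  then have km: "k \<in> borel_measurable \<sigma>"
    using borel_measurable_continuous_on_sets[OF _ sets_\<sigma>] by blast
  have "eventually (\<lambda>t. (\<integral>s. k s \<partial>law t) = excess k t / tail t) at_top"
    using eventually_ge_at_top[of 0] by eventually_elim (rule integral_law[OF _ pos km])
  from tendsto_cong[OF this] integral_spherical_law[OF km]
  show "((\<lambda>t. \<integral>s. k s \<partial>law t) \<longlongrightarrow> (\<integral>s. k s \<partial>spherical_law)) at_top \<longleftrightarrow>
      ((\<lambda>t. excess k t / tail t) \<longlongrightarrow> (\<integral>s. k s \<partial>\<sigma>) / mass) at_top"
    by simp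
qed

definition polar_limit :: "real \<Rightarrow> bool" where
  "polar_limit \<alpha> \<longleftrightarrow> 0 < \<alpha> \<and> tau_additive_on sphere \<sigma> \<and> power_tail M (\<lambda>\<omega>. \<tau> (\<xi> \<omega>)) \<alpha> \<and>
     weakly_converges_on sphere law spherical_law at_top"

lemma power_tail_tail:
  "power_tail M (\<lambda>\<omega>. \<tau> (\<xi> \<omega>)) \<alpha> \<longleftrightarrow> (\<forall>t. 0 < tail t) \<and>
     (\<forall>u>0. ((\<lambda>t. tail (u * t) / tail t) \<longlongrightarrow> u powr (- \<alpha>)) at_top)"
  by (simp add: power_tail_def tail_def)

section \<open>From regular variation to polar coordinates\<close>

text \<open>
  The function \<open>k (direction x) * ramp a b (\<tau> x)\<close> is continuous, with support in \<open>{a \<le> \<tau>}\<close>, hence an admissible test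
  function. Its integral lies between those of the cone functions at levels \<open>b\<close> and \<open>a\<close>.
\<close>

lemma in_RV_excess_limit:
  assumes rv: "in_RV M \<xi> UNIV T ideal g (homogeneous \<alpha>)" and \<alpha>: "0 < \<alpha>"
    and k: "continuous_on sphere k" "\<And>s. s \<in> sphere \<Longrightarrow> 0 \<le> k s" "\<And>s. s \<in> sphere \<Longrightarrow> k s \<le> C" and u: "0 < u"
  shows "((\<lambda>t. g t * excess k (u * t)) \<longlongrightarrow> (\<integral>s. k s \<partial>\<sigma>) * u powr (- \<alpha>)) at_top"
proof -
  have km: "k \<in> borel_measurable \<sigma>" by (rule borel_measurable_continuous_on_sets[OF k(1) sets_\<sigma>])
  have kC: "\<bar>k s\<bar> \<le> C" if "s \<in> sphere" for s using k(2,3)[OF that] by simp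
  have g0: "0 \<le> g t" if "0 \<le> t" for t using rv that by (simp add: in_RV_def)
  define W where "W \<omega> = cone 0 k (\<xi> \<omega>)" for \<omega>
  have W_meas: "W \<in> borel_measurable M"
    unfolding W_def by (rule measurable_compose[OF \<xi> borel_measurable_cone[OF km]]) simp
  have W: "0 \<le> W \<omega>" "W \<omega> \<le> \<bar>C\<bar>" for \<omega>
    using k(2,3) direction_in_sphere[of "\<xi> \<omega>"] unfolding W_def cone_def by (force simp: indicator_def)+
  define f where "f a b x = k (direction x) * ramp a b (\<tau> x)" for a b x
  define I where "I a b = (\<integral>x. f a b x \<partial>homogeneous \<alpha>)" for a b
  have f_cone: "cone b k x \<le> f a b x" "f a b x \<le> cone a k x" if ab: "0 < a" "a < b" for a b x
  proof -
    have "cone b k x \<le> f a b x \<and> f a b x \<le> cone a k x"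
    proof (cases "0 < \<tau> x")
      case True
      then show ?thesis
        using k(2)[OF direction_in_sphere[OF True]] indicator_le_ramp[OF ab(2), of "\<tau> x"] ramp_le_indicator[OF ab(2), of "\<tau> x"]
        unfolding cone_def f_def by (simp add: mult_left_mono)
    next
      case False
      then show ?thesis using ab by (simp add: cone_def f_def ramp_eq_0)
    qed
    then show "cone b k x \<le> f a b x" "f a b x \<le> cone a k x" by auto
  qed
  have f_zero: "f a b x = 0" if "a < b" "\<tau> x \<le> a" for a b x
    using that by (simp add: f_def ramp_eq_0)
  have f_cont: "continuous_on {x. 0 < \<tau> x} (f a b)" for a b
    unfolding f_def
    using direction_in_sphere
    by (intro continuous_on_mult continuous_on_compose2[OF k(1) continuous_on_direction]
        continuous_on_compose2[OF continuous_on_ramp continuous_on_tau]) auto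
  have f_meas: "f a b \<in> borel_measurable borel" if ab: "0 < a" "a < b" for a b
  proof -
    have "(\<lambda>x. indicator {x. 0 < \<tau> x} x *\<^sub>R f a b x) \<in> borel_measurable borel"
      using open_tau_greater[of 0] by (intro borel_measurable_continuous_on_indicator f_cont) simp
    also have "(\<lambda>x. indicator {x. 0 < \<tau> x} x *\<^sub>R f a b x) = f a b"
      using f_zero[OF ab(2)] ab by (auto simp: indicator_def fun_eq_iff not_less)
    finally show ?thesis .
  qed
  have conv: "((\<lambda>t. g t * (\<integral>\<omega>. W \<omega> * ramp a b (inverse t * \<tau> (\<xi> \<omega>)) \<partial>M)) \<longlongrightarrow> I a b) at_top"
    if ab: "0 < a" "a < b" for a b
  proof -
    have "bounded (f a b ` \<Union>ideal)"
    proof (rule boundedI[where B="\<bar>C\<bar>"])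
      fix y assume "y \<in> f a b ` \<Union>ideal"
      then obtain x where x: "y = f a b x" "0 < \<tau> x" by (auto simp: Union_ideal)
      have "\<bar>k (direction x)\<bar> * \<bar>ramp a b (\<tau> x)\<bar> \<le> \<bar>C\<bar> * 1"
        using kC[OF direction_in_sphere[OF x(2)]] ramp_bounds[of a b "\<tau> x"] by (intro mult_mono) auto
      then show "norm y \<le> \<bar>C\<bar>" by (simp add: x(1) f_def abs_mult)
    qed
    moreover have "\<forall>x. x \<notin> \<Union>ideal \<longrightarrow> f a b x = 0"
      using f_zero[OF ab(2)] ab(1) by (auto simp: Union_ideal)
    moreover have "UNIV \<inter> closure {x \<in> UNIV. f a b x \<noteq> 0} \<in> ideal"
    proof -
      have "closure {x \<in> UNIV. f a b x \<noteq> 0} \<subseteq> {x. a \<le> \<tau> x}"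
      proof (rule closure_minimal)
        show "closed {x. a \<le> \<tau> x}"
          by (intro closed_Collect_le continuous_on_const continuous_on_tau)
        show "{x \<in> UNIV. f a b x \<noteq> 0} \<subseteq> {x. a \<le> \<tau> x}"
          using f_zero[OF ab(2)] linear by blast
      qed
      then show ?thesis
        unfolding modulus_ideal_iff using ab(1) by (intro conjI exI[of _ "a / 2"]) auto
    qed
    ultimately have "((\<lambda>t. g t * (\<integral>\<omega>. f a b (T (inverse t) (\<xi> \<omega>)) \<partial>M)) \<longlongrightarrow> I a b) at_top"
      using rv f_cont[of a b] unfolding in_RV_def I_def Union_ideal by blast
    moreover have "eventually (\<lambda>t. g t * (\<integral>\<omega>. f a b (T (inverse t) (\<xi> \<omega>)) \<partial>M) =
        g t * (\<integral>\<omega>. W \<omega> * ramp a b (inverse t * \<tau> (\<xi> \<omega>)) \<partial>M)) at_top"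
      using eventually_gt_at_top[of 0]
    proof eventually_elim
      case (elim t)
      have "f a b (T (inverse t) x) = cone 0 k x * ramp a b (inverse t * \<tau> x)" for x
      proof (cases "0 < \<tau> x")
        case True
        then show ?thesis using elim by (simp add: f_def cone_def direction_T tau_T)
      next
        case False
        then have "\<tau> x = 0" using tau_nonneg[of x] by simp
        then show ?thesis using elim ab by (simp add: f_def cone_def tau_T ramp_eq_0)
      qed
      then show ?case by (simp add: W_def)
    qed
    ultimately show ?thesis by (simp add: tendsto_cong)
  qed
  have int_cone: "integrable (homogeneous \<alpha>) (cone a k)" if "0 < a" for a
    by (rule integrable_cone[OF \<alpha> that km kC])
  have int_f: "integrable (homogeneous \<alpha>) (f a b)" if ab: "0 < a" "a < b" for a b
  proof (rule Bochner_Integration.integrable_bound[OF int_cone[OF ab(1)]])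
    show "f a b \<in> borel_measurable (homogeneous \<alpha>)"
      using f_meas[OF ab] by (simp cong: measurable_cong_sets)
    show "AE x in homogeneous \<alpha>. norm (f a b x) \<le> norm (cone a k x)"
    proof (rule AE_I2)
      fix x
      have "0 \<le> cone b k x"
        using k(2)[OF direction_in_sphere, of x] ab by (auto simp: cone_def indicator_def)
      then show "norm (f a b x) \<le> norm (cone a k x)"
        using f_cone[OF ab, of x] by simp
    qed
  qed
  have "((\<lambda>t. g t * (\<integral>\<omega>. W \<omega> * indicator {u<..} (inverse t * \<tau> (\<xi> \<omega>)) \<partial>M)) \<longlongrightarrow> (\<integral>s. k s \<partial>\<sigma>) * u powr (- \<alpha>)) at_top"
  proof (rule tendsto_indicator_from_ramps[where I=I and C="\<bar>C\<bar>" and H="\<lambda>u. (\<integral>s. k s \<partial>\<sigma>) * u powr (- \<alpha>)", OF prob_M W_meas])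
    show "isCont (\<lambda>u. (\<integral>s. k s \<partial>\<sigma>) * u powr (- \<alpha>)) u"
      using u by (intro continuous_intros) auto
    fix a b :: real assume ab: "0 < a" "a < b"
    then have b: "0 < b" by simp
    show "(\<integral>s. k s \<partial>\<sigma>) * b powr (- \<alpha>) \<le> I a b"
      unfolding I_def using integral_mono[OF int_cone[OF b] int_f[OF ab] f_cone(1)[OF ab]]
      by (simp add: integral_cone[OF \<alpha> km b] mult.commute)
    show "I a b \<le> (\<integral>s. k s \<partial>\<sigma>) * a powr (- \<alpha>)"
      unfolding I_def using integral_mono[OF int_f[OF ab] int_cone[OF ab(1)] f_cone(2)[OF ab]]
      by (simp add: integral_cone[OF \<alpha> km ab(1)] mult.commute)
  qed (use W g0 conv u in auto)
  moreover have "eventually (\<lambda>t. g t * (\<integral>\<omega>. W \<omega> * indicator {u<..} (inverse t * \<tau> (\<xi> \<omega>)) \<partial>M) = g t * excess k (u * t)) at_top"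
    using eventually_gt_at_top[of 0]
  proof eventually_elim
    case (elim t)
    have "W \<omega> * indicator {u<..} (inverse t * \<tau> (\<xi> \<omega>)) = cone (u * t) k (\<xi> \<omega>)" for \<omega>
    proof -
      have "u < inverse t * \<tau> (\<xi> \<omega>) \<longleftrightarrow> u * t < \<tau> (\<xi> \<omega>)" using elim by (simp add: field_simps)
      moreover have "0 < u * t" using elim u by simp
      ultimately show ?thesis by (auto simp: W_def cone_def indicator_def)
    qed
    then show ?case by (simp add: excess_def)
  qed
  ultimately show ?thesis by (simp add: tendsto_cong)
qed

lemma in_RV_imp_polar_limit:
  assumes rv: "in_RV M \<xi> UNIV T ideal g \<mu>" and tau: "tau_additive_on UNIV \<mu>" and \<alpha>: "0 < \<alpha>"
    and eq: "\<And>B. B \<in> sets borel \<Longrightarrow> B \<in> ideal \<Longrightarrow>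
      emeasure \<mu> B = ennreal \<alpha> * (\<integral>\<^sup>+ t \<in> {0<..}. emeasure \<sigma> (T t ` B \<inter> sphere) * ennreal (t powr (\<alpha> - 1)) \<partial>lborel)"
  shows "polar_limit \<alpha>"
proof -
  have sets: "sets \<mu> = sets borel" using rv by (simp add: in_RV_def sets_restrict_borel_UNIV)
  have "\<mu> = homogeneous \<alpha>"
  proof (rule measure_eq_homogeneous[OF sets])
    show "emeasure \<mu> B = emeasure (homogeneous \<alpha>) B" if "B \<in> sets borel" "B \<in> ideal" for B
      unfolding emeasure_homogeneous_scaled[OF \<alpha> that(1)] by (rule eq[OF that])
    show "emeasure \<mu> B = 0" if "B \<in> sets borel" "B \<inter> {x. 0 < \<tau> x} = {}" for B
      using rv that sets by (simp add: in_RV_def Union_modulus_ideal)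
  qed
  then have rv: "in_RV M \<xi> UNIV T ideal g (homogeneous \<alpha>)"
    and tau: "tau_additive_on UNIV (homogeneous \<alpha>)" using rv tau by simp_all
  have tail_lim: "((\<lambda>t. g t * tail (u * t)) \<longlongrightarrow> mass * u powr (- \<alpha>)) at_top" if u: "0 < u" for u
  proof -
    have "((\<lambda>t. g t * excess (\<lambda>_. 1) (u * t)) \<longlongrightarrow> (\<integral>s. 1 \<partial>\<sigma>) * u powr (- \<alpha>)) at_top"
      by (rule in_RV_excess_limit[OF rv \<alpha> continuous_on_const, of _ 1]) (use u in auto)
    moreover have "eventually (\<lambda>t. g t * excess (\<lambda>_. 1) (u * t) = g t * tail (u * t)) at_top"
      using eventually_ge_at_top[of 0] by eventually_elim (use u in \<open>simp add: excess_one\<close>)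
    ultimately show ?thesis by (simp add: tendsto_cong space_\<sigma>)
  qed
  have pt: "power_tail M (\<lambda>\<omega>. \<tau> (\<xi> \<omega>)) \<alpha>"
    by (rule power_tailI[OF prob_M, where c=mass and g=g]) (use mass_pos tail_lim in \<open>auto simp: tail_def\<close>)
  then have pos: "0 < tail t" for t by (simp add: power_tail_tail)
  have tail_lim1: "((\<lambda>t. g t * tail t) \<longlongrightarrow> mass) at_top"
    using tail_lim[of 1] by simp
  have g_ev: "eventually (\<lambda>t. g t * tail t \<noteq> 0) at_top"
    by (rule tendsto_imp_eventually_ne[OF tail_lim1]) (use mass_pos in simp)
  have nonneg: "((\<lambda>t. excess k t / tail t) \<longlongrightarrow> (\<integral>s. k s \<partial>\<sigma>) / mass) at_top"
    if k: "continuous_on sphere k" "\<And>s. s \<in> sphere \<Longrightarrow> 0 \<le> k s" "\<And>s. s \<in> sphere \<Longrightarrow> k s \<le> C" for k C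
  proof -
    have "((\<lambda>t. g t * excess k t) \<longlongrightarrow> (\<integral>s. k s \<partial>\<sigma>)) at_top"
      using in_RV_excess_limit[OF rv \<alpha> k, of 1] by simp
    then have "((\<lambda>t. (g t * excess k t) / (g t * tail t)) \<longlongrightarrow> (\<integral>s. k s \<partial>\<sigma>) / mass) at_top"
      using mass_pos by (intro tendsto_divide tail_lim1) auto
    moreover have "eventually (\<lambda>t. (g t * excess k t) / (g t * tail t) = excess k t / tail t) at_top"
      using g_ev by eventually_elim simp
    ultimately show ?thesis by (simp add: tendsto_cong)
  qed
  have "weakly_converges_on sphere law spherical_law at_top"
    unfolding weakly_converges_on_law_iff[OF pos]
  proof (intro allI impI, elim conjE)
    fix k :: "'a \<Rightarrow> real" assume k: "continuous_on sphere k" "bounded (k ` sphere)"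
    then obtain C where C: "\<And>s. s \<in> sphere \<Longrightarrow> \<bar>k s\<bar> \<le> C" by (auto simp: bounded_iff)
    have km: "k \<in> borel_measurable \<sigma>" by (rule borel_measurable_continuous_on_sets[OF k(1) sets_\<sigma>])
    have int_k: "integrable \<sigma> k"
      using C km by (intro \<sigma>.integrable_const_bound[where B=C]) (auto simp: space_\<sigma>)
    \<comment> \<open>A bounded function becomes nonnegative after adding a constant.\<close>
    have "((\<lambda>t. excess (\<lambda>s. k s + C) t / tail t) \<longlongrightarrow> (\<integral>s. k s + C \<partial>\<sigma>) / mass) at_top"
    proof (rule nonneg[of _ "2 * C"])
      show "continuous_on sphere (\<lambda>s. k s + C)" by (intro continuous_on_add k(1) continuous_on_const)
    qed (use C in \<open>force simp: abs_le_iff\<close>)+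
    then have "((\<lambda>t. excess (\<lambda>s. k s + C) t / tail t - C) \<longlongrightarrow> (\<integral>s. k s + C \<partial>\<sigma>) / mass - C) at_top"
      by (intro tendsto_diff tendsto_const)
    moreover have "(\<integral>s. k s + C \<partial>\<sigma>) / mass - C = (\<integral>s. k s \<partial>\<sigma>) / mass"
      using int_k mass_pos by (simp add: Bochner_Integration.integral_add space_\<sigma> field_simps)
    moreover have "eventually (\<lambda>t. excess (\<lambda>s. k s + C) t / tail t - C = excess k t / tail t) at_top"
      using eventually_ge_at_top[of 0]
    proof eventually_elim
      case (elim t)
      show ?case
        using pos[of t] excess_add_const[OF km C elim, of C] by (simp add: field_simps)
    qed
    ultimately show "((\<lambda>t. excess k t / tail t) \<longlongrightarrow> (\<integral>s. k s \<partial>\<sigma>) / mass) at_top"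
      by (simp add: tendsto_cong)
  qed
  then show ?thesis
    unfolding polar_limit_def using \<alpha> pt tau_additive_sphere[OF tau \<alpha>] by blast
qed

end

context scaled_random_element
begin

section \<open>From polar coordinates to regular variation\<close>

context
  fixes \<alpha> :: real
  assumes polar: "polar_limit \<alpha>"
begin

lemma polar_limit_pos: "0 < \<alpha>"
  and tail_pos: "0 < tail t"
  and tail_ratio: "0 < u \<Longrightarrow> ((\<lambda>t. tail (u * t) / tail t) \<longlongrightarrow> u powr (- \<alpha>)) at_top"
  using polar by (auto simp: polar_limit_def power_tail_tail)

lemma excess_ratio:
  assumes "continuous_on sphere k" "bounded (k ` sphere)" and u: "0 < u"
  shows "((\<lambda>t. mass / tail t * excess k (u * t)) \<longlongrightarrow> u powr (- \<alpha>) * (\<integral>s. k s \<partial>\<sigma>)) at_top"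
proof -
  have "((\<lambda>t. excess k t / tail t) \<longlongrightarrow> (\<integral>s. k s \<partial>\<sigma>) / mass) at_top"
    using polar assms(1,2) weakly_converges_on_law_iff[OF tail_pos] by (simp add: polar_limit_def)
  from filterlim_compose[OF this filterlim_mult_const_at_top[OF u]]
  have "((\<lambda>t. mass * (excess k (u * t) / tail (u * t)) * (tail (u * t) / tail t)) \<longlongrightarrow>
      mass * ((\<integral>s. k s \<partial>\<sigma>) / mass) * u powr (- \<alpha>)) at_top"
    by (intro tendsto_mult tendsto_const tail_ratio u)
  moreover have "mass * (excess k (u * t) / tail (u * t)) * (tail (u * t) / tail t) = mass / tail t * excess k (u * t)" for t
    using tail_pos[of "u * t"] by simp
  ultimately show ?thesis
    using mass_pos by (simp add: mult.commute)
qed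

lemma borel_measurable_T: "0 < t \<Longrightarrow> T (inverse t) \<in> borel_measurable borel"
  by (intro borel_measurable_continuous_onI continuous_on_T continuous_on_id continuous_on_const) auto

lemma cone_limit:
  assumes u: "0 < u" and k: "continuous_on sphere k" "bounded (k ` sphere)"
  shows "((\<lambda>t. mass / tail t * (\<integral>\<omega>. cone u k (T (inverse t) (\<xi> \<omega>)) \<partial>M)) \<longlongrightarrow> (\<integral>x. cone u k x \<partial>homogeneous \<alpha>)) at_top"
proof -
  have km: "k \<in> borel_measurable \<sigma>" by (rule borel_measurable_continuous_on_sets[OF k(1) sets_\<sigma>])
  have "eventually (\<lambda>t. mass / tail t * (\<integral>\<omega>. cone u k (T (inverse t) (\<xi> \<omega>)) \<partial>M) = mass / tail t * excess k (u * t)) at_top"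
    using eventually_gt_at_top[of 0] by eventually_elim (simp add: excess_def cone_scale[OF _ u])
  from tendsto_cong[OF this] show ?thesis
    using excess_ratio[OF k u] by (simp add: integral_cone[OF polar_limit_pos km u])
qed

text \<open>
  The shift by \<open>B\<close> makes \<open>f\<close> nonnegative. On \<open>{\<epsilon> < \<tau>}\<close> it contributes \<open>B\<close> times the normalised tail at \<open>\<epsilon> * t\<close>, whose
  limit \<open>B * N\<close> is known, and it is subtracted again in the end.
\<close>

lemma test_function_lower_bound:
  assumes f: "continuous_on {x. 0 < \<tau> x} f" "\<And>x. \<bar>f x\<bar> \<le> B" "\<And>x. \<tau> x \<le> \<epsilon> \<Longrightarrow> f x = 0" and \<epsilon>: "0 < \<epsilon>"
    and l: "l < (\<integral>x. f x \<partial>homogeneous \<alpha>)"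
  shows "eventually (\<lambda>t. l < mass / tail t * (\<integral>\<omega>. f (T (inverse t) (\<xi> \<omega>)) \<partial>M)) at_top"
proof -
  let ?E = "{x. \<epsilon> < \<tau> x}"
  have E: "?E \<in> sets borel" using open_tau_greater[of \<epsilon>] by simp
  have B: "0 \<le> B" using f(2)[of undefined] by simp
  have f_meas: "f \<in> borel_measurable borel"
  proof -
    have "(\<lambda>x. indicator {x. 0 < \<tau> x} x *\<^sub>R f x) \<in> borel_measurable borel"
      using open_tau_greater[of 0] by (intro borel_measurable_continuous_on_indicator f(1)) simp
    also have "(\<lambda>x. indicator {x. 0 < \<tau> x} x *\<^sub>R f x) = f"
      using f(3) \<epsilon> by (auto simp: indicator_def fun_eq_iff)
    finally show ?thesis .
  qed
  have f_ind: "(f x + B) * indicator ?E x = f x + B * indicator ?E x" for x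
    using f(3)[of x] by (auto simp: indicator_def)
  have int_f: "integrable (homogeneous \<alpha>) f"
  proof (rule Bochner_Integration.integrable_bound[OF integrable_tail[OF polar_limit_pos \<epsilon>, of B]])
    show "f \<in> borel_measurable (homogeneous \<alpha>)" using f_meas by (simp cong: measurable_cong_sets)
    show "AE x in homogeneous \<alpha>. norm (f x) \<le> norm (B * indicat_real ?E x)"
    proof (rule AE_I2)
      fix x show "norm (f x) \<le> norm (B * indicat_real ?E x)"
        using f(2,3)[of x] B by (cases "\<epsilon> < \<tau> x") auto
    qed
  qed
  define N where "N = measure (homogeneous \<alpha>) ?E"
  have N: "N = mass * \<epsilon> powr (- \<alpha>)"
    unfolding N_def measure_def emeasure_homogeneous_tail[OF polar_limit_pos \<epsilon>] using mass_pos by simp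
  have int_eq: "(\<integral>x. (f x + B) * indicator ?E x \<partial>homogeneous \<alpha>) = (\<integral>x. f x \<partial>homogeneous \<alpha>) + B * N"
    unfolding f_ind N_def using int_f integrable_tail[OF polar_limit_pos \<epsilon>, of B]
    by (subst Bochner_Integration.integral_add) auto
  \<comment> \<open>The gap between \<open>l\<close> and \<open>m\<close> absorbs the error in the limit of the tail.\<close>
  obtain m where m: "l < m" "m < (\<integral>x. f x \<partial>homogeneous \<alpha>)" using l dense by blast
  have low: "eventually (\<lambda>t. m + B * N < mass / tail t * (\<integral>\<omega>. (f (T (inverse t) (\<xi> \<omega>)) + B) * indicator ?E (T (inverse t) (\<xi> \<omega>)) \<partial>M)) at_top"
  proof (rule vague_lower_bound[where C="2 * B", OF \<epsilon> _ _ _ prob_M \<xi> polar_limit_pos _ borel_measurable_T cone_limit])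
    show "continuous_on {x. \<epsilon> \<le> \<tau> x} (\<lambda>x. f x + B)"
      using \<epsilon> by (intro continuous_on_add continuous_on_const continuous_on_subset[OF f(1)]) auto
    show "0 \<le> f x + B" "f x + B \<le> 2 * B" for x using f(2)[of x] by auto
    show "0 \<le> mass / tail t" for t using tail_pos[of t] mass_pos by simp
    show "m + B * N < (\<integral>x. (f x + B) * indicator ?E x \<partial>homogeneous \<alpha>)"
      unfolding int_eq using m(2) by simp
  qed
  have "((\<lambda>t. B * (mass * (tail (\<epsilon> * t) / tail t))) \<longlongrightarrow> B * (mass * \<epsilon> powr (- \<alpha>))) at_top"
    by (intro tendsto_mult tendsto_const tail_ratio \<epsilon>)
  then have "eventually (\<lambda>t. B * (mass * (tail (\<epsilon> * t) / tail t)) < B * N + (m - l)) at_top"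
    unfolding N using m(1) by (intro order_tendstoD) auto
  with low eventually_gt_at_top[of 0] show ?thesis
  proof eventually_elim
    case (elim t)
    have T_meas: "(\<lambda>\<omega>. T (inverse t) (\<xi> \<omega>)) \<in> borel_measurable M"
      by (rule measurable_compose[OF \<xi> borel_measurable_T[OF elim(2)]])
    have ev: "T (inverse t) (\<xi> \<omega>) \<in> ?E \<longleftrightarrow> \<epsilon> * t < \<tau> (\<xi> \<omega>)" for \<omega>
      using elim(2) by (simp add: tau_T field_simps)
    have 1: "integrable M (\<lambda>\<omega>. f (T (inverse t) (\<xi> \<omega>)))"
      using f(2) by (intro M.integrable_const_bound[where B=B] measurable_compose[OF T_meas f_meas]) auto
    let ?F = "{\<omega>. \<epsilon> * t < \<tau> (\<xi> \<omega>)}"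
    have 2: "indicat_real ?E (T (inverse t) (\<xi> \<omega>)) = indicat_real ?F \<omega>" for \<omega>
      using ev[of \<omega>] by (simp add: indicator_def)
    have 3: "?F \<inter> space M = {\<omega> \<in> space M. \<epsilon> * t < \<tau> (\<xi> \<omega>)}" by blast
    have "integrable M (\<lambda>\<omega>. B * indicat_real ?F \<omega>)"
      by (intro integrable_mult_right) (simp add: integrable_indicator_iff 3 M.emeasure_eq_measure)
    then have "(\<integral>\<omega>. (f (T (inverse t) (\<xi> \<omega>)) + B) * indicator ?E (T (inverse t) (\<xi> \<omega>)) \<partial>M)
        = (\<integral>\<omega>. f (T (inverse t) (\<xi> \<omega>)) \<partial>M) + B * tail (\<epsilon> * t)"
      unfolding f_ind unfolding 2 using 1 by (subst Bochner_Integration.integral_add) (auto simp: 3 tail_def)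
    then have "m + B * N < mass / tail t * (\<integral>\<omega>. f (T (inverse t) (\<xi> \<omega>)) \<partial>M) + B * (mass * (tail (\<epsilon> * t) / tail t))"
      using elim(1) by (simp add: algebra_simps)
    then show ?case using elim(3) by linarith
  qed
qed

text \<open>
  The lower bound is applied to a test function and to its negative.
\<close>

lemma polar_limit_imp_in_RV:
  "in_RV M \<xi> UNIV T ideal (\<lambda>t. mass / tail t) (homogeneous \<alpha>)"
proof -
  have pt: "power_tail M (\<lambda>\<omega>. \<tau> (\<xi> \<omega>)) \<alpha>" using polar by (simp add: polar_limit_def)
  have \<tau>\<xi>: "(\<lambda>\<omega>. \<tau> (\<xi> \<omega>)) \<in> borel_measurable M" by measurable
  note norm = inverse_tail_normalising[OF prob_M \<tau>\<xi> mass_pos pt, folded tail_def]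
  show ?thesis
    unfolding in_RV_def
  proof (intro conjI)
    show "(\<lambda>t. mass / tail t) \<in> borel_measurable (restrict_space borel {0..})"
      by (rule measurable_restrict_space1[OF norm(1)])
    show "\<forall>t\<ge>0. 0 \<le> mass / tail t" using norm(2) by (auto intro: less_imp_le)
    show "filterlim (\<lambda>t. mass / tail t) at_top at_top" by (rule norm(3))
    show "sets (homogeneous \<alpha>) = sets (restrict_space borel UNIV)" by (simp add: sets_restrict_borel_UNIV)
    show "\<forall>B\<in>sets (homogeneous \<alpha>). B \<in> ideal \<longrightarrow> emeasure (homogeneous \<alpha>) B < \<infinity>"
    proof (intro ballI impI)
      fix B assume "B \<in> ideal"
      then obtain \<epsilon> where \<epsilon>: "0 < \<epsilon>" "B \<subseteq> {x. \<epsilon> < \<tau> x}" by (auto simp: modulus_ideal_iff)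
      have "emeasure (homogeneous \<alpha>) B \<le> emeasure (homogeneous \<alpha>) {x. \<epsilon> < \<tau> x}"
        using open_tau_greater[of \<epsilon>] by (intro emeasure_mono[OF \<epsilon>(2)]) simp
      also have "\<dots> < \<infinity>" by (simp add: emeasure_homogeneous_tail[OF polar_limit_pos \<epsilon>(1)])
      finally show "emeasure (homogeneous \<alpha>) B < \<infinity>" .
    qed
    show "\<forall>B\<in>sets (homogeneous \<alpha>). B \<inter> \<Union>ideal = {} \<longrightarrow> emeasure (homogeneous \<alpha>) B = 0"
      unfolding Union_ideal using emeasure_homogeneous_tau_0 by simp
    show "\<exists>B\<in>sets (homogeneous \<alpha>). B \<in> ideal \<and> 0 < emeasure (homogeneous \<alpha>) B"
    proof (intro bexI conjI)
      show "{x. 1 < \<tau> x} \<in> sets (homogeneous \<alpha>)" using open_tau_greater[of 1] by simp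
      show "{x. 1 < \<tau> x} \<in> ideal" by (auto simp: modulus_ideal_iff intro: exI[of _ 1])
      show "0 < emeasure (homogeneous \<alpha>) {x. 1 < \<tau> x}"
        using mass_pos by (simp add: emeasure_homogeneous_tail[OF polar_limit_pos])
    qed
    show "\<forall>f::'a \<Rightarrow> real. continuous_on (\<Union>ideal) f \<and> bounded (f ` \<Union>ideal) \<and> (\<forall>x. x \<notin> \<Union>ideal \<longrightarrow> f x = 0) \<and>
        UNIV \<inter> closure {x \<in> UNIV. f x \<noteq> 0} \<in> ideal \<longrightarrow>
        ((\<lambda>t. mass / tail t * (\<integral>\<omega>. f (T (inverse t) (\<xi> \<omega>)) \<partial>M)) \<longlongrightarrow> (\<integral>x. f x \<partial>homogeneous \<alpha>)) at_top"
      unfolding Union_ideal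
    proof (intro allI impI, elim conjE)
      fix f :: "'a \<Rightarrow> real"
      assume f: "continuous_on {x. 0 < \<tau> x} f" "bounded (f ` {x. 0 < \<tau> x})" "\<forall>x. x \<notin> {x. 0 < \<tau> x} \<longrightarrow> f x = 0"
        "UNIV \<inter> closure {x \<in> UNIV. f x \<noteq> 0} \<in> ideal"
      obtain C where C: "\<And>x. 0 < \<tau> x \<Longrightarrow> \<bar>f x\<bar> \<le> C"
        using f(2) by (auto simp: bounded_iff)
      have bd: "\<bar>f x\<bar> \<le> \<bar>C\<bar>" for x
        using C[of x] f(3) by (cases "0 < \<tau> x") auto
      obtain \<epsilon> where \<epsilon>: "0 < \<epsilon>" "closure {x \<in> UNIV. f x \<noteq> 0} \<subseteq> {x. \<epsilon> < \<tau> x}"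
        using f(4) by (auto simp: modulus_ideal_iff)
      have zero: "f x = 0" if "\<tau> x \<le> \<epsilon>" for x
        using \<epsilon>(2) closure_subset[of "{x \<in> UNIV. f x \<noteq> 0}"] that by (auto simp: not_less[symmetric])
      show "((\<lambda>t. mass / tail t * (\<integral>\<omega>. f (T (inverse t) (\<xi> \<omega>)) \<partial>M)) \<longlongrightarrow> (\<integral>x. f x \<partial>homogeneous \<alpha>)) at_top"
      proof (rule order_tendstoI)
        fix l assume l: "l < (\<integral>x. f x \<partial>homogeneous \<alpha>)"
        show "eventually (\<lambda>t. l < mass / tail t * (\<integral>\<omega>. f (T (inverse t) (\<xi> \<omega>)) \<partial>M)) at_top"
          by (rule test_function_lower_bound[OF f(1) bd _ \<epsilon>(1) l]) (rule zero)
      next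
        fix l assume "(\<integral>x. f x \<partial>homogeneous \<alpha>) < l"
        then have "- l < (\<integral>x. - f x \<partial>homogeneous \<alpha>)" by simp
        then have "eventually (\<lambda>t. - l < mass / tail t * (\<integral>\<omega>. - f (T (inverse t) (\<xi> \<omega>)) \<partial>M)) at_top"
          using bd zero by (intro test_function_lower_bound[OF continuous_on_minus[OF f(1)] _ _ \<epsilon>(1)]) auto
        then show "eventually (\<lambda>t. mass / tail t * (\<integral>\<omega>. f (T (inverse t) (\<xi> \<omega>)) \<partial>M) < l) at_top"
          by eventually_elim simp
      qed
    qed
  qed
qed

lemma polar_limit_imp_modulus_regularly_varying:
  "\<exists>g\<in>RV_class \<alpha>. regularly_varying_variable M (\<lambda>\<omega>. \<tau> (\<xi> \<omega>)) g"
proof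
  have pt: "power_tail M (\<lambda>\<omega>. \<tau> (\<xi> \<omega>)) \<alpha>" using polar by (simp add: polar_limit_def)
  have \<tau>\<xi>: "(\<lambda>\<omega>. \<tau> (\<xi> \<omega>)) \<in> borel_measurable M" by measurable
  show "(\<lambda>t. mass / tail t) \<in> RV_class \<alpha>"
    using inverse_tail_normalising(4)[OF prob_M \<tau>\<xi> mass_pos pt, folded tail_def] .
  show "regularly_varying_variable M (\<lambda>\<omega>. \<tau> (\<xi> \<omega>)) (\<lambda>t. mass / tail t)"
    by (rule in_RV_modulus[OF polar_limit_imp_in_RV])
qed

end

lemma modulus_regularly_varying_imp_power_tail:
  assumes g: "g \<in> RV_class \<alpha>" and rv: "regularly_varying_variable M (\<lambda>\<omega>. \<tau> (\<xi> \<omega>)) g"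
  shows "power_tail M (\<lambda>\<omega>. \<tau> (\<xi> \<omega>)) \<alpha>"
proof -
  obtain \<mu> where \<mu>: "in_RV M (\<lambda>\<omega>. \<tau> (\<xi> \<omega>)) {0..} (\<lambda>t x. t * x) (modulus_ideal {0..} (\<lambda>x. x)) g \<mu>"
    using rv unfolding regularly_varying_variable_def by blast
  have "(\<lambda>\<omega>. \<tau> (\<xi> \<omega>)) \<in> borel_measurable M" by measurable
  then show ?thesis by (rule in_RV_half_line_power_tail[OF prob_M _ g \<mu>])
qed

section \<open>Joint limits on product sets\<close>

definition product_limit :: "real \<Rightarrow> bool" where
  "product_limit \<alpha> \<longleftrightarrow> (\<forall>A\<in>sets \<sigma>. emeasure \<sigma> (top_of_set sphere frontier_of A) = 0 \<longrightarrow> (\<forall>u\<ge>1.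
     ((\<lambda>t. excess (indicator A) (u * t) / tail t) \<longlongrightarrow> measure \<sigma> A * u powr (- \<alpha>) / mass) at_top))"

lemma measure_product_theta:
  assumes \<alpha>: "0 < \<alpha>" and A: "A \<in> sets \<sigma>" and u: "0 < u"
  shows "measure (\<sigma> \<Otimes>\<^sub>M theta \<alpha>) (A \<times> {u<..}) = measure \<sigma> A * u powr (- \<alpha>)"
proof -
  interpret theta: sigma_finite_measure "theta \<alpha>" by (rule sigma_finite_theta)
  show ?thesis
    unfolding measure_def theta.emeasure_pair_measure_Times[OF A emeasure_theta(1)[OF \<alpha> u]] emeasure_theta(2)[OF \<alpha> u]
    by (simp add: enn2real_mult)
qed

text \<open>
  Since \<open>u \<ge> 1\<close>, the event \<open>\<tau>(\<xi>) > u t\<close> is contained in the condition \<open>\<tau>(\<xi>) > t\<close>.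
\<close>

lemma cond_prob_polar:
  assumes A: "A \<in> sets \<sigma>" and u: "1 \<le> u" and t: "0 < t"
  shows "cond_prob M (\<lambda>\<omega>. (direction (\<xi> \<omega>), inverse t * \<tau> (\<xi> \<omega>)) \<in> A \<times> {u<..}) (\<lambda>\<omega>. t < \<tau> (\<xi> \<omega>))
    = excess (indicator A) (u * t) / tail t"
proof -
  have ut: "t \<le> u * t" using u t by simp
  have "u < inverse t * \<tau> (\<xi> \<omega>) \<longleftrightarrow> u * t < \<tau> (\<xi> \<omega>)" for \<omega>
    using t by (simp add: field_simps)
  then have "{\<omega> \<in> space M. (direction (\<xi> \<omega>), inverse t * \<tau> (\<xi> \<omega>)) \<in> A \<times> {u<..} \<and> t < \<tau> (\<xi> \<omega>)}
      = {\<omega> \<in> space M. u * t < \<tau> (\<xi> \<omega>) \<and> direction (\<xi> \<omega>) \<in> A}"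
    using ut by auto
  moreover have "0 \<le> u * t" using u t by simp
  ultimately show ?thesis
    unfolding cond_prob_def excess_indicator[OF A \<open>0 \<le> u * t\<close>] tail_def by simp
qed

lemma product_limit_iff:
  assumes \<alpha>: "0 < \<alpha>"
  shows "product_limit \<alpha> \<longleftrightarrow>
    (\<forall>A \<in> sets \<sigma>. emeasure \<sigma> (top_of_set sphere frontier_of A) = 0 \<longrightarrow> (\<forall>u\<ge>1.
      ((\<lambda>t. cond_prob M (\<lambda>\<omega>. (direction (\<xi> \<omega>), inverse t * \<tau> (\<xi> \<omega>)) \<in> A \<times> {u<..}) (\<lambda>\<omega>. t < \<tau> (\<xi> \<omega>)))
        \<longlongrightarrow> measure (\<sigma> \<Otimes>\<^sub>M theta \<alpha>) (A \<times> {u<..}) / mass) at_top))"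
proof -
  let ?P = "\<lambda>A u t. cond_prob M (\<lambda>\<omega>. (direction (\<xi> \<omega>), inverse t * \<tau> (\<xi> \<omega>)) \<in> A \<times> {u<..}) (\<lambda>\<omega>. t < \<tau> (\<xi> \<omega>))"
  have "((\<lambda>t. excess (indicator A) (u * t) / tail t) \<longlongrightarrow> measure \<sigma> A * u powr (- \<alpha>) / mass) at_top \<longleftrightarrow>
      ((\<lambda>t. ?P A u t)
        \<longlongrightarrow> measure (\<sigma> \<Otimes>\<^sub>M theta \<alpha>) (A \<times> {u<..}) / mass) at_top"
    if A: "A \<in> sets \<sigma>" and u: "1 \<le> u" for A u
  proof -
    have "eventually (\<lambda>t. excess (indicator A) (u * t) / tail t =
        ?P A u t) at_top"
      using eventually_gt_at_top[of 0] by eventually_elim (rule cond_prob_polar[OF A u, symmetric])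
    from tendsto_cong[OF this] show ?thesis
      using measure_product_theta[OF \<alpha> A, of u] u by simp
  qed
  then show ?thesis
    unfolding product_limit_def by simp
qed

text \<open>
  The conditional probability factors into the probability of \<open>A\<close> under the law of the direction at level \<open>u * t\<close>
  and the ratio of the tails at \<open>u * t\<close> and \<open>t\<close>.
\<close>

lemma polar_limit_imp_product_limit:
  assumes "polar_limit \<alpha>"
  shows "product_limit \<alpha>"
  unfolding product_limit_def
proof (intro ballI impI allI)
  fix A and u :: real
  assume A: "A \<in> sets \<sigma>" "emeasure \<sigma> (top_of_set sphere frontier_of A) = 0" and u: "1 \<le> u"
  note pos = tail_pos[OF assms]
  have "((\<lambda>t. measure (law t) A) \<longlongrightarrow> measure spherical_law A) at_top"
  proof (rule weak_convergence_imp_continuity_set_convergence)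
    show "weakly_converges_on sphere law spherical_law at_top" using assms by (simp add: polar_limit_def)
    show "eventually (\<lambda>t. prob_space (law t) \<and> sets (law t) = sets (restrict_space borel sphere)) at_top"
      using eventually_ge_at_top[of 0] by eventually_elim (use prob_space_law pos sets_law in auto)
    show "A \<in> sets spherical_law" using A(1) by (simp add: sets_spherical_law sets_\<sigma>)
    show "emeasure spherical_law (top_of_set sphere frontier_of A) = 0"
      using A(2) by (simp add: emeasure_spherical_law)
  qed (rule functionally_open_sphere prob_space_spherical_law sets_spherical_law; assumption?)+
  moreover have "eventually (\<lambda>t. measure (law t) A = excess (indicator A) t / tail t) at_top"
    using eventually_ge_at_top[of 0] by eventually_elim (rule measure_law[OF _ pos A(1)])
  ultimately have "((\<lambda>t. excess (indicator A) t / tail t) \<longlongrightarrow> measure \<sigma> A / mass) at_top"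
    by (simp add: tendsto_cong measure_spherical_law)
  from filterlim_compose[OF this filterlim_mult_const_at_top, of u]
  have "((\<lambda>t. (excess (indicator A) (u * t) / tail (u * t)) * (tail (u * t) / tail t)) \<longlongrightarrow>
      measure \<sigma> A / mass * u powr (- \<alpha>)) at_top"
    using u by (intro tendsto_mult tail_ratio[OF assms]) auto
  moreover have "(excess (indicator A) (u * t) / tail (u * t)) * (tail (u * t) / tail t) = excess (indicator A) (u * t) / tail t" for t
    using pos[of "u * t"] by simp
  ultimately show "((\<lambda>t. excess (indicator A) (u * t) / tail t) \<longlongrightarrow> measure \<sigma> A * u powr (- \<alpha>) / mass) at_top"
    by (simp only: times_divide_eq_left)
qed

text \<open>
  Taking the whole sphere for \<open>A\<close> gives the tail asymptotics for \<open>u \<ge> 1\<close>, and by inversion for all \<open>u > 0\<close>; taking \<open>u = 1\<close>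
  gives the convergence of the laws of the direction on continuity sets.
\<close>

lemma product_limit_imp_polar_limit:
  assumes \<alpha>: "0 < \<alpha>" and tau: "tau_additive_on sphere \<sigma>" and pl: "product_limit \<alpha>"
  shows "polar_limit \<alpha>"
proof -
  have ratio1: "((\<lambda>t. tail (u * t) / tail t) \<longlongrightarrow> u powr (- \<alpha>)) at_top" if u: "1 \<le> u" for u
  proof -
    have "emeasure \<sigma> (top_of_set sphere frontier_of sphere) = 0"
      using frontier_of_topspace[of "top_of_set sphere"] by simp
    then have "((\<lambda>t. excess (indicator sphere) (u * t) / tail t) \<longlongrightarrow> mass * u powr (- \<alpha>) / mass) at_top"
      using pl sphere_sets u unfolding product_limit_def by blast
    moreover have "eventually (\<lambda>t. excess (indicator sphere) (u * t) / tail t = tail (u * t) / tail t) at_top"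
      using eventually_ge_at_top[of 0]
    proof eventually_elim
      case (elim t)
      then have ut: "0 \<le> u * t" using u by simp
      have "{\<omega> \<in> space M. u * t < \<tau> (\<xi> \<omega>) \<and> direction (\<xi> \<omega>) \<in> sphere} = {\<omega> \<in> space M. u * t < \<tau> (\<xi> \<omega>)}"
        using ut direction_in_sphere by auto
      then show ?case by (simp add: excess_indicator[OF sphere_sets ut] tail_def)
    qed
    ultimately show ?thesis
      using mass_pos by (simp add: tendsto_cong)
  qed
  have \<tau>\<xi>: "(\<lambda>\<omega>. \<tau> (\<xi> \<omega>)) \<in> borel_measurable M" by measurable
  have pt: "power_tail M (\<lambda>\<omega>. \<tau> (\<xi> \<omega>)) \<alpha>"
  proof (rule power_tailI[OF prob_M \<tau>\<xi>, where c=1 and g="\<lambda>t. 1 / tail t"])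
    fix u :: real assume u: "0 < u"
    have "((\<lambda>t. tail (u * t) / tail t) \<longlongrightarrow> u powr (- \<alpha>)) at_top"
    proof (cases "1 \<le> u")
      case False
      then have v: "1 \<le> inverse u" using u by (simp add: one_le_inverse_iff)
      have "((\<lambda>t. inverse (tail (inverse u * (u * t)) / tail (u * t))) \<longlongrightarrow> inverse (inverse u powr (- \<alpha>))) at_top"
        by (intro tendsto_inverse filterlim_compose[OF ratio1[OF v] filterlim_mult_const_at_top[OF u]]) (use u in simp)
      moreover have "inverse u * (u * t) = t" for t
        using u by (simp flip: mult.assoc)
      moreover have "inverse (inverse u powr (- \<alpha>)) = u powr (- \<alpha>)"
        using u by (simp add: powr_minus inverse_powr)
      ultimately show ?thesis by (simp only: inverse_divide)
    qed (rule ratio1)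
    then show "((\<lambda>t. 1 / tail t * measure M {\<omega> \<in> space M. u * t < \<tau> (\<xi> \<omega>)}) \<longlongrightarrow> 1 * u powr (- \<alpha>)) at_top"
      by (simp add: tail_def)
  qed simp
  then have pos: "0 < tail t" for t by (simp add: power_tail_tail)
  have "weakly_converges_on sphere law spherical_law at_top"
    unfolding weakly_converges_on_def
  proof (intro allI impI tendsto_at_topI_sequentially)
    fix k :: "'a \<Rightarrow> real" and X :: "nat \<Rightarrow> real"
    assume k: "continuous_on sphere k \<and> bounded (k ` sphere)" and X: "filterlim X at_top sequentially"
    \<comment> \<open>At negative levels \<open>law\<close> need not be a probability measure, as the direction is arbitrary where \<open>\<tau>\<close> vanishes.\<close>
    have "weakly_converges_on sphere (\<lambda>n. law (max 0 (X n))) spherical_law sequentially"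
    proof (rule continuity_set_convergence_imp_weak_convergence)
      show "prob_space (law (max 0 (X n)))" for n by (rule prob_space_law[OF _ pos]) simp
      fix A assume A: "A \<in> sets spherical_law" "emeasure spherical_law (top_of_set sphere frontier_of A) = 0"
      have A': "A \<in> sets \<sigma>" using A(1) by (simp add: sets_spherical_law sets_\<sigma>)
      have A0: "emeasure \<sigma> (top_of_set sphere frontier_of A) = 0"
        using A(2) mass_pos by (simp add: emeasure_spherical_law)
      have "((\<lambda>t. excess (indicator A) (1 * t) / tail t) \<longlongrightarrow> measure \<sigma> A * 1 powr (- \<alpha>) / mass) at_top"
        using pl A' A0 unfolding product_limit_def by blast
      then have "((\<lambda>t. excess (indicator A) t / tail t) \<longlongrightarrow> measure \<sigma> A / mass) at_top" by simp
      moreover have "filterlim (\<lambda>n. max 0 (X n)) at_top sequentially"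
        by (rule filterlim_at_top_mono[OF X]) simp
      ultimately have "(\<lambda>n. excess (indicator A) (max 0 (X n)) / tail (max 0 (X n))) \<longlonglongrightarrow> measure \<sigma> A / mass"
        by (rule filterlim_compose)
      then show "(\<lambda>n. measure (law (max 0 (X n))) A) \<longlonglongrightarrow> measure spherical_law A"
        by (simp add: measure_law[OF _ pos A'] measure_spherical_law)
    qed (rule sets_law prob_space_spherical_law sets_spherical_law)+
    then have "(\<lambda>n. \<integral>s. k s \<partial>law (max 0 (X n))) \<longlonglongrightarrow> (\<integral>s. k s \<partial>spherical_law)"
      using k unfolding weakly_converges_on_def by blast
    moreover have "eventually (\<lambda>n. (\<integral>s. k s \<partial>law (max 0 (X n))) = (\<integral>s. k s \<partial>law (X n))) sequentially"
    proof -
      have "eventually (\<lambda>n. 0 \<le> X n) sequentially"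
        using X by (simp add: filterlim_at_top)
      then show ?thesis by eventually_elim (simp add: max_absorb2)
    qed
    ultimately show "(\<lambda>n. \<integral>s. k s \<partial>law (X n)) \<longlonglongrightarrow> (\<integral>s. k s \<partial>spherical_law)"
      by (simp add: tendsto_cong)
  qed
  then show ?thesis
    unfolding polar_limit_def using \<alpha> tau pt by blast
qed

end

section \<open>Equivalence of the three statements\<close>

theorem proposition3p4p2:
  fixes M :: "'w measure"
    and \<xi> :: "'w \<Rightarrow> 'a::topological_space"
    and T :: "real \<Rightarrow> 'a \<Rightarrow> 'a"
    and \<tau> :: "'a \<Rightarrow> real"
    and \<sigma> :: "'a measure"
  assumes "perfectly_normal_on (UNIV :: 'a set)"
    and "continuous_scaling_on UNIV T"
    and "continuous_finite_modulus_on UNIV T \<tau>"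
    and "prob_space M"
    and "\<xi> \<in> measurable M borel"
    and "sets \<sigma> = sets (restrict_space borel (modulus_sphere UNIV \<tau>))"
    and "finite_measure \<sigma>"
    and "emeasure \<sigma> (modulus_sphere UNIV \<tau>) \<noteq> 0"
  shows
    "let S = modulus_sphere UNIV \<tau>;
         stmt_i =
           (\<exists>g \<mu>. in_RV M \<xi> UNIV T (modulus_ideal UNIV \<tau>) g \<mu> \<and> tau_additive_on UNIV \<mu> \<and>
             (\<exists>\<alpha>>0. \<forall>B \<in> sets borel. B \<in> modulus_ideal UNIV \<tau> \<longrightarrow>
                emeasure \<mu> B =
                  ennreal \<alpha> * (\<integral>\<^sup>+ t \<in> {0<..}. emeasure \<sigma> (T t ` B \<inter> S) * ennreal (t powr (\<alpha> - 1)) \<partial>lborel)));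
         stmt_ii =
           ((\<exists>\<alpha>>0. \<exists>g \<in> RV_class \<alpha>. regularly_varying_variable M (\<lambda>\<omega>. \<tau> (\<xi> \<omega>)) g) \<and>
            tau_additive_on S \<sigma> \<and>
            weakly_converges_on S
              (\<lambda>t. conditional_law M (restrict_space borel S)
                     (\<lambda>\<omega>. T (inverse (\<tau> (\<xi> \<omega>))) (\<xi> \<omega>)) {\<omega> \<in> space M. \<tau> (\<xi> \<omega>) > t})
              (scale_measure (1 / emeasure \<sigma> S) \<sigma>) at_top);
         stmt_iii =
           (tau_additive_on S \<sigma> \<and>
            (\<exists>\<alpha>>0. \<forall>A \<in> sets \<sigma>. emeasure \<sigma> (top_of_set S frontier_of A) = 0 \<longrightarrow> (\<forall>u\<ge>1.
               ((\<lambda>t. cond_prob M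
                       (\<lambda>\<omega>. (T (inverse (\<tau> (\<xi> \<omega>))) (\<xi> \<omega>), inverse t * \<tau> (\<xi> \<omega>)) \<in> A \<times> {u<..})
                       (\<lambda>\<omega>. \<tau> (\<xi> \<omega>) > t))
                 \<longlongrightarrow> measure (\<sigma> \<Otimes>\<^sub>M theta \<alpha>) (A \<times> {u<..}) / measure \<sigma> S) at_top)))
     in (stmt_i \<longleftrightarrow> stmt_ii) \<and> (stmt_ii \<longleftrightarrow> stmt_iii)"
proof -
  interpret scaled_random_element T \<tau> \<sigma> M \<xi>
    by (intro scaled_random_element.intro spherical_measure.intro scaled_space.intro
        spherical_measure_axioms.intro scaled_random_element_axioms.intro assms)
  have ii: "((\<exists>\<alpha>>0. \<exists>g \<in> RV_class \<alpha>. regularly_varying_variable M (\<lambda>\<omega>. \<tau> (\<xi> \<omega>)) g) \<and>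
      tau_additive_on sphere \<sigma> \<and> weakly_converges_on sphere law spherical_law at_top) \<longleftrightarrow> (\<exists>\<alpha>. polar_limit \<alpha>)"
    using polar_limit_imp_modulus_regularly_varying modulus_regularly_varying_imp_power_tail
    unfolding polar_limit_def by blast
  have iii: "(tau_additive_on sphere \<sigma> \<and> (\<exists>\<alpha>>0. product_limit \<alpha>)) \<longleftrightarrow> (\<exists>\<alpha>. polar_limit \<alpha>)"
    using polar_limit_imp_product_limit product_limit_imp_polar_limit
    unfolding polar_limit_def by blast
  have chain: "(I \<longleftrightarrow> P) \<Longrightarrow> (II \<longleftrightarrow> P) \<Longrightarrow> (III \<longleftrightarrow> P) \<Longrightarrow> (I \<longleftrightarrow> II) \<and> (II \<longleftrightarrow> III)" for I II III P
    by blast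
  show ?thesis
    unfolding Let_def
  proof (rule chain[of _ "\<exists>\<alpha>. polar_limit \<alpha>"], goal_cases)
    case 1
    show ?case
    proof (intro iffI, goal_cases)
      case 1
      then show ?case using in_RV_imp_polar_limit by blast
    next
      case 2
      then obtain \<alpha> where \<alpha>: "polar_limit \<alpha>" ..
      have "tau_additive_on UNIV (homogeneous \<alpha>)"
        using \<alpha> by (intro tau_additive_homogeneous) (simp add: polar_limit_def)
      with polar_limit_imp_in_RV[OF \<alpha>] polar_limit_pos[OF \<alpha>] emeasure_homogeneous_scaled[OF polar_limit_pos[OF \<alpha>]]
      show ?case by blast
    qed
  next
    case 2
    show ?case using ii unfolding law_def spherical_law_def direction_def .
  next
    case 3
    show ?case
      using iii by (simp only: product_limit_iff[unfolded direction_def] cong: conj_cong)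
  qed
qed

end
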